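(* Let $\kappa$ be a perfect field of prime characteristic $p$, let $r\ge 2$ and $n\geq 1$ be integers, let $X_k=(x^{(k)}_{i,j})$, $1\le k\le r$, be $n\times n$ matrices of distinct indeterminates, and let $S=\kappa[x^{(k)}_{i,j}\mid i,j\in\{1,\dots,n\},\,k\in\{1,\dots,r\}]$. Let $H=\begin{pmatrix}X_1&\cdots&X_r\end{pmatrix}$ be the $n\times rn$ horizontal concatenation and $V$ the $rn\times n$ vertical concatenation (with $X_1$ on top, then $X_2$, and so on) of $X_1,\dots,X_r$. Define $$f=\prod_{k=1}^r\det X_k\;\prod_{u=1}^{n-1}\Delta_u\Delta^u\in S,$$ where $\Delta^u$ and $\Delta_u$ are the minors defined in the context. Then the double determinantal ideal $I=I_n(H)+I_n(V)$ is a Knutson ideal of $f$. In particular, $\mathrm{Tr}(f^{p-1}\bullet)$ is a Frobenius splitting of $S$ that compatibly splits $I$.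
   Context: $I_n(M)$ denotes the ideal generated by the $n$-minors of a matrix $M$. **The matrices $D^*$ and $D_*$.** Both are block matrices with $n\times n$ blocks. - $D^*$ has block rows $k=1,\dots,\lceil r/2\rceil$. In block row $k$, the block in block column $k$ is $X_{2k-1}$, the block in block column $k+1$ is $X_{2k}$ (if $2k\le r$), and all other blocks are $0$. Thus $D^*$ has $\frac r2$ block rows and $\frac r2+1$ block columns if $r$ is even, and $\frac{r+1}2$ block rows and $\frac{r+1}{2}$ block columns if $r$ is odd. For example, for $r=3$, $D^*=\begin{pmatrix} X_1 & X_2 \\ 0 & X_3 \end{pmatrix}$. - $D_*$ has block columns $k=1,\dots,\lceil r/2\rceil$. In block column $k$, the block in block row $k$ is $X_{2k-1}$, the block in block row $k+1$ is $X_{2k}$ (if $2k\le r$), and all other blocks are $0$. Thus $D_*$ has $\frac r2+1$ block rows and $\frac r2$ block columns if $r$ is even, and $\frac{r+1}2$ of each if $r$ is odd. For example, for $r=3$, $D_*=\begin{pmatrix} X_1 & 0 \\ X_2 & X_3 \end{pmatrix}$. **The minors.** For $1\le s\le n-1$, let $\delta^s$ be the diagonal of $D^*$ starting from the entry $x^{(1)}_{1,s+1}$ (in row $1$, column $s+1$) and continuing down and to the right until it leaves the matrix; $\Delta^s$ is the minor of $D^*$ whose main diagonal is $\delta^s$. That is, $\Delta^s$ uses rows $1,\dots,L$ and columns $s+1,\dots,s+L$, where $L$ is the minimum of the number of rows of $D^*$ and the number of columns of $D^*$ minus $s$. Likewise, let $\delta_s$ be the diagonal of $D_*$ starting from $x^{(1)}_{s+1,1}$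 (in row $s+1$, column $1$) and let $\Delta_s$ be the minor of $D_*$ whose main diagonal is $\delta_s$: rows $s+1,\dots,s+L'$, columns $1,\dots,L'$, where $L'$ is the minimum of the number of columns of $D_*$ and the number of rows of $D_*$ minus $s$. **Knutson ideals.** Let $f\in S$ be a polynomial whose leading term with respect to some term order is the product of all the variables of $S$. $\mathcal C_f$ is the smallest set of ideals of $S$ such that (1) $(f)\in\mathcal C_f$; (2) if $I\in\mathcal C_f$ then $I:J\in\mathcal C_f$ for every ideal $J$ of $S$; (3) if $I,J\in\mathcal C_f$ then $I+J\in\mathcal C_f$ and $I\cap J\in\mathcal C_f$. Elements of $\mathcal C_f$ are called Knutson ideals of $f$. **Frobenius splittings and trace.** A Frobenius splitting of $S$ is an additive map $\varphi:S\to S$ with $\varphi(a^pb)=a\varphi(b)$ and $\varphi(1)=1$; it compatibly splits an ideal $I$ if $\varphi(I)\subseteq I$. Let $\pi$ be the product of all variables of $S$. $\mathrm{Tr}:S\to S$ is the additive map with $\mathrm{Tr}(am)=a^{1/p}\,\mathrm{Tr}(m)$ for $a\in\kappa$ and $m$ a monomial, where $\mathrm{Tr}(m)=\sqrt[p]{m\pi}/\pi$ if $m\pi$ is a $p$-th power of a monomial, and $\mathrm{Tr}(m)=0$ otherwise. $\mathrm{Tr}(h\,\bullet)$ denotes the map $a\mapsto\mathrm{Tr}(ha)$. *)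

theory Defs
  imports
    "HOL-Library.Poly_Mapping"
    "HOL-Algebra.Ideal"
    "HOL-Computational_Algebra.Primes"
    "Jordan_Normal_Form.Determinant"
    "Jordan_Normal_Form.DL_Submatrix"
begin

section \<open>Polynomial rings, monomials and term orders\<close>

text \<open>A monomial is identified with its exponent vector; \<open>Poly_Mapping.single m c\<close> is the
  polynomial \<open>c\<cdot>m\<close>, and multiplication of monomials is addition of exponent vectors.\<close>

type_synonym 'v monomial = "'v \<Rightarrow>\<^sub>0 nat"
type_synonym ('v, 'k) mpoly = "('v \<Rightarrow>\<^sub>0 nat) \<Rightarrow>\<^sub>0 'k"

definition mvar :: "'v \<Rightarrow> ('v, 'k::comm_ring_1) mpoly" where
  "mvar v = Poly_Mapping.single (Poly_Mapping.single v 1) 1"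

definition monomials_in :: "'v set \<Rightarrow> 'v monomial set" where
  "monomials_in V = {m. Poly_Mapping.keys m \<subseteq> V}"

definition mpoly_ring :: "'v set \<Rightarrow> ('v, 'k::comm_ring_1) mpoly ring" where
  "mpoly_ring V =
     \<lparr>carrier = {g. Poly_Mapping.keys g \<subseteq> monomials_in V},
      monoid.mult = (*), one = 1, zero = 0, add = (+)\<rparr>"

text \<open>For finite \<open>V\<close> a term order is automatically a well-order (Dickson's lemma).\<close>

definition term_order :: "'v set \<Rightarrow> 'v monomial rel \<Rightarrow> bool" where
  "term_order V ord \<longleftrightarrow>
     linear_order_on (monomials_in V) ord \<and>
     (\<forall>m \<in> monomials_in V. (0, m) \<in> ord) \<and>
     (\<forall>a b c. (a, b) \<in> ord \<longrightarrow> c \<in> monomials_in V \<longrightarrow> (a + c, b + c) \<in> ord)"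

text \<open>The leading term includes the coefficient; the leading term of \<open>0\<close> is \<open>0\<close>.\<close>

definition leading_term :: "'v monomial rel \<Rightarrow> ('v, 'k::comm_ring_1) mpoly \<Rightarrow> ('v, 'k) mpoly" where
  "leading_term ord g =
     (let m = (THE m. m \<in> Poly_Mapping.keys g \<and> (\<forall>m' \<in> Poly_Mapping.keys g. (m', m) \<in> ord))
      in Poly_Mapping.single m (Poly_Mapping.lookup g m))"


section \<open>Knutson ideals\<close>

definition colon_ideal :: "('a, 'b) ring_scheme \<Rightarrow> 'a set \<Rightarrow> 'a set \<Rightarrow> 'a set" where
  "colon_ideal R I J = {a \<in> carrier R. \<forall>b \<in> J. a \<otimes>\<^bsub>R\<^esub> b \<in> I}"

inductive_set knutson_class :: "('a, 'b) ring_scheme \<Rightarrow> 'a \<Rightarrow> 'a set set"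
  for R :: "('a, 'b) ring_scheme" and f :: 'a where
  principal: "PIdl\<^bsub>R\<^esub> f \<in> knutson_class R f"
| colon: "I \<in> knutson_class R f \<Longrightarrow> ideal J R \<Longrightarrow> colon_ideal R I J \<in> knutson_class R f"
| sum: "I \<in> knutson_class R f \<Longrightarrow> J \<in> knutson_class R f \<Longrightarrow> I <+>\<^bsub>R\<^esub> J \<in> knutson_class R f"
| inter: "I \<in> knutson_class R f \<Longrightarrow> J \<in> knutson_class R f \<Longrightarrow> I \<inter> J \<in> knutson_class R f"

text \<open>The requirement on the leading term of \<open>f\<close> is part of the notion.\<close>

definition knutson_ideal ::
    "'v set \<Rightarrow> ('v, 'k::comm_ring_1) mpoly \<Rightarrow> ('v, 'k) mpoly set \<Rightarrow> bool" where
  "knutson_ideal V f I \<longleftrightarrow>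
     f \<in> carrier (mpoly_ring V) \<and>
     (\<exists>ord. term_order V ord \<and> leading_term ord f = (\<Prod>v\<in>V. mvar v)) \<and>
     I \<in> knutson_class (mpoly_ring V) f"


section \<open>Frobenius splittings and the trace map\<close>

definition frobenius_splitting :: "nat \<Rightarrow> ('a, 'b) ring_scheme \<Rightarrow> ('a \<Rightarrow> 'a) \<Rightarrow> bool" where
  "frobenius_splitting p R \<phi> \<longleftrightarrow>
     \<phi> \<in> carrier R \<rightarrow> carrier R \<and>
     (\<forall>a \<in> carrier R. \<forall>b \<in> carrier R. \<phi> (a \<oplus>\<^bsub>R\<^esub> b) = \<phi> a \<oplus>\<^bsub>R\<^esub> \<phi> b) \<and>
     (\<forall>a \<in> carrier R. \<forall>b \<in> carrier R. \<phi> ((a [^]\<^bsub>R\<^esub> p) \<otimes>\<^bsub>R\<^esub> b) = a \<otimes>\<^bsub>R\<^esub> \<phi> b) \<and>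
     \<phi> \<one>\<^bsub>R\<^esub> = \<one>\<^bsub>R\<^esub>"

definition compatibly_splits :: "('a \<Rightarrow> 'a) \<Rightarrow> 'a set \<Rightarrow> bool" where
  "compatibly_splits \<phi> I \<longleftrightarrow> \<phi> ` I \<subseteq> I"

definition pth_root :: "nat \<Rightarrow> 'k::field \<Rightarrow> 'k" where
  "pth_root p a = (THE b. b ^ p = a)"

definition vars_monomial :: "'v set \<Rightarrow> 'v monomial" where
  "vars_monomial V = (\<Sum>v\<in>V. Poly_Mapping.single v 1)"

definition monomial_pth_power :: "nat \<Rightarrow> 'v monomial \<Rightarrow> 'v monomial \<Rightarrow> bool" where
  "monomial_pth_power p q m \<longleftrightarrow> (\<forall>v. Poly_Mapping.lookup m v = p * Poly_Mapping.lookup q v)"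

text \<open>The truncated subtraction of \<open>\<pi>\<close> below is an exact division: if \<open>m\<pi> = q\<^sup>p\<close>,
  then every variable in \<open>V\<close> occurs in \<open>q\<close>.\<close>

definition trace_monomial :: "nat \<Rightarrow> 'v set \<Rightarrow> 'v monomial \<Rightarrow> ('v, 'k::field) mpoly" where
  "trace_monomial p V m =
     (if \<exists>q. monomial_pth_power p q (m + vars_monomial V)
      then Poly_Mapping.single
             ((THE q. monomial_pth_power p q (m + vars_monomial V)) - vars_monomial V) 1
      else 0)"

definition trace_map :: "nat \<Rightarrow> 'v set \<Rightarrow> ('v, 'k::field) mpoly \<Rightarrow> ('v, 'k) mpoly" where
  "trace_map p V g =
     (\<Sum>m\<in>Poly_Mapping.keys g.
        Poly_Mapping.single 0 (pth_root p (Poly_Mapping.lookup g m)) * trace_monomial p V m)"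


section \<open>Generic matrices and their minors\<close>

definition minors_ideal :: "('a::comm_ring_1, 'b) ring_scheme \<Rightarrow> nat \<Rightarrow> 'a mat \<Rightarrow> 'a set" where
  "minors_ideal R t M =
     Idl\<^bsub>R\<^esub> {det (submatrix M A B) | A B.
        A \<subseteq> {..<dim_row M} \<and> B \<subseteq> {..<dim_col M} \<and> card A = t \<and> card B = t}"

text \<open>The triple \<open>(k, i, j)\<close> indexes the variable \<open>x\<^sup>(\<^sup>k\<^sup>)\<^sub>i\<^sub>j\<close>; all
  three indices start at \<open>1\<close>, whereas matrix positions start at \<open>0\<close>.\<close>

type_synonym 'k gpoly = "(nat \<times> nat \<times> nat, 'k) mpoly"

definition gvars :: "nat \<Rightarrow> nat \<Rightarrow> (nat \<times> nat \<times> nat) set" where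
  "gvars r n = {1..r} \<times> {1..n} \<times> {1..n}"

definition X_mat :: "nat \<Rightarrow> nat \<Rightarrow> 'k::comm_ring_1 gpoly mat" where
  "X_mat n k = mat n n (\<lambda>(i, j). mvar (k, i + 1, j + 1))"

text \<open>The matrix with \<open>R\<close> block rows and \<open>C\<close> block columns whose \<open>n \<times> n\<close> block in block
  row \<open>k\<close> and block column \<open>l\<close> (both counted from \<open>1\<close>) is \<open>B k l\<close>.\<close>

definition block_mat :: "nat \<Rightarrow> nat \<Rightarrow> nat \<Rightarrow> (nat \<Rightarrow> nat \<Rightarrow> 'a mat) \<Rightarrow> 'a mat" where
  "block_mat n R C B =
     mat (R * n) (C * n) (\<lambda>(i, j). B (i div n + 1) (j div n + 1) $$ (i mod n, j mod n))"

definition H_mat :: "nat \<Rightarrow> nat \<Rightarrow> 'k::comm_ring_1 gpoly mat" where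
  "H_mat r n = block_mat n 1 r (\<lambda>_ l. X_mat n l)"

definition V_mat :: "nat \<Rightarrow> nat \<Rightarrow> 'k::comm_ring_1 gpoly mat" where
  "V_mat r n = block_mat n r 1 (\<lambda>k _. X_mat n k)"

text \<open>The matrices \<open>D\<^sup>*\<close> and \<open>D\<^sub>*\<close>. Here \<open>(r + 1) div 2\<close> is \<open>r/2\<close> rounded up, and
  \<open>r div 2 + 1\<close> is \<open>r/2 + 1\<close> for even \<open>r\<close> and \<open>(r + 1)/2\<close> for odd \<open>r\<close>.\<close>

definition D_upper :: "nat \<Rightarrow> nat \<Rightarrow> 'k::comm_ring_1 gpoly mat" where
  "D_upper r n = block_mat n ((r + 1) div 2) (r div 2 + 1)
     (\<lambda>k l. if l = k then X_mat n (2 * k - 1)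
            else if l = k + 1 \<and> 2 * k \<le> r then X_mat n (2 * k)
            else 0\<^sub>m n n)"

definition D_lower :: "nat \<Rightarrow> nat \<Rightarrow> 'k::comm_ring_1 gpoly mat" where
  "D_lower r n = block_mat n (r div 2 + 1) ((r + 1) div 2)
     (\<lambda>l k. if l = k then X_mat n (2 * k - 1)
            else if l = k + 1 \<and> 2 * k \<le> r then X_mat n (2 * k)
            else 0\<^sub>m n n)"

definition Delta_upper :: "nat \<Rightarrow> nat \<Rightarrow> nat \<Rightarrow> 'k::comm_ring_1 gpoly" where
  "Delta_upper r n s =
     (let D = D_upper r n; L = min (dim_row D) (dim_col D - s)
      in det (submatrix D {0..<L} {s..<s + L}))"

definition Delta_lower :: "nat \<Rightarrow> nat \<Rightarrow> nat \<Rightarrow> 'k::comm_ring_1 gpoly" where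
  "Delta_lower r n s =
     (let D = D_lower r n; L = min (dim_col D) (dim_row D - s)
      in det (submatrix D {s..<s + L} {0..<L}))"

definition f_poly :: "nat \<Rightarrow> nat \<Rightarrow> 'k::comm_ring_1 gpoly" where
  "f_poly r n =
     (\<Prod>k = 1..r. det (X_mat n k)) * (\<Prod>u = 1..n - 1. Delta_lower r n u * Delta_upper r n u)"

definition double_det_ideal :: "nat \<Rightarrow> nat \<Rightarrow> 'k::comm_ring_1 gpoly set" where
  "double_det_ideal r n =
     (let S = mpoly_ring (gvars r n)
      in minors_ideal S n (H_mat r n) <+>\<^bsub>S\<^esub> minors_ideal S n (V_mat r n))"

end

theory Submission
  imports Defs "HOL-Library.Product_Lexorder"
begin

text \<open>
  Order the variables \<open>(k, i, j)\<close> lexicographically, the smallest triple being the most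
  significant one, and use the lexicographic order on monomials; this is the order that the
  linear order on finitely supported functions provides. In every matrix below the variables
  increase along rows and along columns, so the leading monomial of a minor is the product of
  its main diagonal as soon as no entry of that diagonal vanishes (\<open>lm_det_variables\<close>). The
  diagonals of the factors of \<open>f\<close> partition the set of all variables, which gives the leading
  term of \<open>f\<close> (\<open>lm_f_poly\<close>). From the leading term alone it follows that the trace of
  \<open>f ^ (p - 1)\<close> is \<open>1\<close>, and every ideal built from \<open>(f)\<close> by colons, sums and intersections is
  preserved by the splitting. The remaining task is to build the ideals of maximal minors
  of \<open>H\<close> and \<open>V\<close> in this way.

  The main tool is \<open>max_minors_ideal_eq_colon\<close>. Let \<open>X\<close> be an \<open>n \<times> N\<close> matrix of variables
  with last row \<open>y\<close>, and let \<open>J\<close> be an ideal contained in \<open>I\<^sub>n(X)\<close> that contains \<open>N - n + 1\<close>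
  polynomials \<open>g\<^sub>u\<close> that are linear in \<open>y\<close>, vanish when \<open>y\<close> is replaced by another row
  of \<open>X\<close>, and have leading monomials containing different variables of \<open>y\<close>. Then
  \<open>I\<^sub>n(X) = J : b\<close> for some \<open>b\<close>. Indeed, if \<open>M\<close> is the minor of the first \<open>n - 1\<close> rows and columns and
  \<open>h\<^sub>j\<close> are the \<open>n\<close>-minors bordering it, then \<open>M g\<^sub>u\<close> is a combination of the \<open>h\<^sub>j\<close> with a
  square coefficient matrix \<open>C\<close>. The leading monomials show that \<open>det C\<close> is not zero, and by Cramer's
  rule \<open>b = M det C\<close> multiplies every \<open>n\<close>-minor into \<open>J\<close>. Conversely \<open>b\<close> does not involve \<open>y\<close>,
  and \<open>I\<^sub>n(X)\<close> is the kernel of the homomorphism to a domain that substitutes a generic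
  combination of the other rows for \<open>y\<close>; so \<open>b g \<in> J\<close> implies \<open>g \<in> I\<^sub>n(X)\<close>.

  That the kernel is not larger than \<open>I\<^sub>n(X)\<close> is \<open>param_eq_0_imp_in_ideal\<close>. Subtracting
  multiples of minors, one reaches an element whose leading monomial is divisible by no diagonal
  of an \<open>n\<close>-minor. For such a monomial there are \<open>n - 1\<close> columns such that its variables avoid
  certain gaps between these columns (\<open>greedy_columns\<close>). There is a matrix of rank less than \<open>n\<close>
  over the field of rational functions whose entries outside the gaps are the variables
  themselves, while the entries in the gaps are too small to disturb leading monomials. The
  element does not vanish at this matrix (\<open>param_nonzero\<close>), so it is not in the kernel.

  The tool is applied twice. For two neighbouring blocks, \<open>J\<close> is generated by
  \<open>n + 1\<close> factors of \<open>f\<close>: the two determinants and, depending on the parity of the position,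
  the minors \<open>\<Delta>\<^sup>s\<close> or the minors \<open>\<Delta>\<^sub>s\<close> (\<open>pair_ideal_knutson\<close>). Then the ideals
  of all neighbouring pairs generate an ideal that contains every minor of consecutive columns
  of \<open>H\<close>, and the tool yields \<open>I\<^sub>n(H)\<close> (\<open>window_ideal_knutson\<close>). Transposing all blocks
  gives \<open>I\<^sub>n(V)\<close>.
\<close>

abbreviation lookup :: "('a \<Rightarrow>\<^sub>0 'b::zero) \<Rightarrow> 'a \<Rightarrow> 'b" where
  "lookup \<equiv> Poly_Mapping.lookup"

abbreviation keys :: "('a \<Rightarrow>\<^sub>0 'b::zero) \<Rightarrow> 'a set" where
  "keys \<equiv> Poly_Mapping.keys"

abbreviation single :: "'a \<Rightarrow> 'b \<Rightarrow> 'a \<Rightarrow>\<^sub>0 'b::zero" where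
  "single \<equiv> Poly_Mapping.single"

abbreviation polys :: "'v set \<Rightarrow> ('v, 'k::comm_ring_1) mpoly set" where
  "polys V \<equiv> carrier (mpoly_ring V)"

section \<open>Polynomials supported on a set of variables\<close>

lemma mem_polys:
  "g \<in> polys V \<longleftrightarrow> keys g \<subseteq> monomials_in V"
  by (simp add: mpoly_ring_def)

lemma mpoly_ring_simps [simp]:
  "monoid.mult (mpoly_ring V) = (*)" "one (mpoly_ring V) = 1"
  "ring.zero (mpoly_ring V) = 0" "ring.add (mpoly_ring V) = (+)"
  by (simp_all add: mpoly_ring_def)

lemma keys_sum_subset_UN: "keys (sum f A) \<subseteq> (\<Union>a\<in>A. keys (f a))"
proof (induction A rule: infinite_finite_induct)
  case (insert x F)
  then show ?case using Poly_Mapping.keys_add[of "f x" "sum f F"] by auto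
qed auto

lemma monomials_in_add: "a \<in> monomials_in V \<Longrightarrow> b \<in> monomials_in V \<Longrightarrow> a + b \<in> monomials_in V"
  using Poly_Mapping.keys_add[of a b] by (auto simp: monomials_in_def)

context
  fixes V :: "'v set"
begin

lemma polys_single [intro]:
  "m \<in> monomials_in V \<Longrightarrow> single m c \<in> polys V"
  by (auto simp: mem_polys)

lemma polys_const [intro, simp]: "single 0 c \<in> polys V"
  by (rule polys_single) (simp add: monomials_in_def)

lemma polys_0 [intro, simp]: "0 \<in> polys V"
  by (simp add: mem_polys)

lemma polys_1 [intro, simp]: "1 \<in> polys V"
  by (simp add: mem_polys monomials_in_def)

lemma polys_add [intro]:
  "f \<in> polys V \<Longrightarrow> g \<in> polys V \<Longrightarrow> f + g \<in> polys V"
  using Poly_Mapping.keys_add[of f g] by (auto simp: mem_polys)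

lemma polys_uminus [intro]:
  fixes f :: "('v, 'k::comm_ring_1) mpoly"
  shows "f \<in> polys V \<Longrightarrow> - f \<in> polys V"
  by (auto simp: mem_polys in_keys_iff)

lemma polys_mult [intro]:
  "f \<in> polys V \<Longrightarrow> g \<in> polys V \<Longrightarrow> f * g \<in> polys V"
  using keys_mult[of f g] monomials_in_add[of _ V] by (auto simp: mem_polys subset_iff)

lemma polys_diff [intro]:
  fixes f :: "('v, 'k::comm_ring_1) mpoly"
  shows "f \<in> polys V \<Longrightarrow> g \<in> polys V \<Longrightarrow> f - g \<in> polys V"
  by (simp only: diff_conv_add_uminus) (intro polys_add polys_uminus)

lemma polys_sum [intro]:
  "(\<And>i. i \<in> A \<Longrightarrow> f i \<in> polys V) \<Longrightarrow> sum f A \<in> polys V"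
  by (induction A rule: infinite_finite_induct) auto

lemma polys_prod [intro]:
  "(\<And>i. i \<in> A \<Longrightarrow> f i \<in> polys V) \<Longrightarrow> prod f A \<in> polys V"
  by (induction A rule: infinite_finite_induct) auto

lemma polys_power [intro]:
  "f \<in> polys V \<Longrightarrow> f ^ k \<in> polys V"
  by (induction k) auto

lemma polys_mvar [intro]: "v \<in> V \<Longrightarrow> mvar v \<in> polys V"
  unfolding mvar_def by (rule polys_single) (simp add: monomials_in_def)

lemma polys_signof [intro]: "signof p \<in> polys V"
  by (auto simp: sign_def intro: polys_uminus)

lemma polys_det:
  assumes A: "A \<in> carrier_mat n n"
    and e: "\<And>i j. i < n \<Longrightarrow> j < n \<Longrightarrow> A $$ (i, j) \<in> polys V"
  shows "det A \<in> polys V"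
  unfolding det_def'[OF A]
  by (intro polys_sum polys_mult polys_signof polys_prod e) (auto simp: permutes_in_image)

lemma polys_cofactor:
  assumes A: "A \<in> carrier_mat n n" and kl: "k < n" "l < n"
    and e: "\<And>i j. i < n \<Longrightarrow> j < n \<Longrightarrow> i \<noteq> k \<Longrightarrow> A $$ (i, j) \<in> polys V"
  shows "cofactor A k l \<in> polys V"
  unfolding cofactor_def
proof (intro polys_mult polys_power polys_uminus polys_1 polys_det)
  show "mat_delete A k l \<in> carrier_mat (n - 1) (n - 1)" by (rule mat_delete_carrier[OF A])
  fix i j assume ij: "i < n - 1" "j < n - 1"
  have "mat_delete A k l $$ (i, j) = A $$ (insert_index k i, insert_index l j)"
    by (rule mat_delete_index[symmetric, of _ "n - 1"]) (use A kl ij in auto)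
  also have "\<dots> \<in> polys V"
    by (rule e) (use ij in \<open>auto simp: insert_index_def\<close>)
  finally show "mat_delete A k l $$ (i, j) \<in> polys V" .
qed

end

lemma polys_mono: "V \<subseteq> W \<Longrightarrow> g \<in> polys V \<Longrightarrow> g \<in> polys W"
  by (auto simp: mem_polys monomials_in_def)

lemma cring_mpoly_ring: "cring (mpoly_ring V :: ('v, 'k::comm_ring_1) mpoly ring)"
proof (rule cringI)
  show "abelian_group (mpoly_ring V :: ('v, 'k) mpoly ring)"
  proof (rule abelian_groupI)
    fix x :: "('v, 'k) mpoly"
    assume "x \<in> polys V"
    then show "\<exists>y\<in>polys V. y \<oplus>\<^bsub>mpoly_ring V\<^esub> x = \<zero>\<^bsub>mpoly_ring V\<^esub>"
      by (intro bexI[of _ "- x"] polys_uminus) auto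
  qed (auto simp: algebra_simps)
  show "comm_monoid (mpoly_ring V :: ('v, 'k) mpoly ring)"
    by (rule comm_monoidI) (auto simp: algebra_simps)
qed (auto simp: algebra_simps)

context
  fixes V :: "'v set" and I :: "('v, 'k::comm_ring_1) mpoly set"
  assumes I: "ideal I (mpoly_ring V)"
begin

lemma ideal_subset_polys: "a \<in> I \<Longrightarrow> a \<in> polys V"
  using ideal.Icarr[OF I] .

lemma ideal_0: "0 \<in> I"
  using additive_subgroup.zero_closed[OF ideal.axioms(1)[OF I]] by simp

lemma ideal_add: "a \<in> I \<Longrightarrow> b \<in> I \<Longrightarrow> a + b \<in> I"
  using additive_subgroup.a_closed[OF ideal.axioms(1)[OF I], of a b] by simp

lemma ideal_mult_left: "a \<in> I \<Longrightarrow> c \<in> polys V \<Longrightarrow> c * a \<in> I"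
  using ideal.I_l_closed[OF I, of a c] by simp

lemma ideal_sum: "(\<And>i. i \<in> A \<Longrightarrow> f i \<in> I) \<Longrightarrow> sum f A \<in> I"
  by (induction A rule: infinite_finite_induct) (auto intro: ideal_0 ideal_add)

end

text \<open>Closure under additive inverses is automatic, because \<open>- 1\<close> lies in the ring.\<close>

lemma mpoly_idealI:
  fixes I :: "('v, 'k::comm_ring_1) mpoly set"
  assumes "I \<subseteq> polys V" "0 \<in> I"
    and add: "\<And>a b. a \<in> I \<Longrightarrow> b \<in> I \<Longrightarrow> a + b \<in> I"
    and mul: "\<And>a c. a \<in> I \<Longrightarrow> c \<in> polys V \<Longrightarrow> c * a \<in> I"
  shows "ideal I (mpoly_ring V)"
proof -
  interpret cring "mpoly_ring V :: ('v, 'k) mpoly ring" by (rule cring_mpoly_ring)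
  have um: "- a \<in> I" if "a \<in> I" for a
    using mul[OF that, of "-1"] by (simp add: polys_uminus)
  have inv: "\<ominus>\<^bsub>mpoly_ring V\<^esub> a = - a" if "a \<in> polys V" for a :: "('v, 'k) mpoly"
    by (rule minus_equality) (use that in \<open>auto intro: polys_uminus\<close>)
  show ?thesis
  proof (rule idealI)
    show "subgroup I (add_monoid (mpoly_ring V))"
    proof (rule group.subgroupI)
      show "group (add_monoid (mpoly_ring V :: ('v, 'k) mpoly ring))" by (rule a_group)
      fix a assume a: "a \<in> I"
      then have "inv\<^bsub>add_monoid (mpoly_ring V)\<^esub> a = - a"
        using inv[of a] assms(1) by (auto simp: a_inv_def)
      then show "inv\<^bsub>add_monoid (mpoly_ring V)\<^esub> a \<in> I" using um[OF a] by simp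
    qed (use assms in auto)
  qed (use mul in \<open>auto simp: mult.commute intro: ring_axioms\<close>)
qed

section \<open>Leading monomials in the lexicographic order\<close>

text \<open>The value at \<open>0\<close> is unspecified.\<close>

definition lm :: "('v::linorder, 'k::zero) mpoly \<Rightarrow> 'v monomial" where
  "lm g = Max (keys g)"

lemma lm_in_keys: "g \<noteq> 0 \<Longrightarrow> lm g \<in> keys g"
  unfolding lm_def by (rule Max_in) auto

lemma le_lm: "m \<in> keys g \<Longrightarrow> m \<le> lm g"
  unfolding lm_def by (rule Max_ge) auto

lemma lm_eqI:
  "lookup g \<mu> \<noteq> 0 \<Longrightarrow> (\<And>m. m \<in> keys g \<Longrightarrow> m \<le> \<mu>) \<Longrightarrow> lm g = \<mu>"
  unfolding lm_def by (rule Max_eqI) (auto simp: in_keys_iff)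

lemma lookup_lm_nonzero: "g \<noteq> 0 \<Longrightarrow> lookup g (lm g) \<noteq> 0"
  using lm_in_keys[of g] by (simp add: in_keys_iff)

lemma lm_single [simp]: "c \<noteq> 0 \<Longrightarrow> lm (single m c) = m"
  by (simp add: lm_def)

lemma mvar_nonzero [simp]: "(mvar v :: ('v, 'k::comm_ring_1) mpoly) \<noteq> 0"
proof
  assume "(mvar v :: ('v, 'k) mpoly) = 0"
  then have "lookup (mvar v :: ('v, 'k) mpoly) (single v 1) = 0" by simp
  then show False by (simp add: mvar_def)
qed

lemma lm_mvar [simp]: "lm (mvar v :: ('v::linorder, 'k::comm_ring_1) mpoly) = single v 1"
  by (simp add: mvar_def)

lemma lookup_mvar_lm [simp]:
  "lookup (mvar v :: ('v::linorder, 'k::comm_ring_1) mpoly) (single v (Suc 0)) = 1"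
  by (simp add: mvar_def)

lemma poly_eq_sum_single:
  "g = (\<Sum>m\<in>keys g. single m (lookup g m))"
  by (rule poly_mapping_eqI) (simp add: lookup_sum lookup_single when_def in_keys_iff)

lemma mult_eq_sum_single:
  fixes f g :: "('v, 'k::comm_ring_1) mpoly"
  shows "f * g = (\<Sum>a\<in>keys f. \<Sum>b\<in>keys g.
           single (a + b) (lookup f a * lookup g b))"
proof -
  have "f * g = (\<Sum>a\<in>keys f. single a (lookup f a)) *
      (\<Sum>b\<in>keys g. single b (lookup g b))"
    using poly_eq_sum_single[of f] poly_eq_sum_single[of g] by simp
  then show ?thesis by (simp add: sum_product mult_single)
qed

lemma add_eq_maxD:
  fixes a b c d :: "'a::{linorder,ordered_cancel_comm_monoid_add}"
  assumes "a \<le> c" "b \<le> d" "a + b = c + d"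
  shows "a = c \<and> b = d"
proof -
  have "\<not> a < c"
  proof
    assume "a < c" from add_less_le_mono[OF this assms(2)] assms(3) show False by simp
  qed
  moreover have "\<not> b < d"
  proof
    assume "b < d" from add_le_less_mono[OF assms(1) this] assms(3) show False by simp
  qed
  ultimately show ?thesis using assms(1,2) by (simp only: order_class.less_le simp_thms)
qed

text \<open>Translation is strictly monotone, so the product of the leading monomials arises from
  no other pair of monomials.\<close>

lemma lookup_mult_lm:
  fixes f g :: "('v::linorder, 'k::comm_ring_1) mpoly"
  assumes "f \<noteq> 0" "g \<noteq> 0"
  shows "lookup (f * g) (lm f + lm g) =
    lookup f (lm f) * lookup g (lm g)"
proof -
  have "lookup (f * g) (lm f + lm g) =
     (\<Sum>a\<in>keys f. \<Sum>b\<in>keys g.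
       if a = lm f \<and> b = lm g then lookup f a * lookup g b else 0)"
    unfolding mult_eq_sum_single[of f g] lookup_sum lookup_single when_def
    by (intro sum.cong refl) (use add_eq_maxD le_lm in \<open>metis (no_types, lifting)\<close>)
  also have "\<dots> = (\<Sum>a\<in>keys f. if a = lm f then
      (\<Sum>b\<in>keys g. if b = lm g then lookup f a * lookup g b else 0) else 0)"
    by (intro sum.cong refl) auto
  also have "\<dots> = lookup f (lm f) * lookup g (lm g)"
    using assms by (simp add: lm_in_keys)
  finally show ?thesis .
qed

lemma lm_mult:
  fixes f g :: "('v::linorder, 'k::idom) mpoly"
  assumes "f \<noteq> 0" "g \<noteq> 0"
  shows "lm (f * g) = lm f + lm g"
proof (rule lm_eqI)
  show "lookup (f * g) (lm f + lm g) \<noteq> 0"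
    using assms by (simp add: lookup_mult_lm lookup_lm_nonzero)
  fix m assume "m \<in> keys (f * g)"
  then obtain a b where "m = a + b" "a \<in> keys f" "b \<in> keys g"
    using keys_mult[of f g] by blast
  then show "m \<le> lm f + lm g" by (simp add: add_mono le_lm)
qed

lemma prod_lm:
  fixes f :: "'i \<Rightarrow> ('v::linorder, 'k::idom) mpoly"
  assumes "\<And>i. i \<in> A \<Longrightarrow> f i \<noteq> 0"
  shows "lm (prod f A) = (\<Sum>i\<in>A. lm (f i))"
    and "lookup (prod f A) (lm (prod f A)) = (\<Prod>i\<in>A. lookup (f i) (lm (f i)))"
proof -
  have "lm (prod f A) = (\<Sum>i\<in>A. lm (f i)) \<and>
     lookup (prod f A) (lm (prod f A)) = (\<Prod>i\<in>A. lookup (f i) (lm (f i)))"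
    using assms
  proof (induction A rule: infinite_finite_induct)
    case (insert x F)
    have nz: "f x \<noteq> 0" "prod f F \<noteq> 0" using insert(1,4) by auto
    have IH: "lm (prod f F) = (\<Sum>i\<in>F. lm (f i))"
      "lookup (prod f F) (lm (prod f F)) = (\<Prod>i\<in>F. lookup (f i) (lm (f i)))"
      using insert(3,4) by blast+
    show ?case
      unfolding prod.insert[OF insert(1,2)] sum.insert[OF insert(1,2)] lm_mult[OF nz] lookup_mult_lm[OF nz]
      unfolding IH(2) unfolding IH(1) by simp
  qed (simp_all add: lm_def)
  then show "lm (prod f A) = (\<Sum>i\<in>A. lm (f i))"
    and "lookup (prod f A) (lm (prod f A)) = (\<Prod>i\<in>A. lookup (f i) (lm (f i)))"
    by blast+
qed

lemma power_lm:
  fixes f :: "('v::linorder, 'k::idom) mpoly"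
  assumes "f \<noteq> 0"
  shows "lm (f ^ k) = (\<Sum>i<k. lm f)"
    and "lookup (f ^ k) (lm (f ^ k)) = lookup f (lm f) ^ k"
  using prod_lm[of "{..<k}" "\<lambda>_. f"] assms by simp_all

text \<open>In the Leibniz expansion the term of the identity cannot be cancelled,
  because it alone has the largest leading monomial.\<close>

lemma lm_det_dominant_diagonal:
  fixes A :: "('v::linorder, 'k::idom) mpoly mat"
  assumes A: "A \<in> carrier_mat n n"
    and diag: "\<And>i. i < n \<Longrightarrow> A $$ (i, i) \<noteq> 0"
    and dom: "\<And>p. p permutes {0..<n} \<Longrightarrow> p \<noteq> id \<Longrightarrow> (\<And>i. i < n \<Longrightarrow> A $$ (i, p i) \<noteq> 0) \<Longrightarrow>
       (\<Sum>i<n. lm (A $$ (i, p i))) < (\<Sum>i<n. lm (A $$ (i, i)))"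
  shows "det A \<noteq> 0" and "lm (det A) = (\<Sum>i<n. lm (A $$ (i, i)))"
    and "lookup (det A) (lm (det A)) =
          (\<Prod>i<n. lookup (A $$ (i, i)) (lm (A $$ (i, i))))"
proof -
  let ?t = "\<lambda>p. \<Prod>i<n. A $$ (i, p i)"
  let ?P = "{p. p permutes {0..<n}}"
  let ?\<mu> = "\<Sum>i<n. lm (A $$ (i, i))"
  have fin: "finite ?P" by (rule finite_permutations) simp
  have dt: "det A = ?t id + (\<Sum>p\<in>?P - {id}. signof p * ?t p)"
    unfolding det_def'[OF A] atLeast0LessThan
    by (subst sum.remove[where x = id]) (use fin in \<open>auto simp: permutes_id atLeast0LessThan\<close>)
  have tid: "lm (?t id) = ?\<mu>"
    "lookup (?t id) ?\<mu> = (\<Prod>i<n. lookup (A $$ (i, i)) (lm (A $$ (i, i))))"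
    using prod_lm[of "{..<n}" "\<lambda>i. A $$ (i, i)"] diag by auto
  have small: "m < ?\<mu>" if m: "m \<in> keys (\<Sum>p\<in>?P - {id}. signof p * ?t p)" for m
  proof -
    obtain p where p: "p permutes {0..<n}" "p \<noteq> id" and mp: "m \<in> keys (signof p * ?t p)"
      using keys_sum_subset_UN[of "\<lambda>p. signof p * ?t p" "?P - {id}"] m by auto
    have mp': "m \<in> keys (?t p)"
      using mp by (auto simp: sign_def in_keys_iff split: if_splits)
    then have nz: "A $$ (i, p i) \<noteq> 0" if "i < n" for i
    proof -
      have "?t p \<noteq> 0" using mp' by (metis keys_zero empty_iff)
      then show ?thesis using that by auto
    qed
    have "m \<le> lm (?t p)" by (rule le_lm[OF mp'])
    also have "\<dots> = (\<Sum>i<n. lm (A $$ (i, p i)))" by (rule prod_lm) (use nz in auto)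
    also have "\<dots> < ?\<mu>" by (rule dom[OF p nz])
    finally show ?thesis .
  qed
  then have zero: "lookup (\<Sum>p\<in>?P - {id}. signof p * ?t p) ?\<mu> = 0"
    by (meson in_keys_iff less_irrefl)
  have tid0: "lookup (?t id) ?\<mu> \<noteq> 0"
    unfolding tid(2) prod_zero_iff[OF finite_lessThan] using diag lookup_lm_nonzero by blast
  have look: "lookup (det A) ?\<mu> = lookup (?t id) ?\<mu>"
    unfolding dt lookup_add zero by simp
  show lm: "lm (det A) = ?\<mu>"
  proof (rule lm_eqI)
    show "lookup (det A) ?\<mu> \<noteq> 0" using look tid0 by simp
    fix m assume "m \<in> keys (det A)"
    then have "m \<in> keys (?t id) \<union> keys (\<Sum>p\<in>?P - {id}. signof p * ?t p)"
      unfolding dt by (rule subsetD[OF Poly_Mapping.keys_add])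
    then show "m \<le> ?\<mu>" using le_lm[of m "?t id"] small[of m] tid(1) by auto
  qed
  show "det A \<noteq> 0" using look tid0 by auto
  show "lookup (det A) (lm (det A)) =
          (\<Prod>i<n. lookup (A $$ (i, i)) (lm (A $$ (i, i))))"
    unfolding lm look tid(2) ..
qed

section \<open>Evaluation homomorphisms\<close>

definition mon_eval :: "('v \<Rightarrow> 'a::comm_ring_1) \<Rightarrow> 'v monomial \<Rightarrow> 'a" where
  "mon_eval s m = (\<Prod>w\<in>keys m. s w ^ lookup m w)"

text \<open>The homomorphism \<open>\<iota>\<close> of coefficient rings allows values in rings that are not polynomial
  rings over the coefficients, such as the field of rational functions.\<close>

definition mp_eval :: "('k \<Rightarrow> 'a) \<Rightarrow> ('v \<Rightarrow> 'a) \<Rightarrow> ('v, 'k::comm_ring_1) mpoly \<Rightarrow> 'a::comm_ring_1" where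
  "mp_eval \<iota> s g = (\<Sum>m\<in>keys g. \<iota> (lookup g m) * mon_eval s m)"

lemma mon_eval_superset:
  assumes "finite W" "keys m \<subseteq> W"
  shows "mon_eval s m = (\<Prod>w\<in>W. s w ^ lookup m w)"
  unfolding mon_eval_def
  by (rule prod.mono_neutral_left) (use assms in \<open>auto simp: in_keys_iff\<close>)

lemma mon_eval_add: "mon_eval s (a + b) = mon_eval s a * mon_eval s b"
proof -
  let ?W = "keys a \<union> keys b"
  have "mon_eval s (a + b) = (\<Prod>w\<in>?W. s w ^ lookup (a + b) w)"
    by (rule mon_eval_superset) (use Poly_Mapping.keys_add[of a b] in auto)
  also have "\<dots> = (\<Prod>w\<in>?W. s w ^ lookup a w) * (\<Prod>w\<in>?W. s w ^ lookup b w)"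
    by (simp add: lookup_add power_add prod.distrib)
  finally show ?thesis by (subst (1 2) mon_eval_superset[of ?W]) auto
qed

lemma mon_eval_0 [simp]: "mon_eval s 0 = 1"
  by (simp add: mon_eval_def)

lemma mon_eval_single [simp]: "mon_eval s (single v k) = s v ^ k"
  by (simp add: mon_eval_def)

lemma mon_eval_mvar: "mon_eval mvar m = (single m 1 :: ('v, 'k::comm_ring_1) mpoly)"
proof -
  have pw: "mvar w ^ k = (single (single w k) 1 :: ('v, 'k) mpoly)" for w k
    by (induction k) (simp_all add: mvar_def mult_single flip: single_add)
  have pr: "(\<Prod>w\<in>A. single (h w) 1) = (single (sum h A) 1 :: ('v, 'k) mpoly)" for h A
    by (induction A rule: infinite_finite_induct) (simp_all add: mult_single)
  show ?thesis
    unfolding mon_eval_def pw pr using poly_eq_sum_single[of m] by simp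
qed

context
  fixes \<iota> :: "'k::comm_ring_1 \<Rightarrow> 'a::comm_ring_1" and s :: "'v \<Rightarrow> 'a"
  assumes \<iota>: "comm_ring_hom \<iota>"
begin

interpretation \<iota>: comm_ring_hom \<iota> by (rule \<iota>)

lemma mp_eval_superset:
  assumes "finite S" "keys g \<subseteq> S"
  shows "mp_eval \<iota> s g = (\<Sum>m\<in>S. \<iota> (lookup g m) * mon_eval s m)"
  unfolding mp_eval_def
  by (rule sum.mono_neutral_left) (use assms in \<open>auto simp: in_keys_iff\<close>)

lemma mp_eval_single: "mp_eval \<iota> s (single m c) = \<iota> c * mon_eval s m"
  by (subst mp_eval_superset[of "{m}"]) auto

lemma mp_eval_const: "mp_eval \<iota> s (single 0 c) = \<iota> c"
  by (simp add: mp_eval_single)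

lemma mp_eval_mvar: "mp_eval \<iota> s (mvar v) = s v"
  by (simp add: mvar_def mp_eval_single)

lemma mp_eval_add: "mp_eval \<iota> s (f + g) = mp_eval \<iota> s f + mp_eval \<iota> s g"
proof -
  let ?S = "keys f \<union> keys g"
  have "mp_eval \<iota> s (f + g) = (\<Sum>m\<in>?S. \<iota> (lookup (f + g) m) * mon_eval s m)"
    by (rule mp_eval_superset) (use Poly_Mapping.keys_add[of f g] in auto)
  also have "\<dots> = (\<Sum>m\<in>?S. \<iota> (lookup f m) * mon_eval s m) +
      (\<Sum>m\<in>?S. \<iota> (lookup g m) * mon_eval s m)"
    by (simp add: lookup_add \<iota>.hom_add distrib_right sum.distrib)
  finally show ?thesis by (subst (1 2) mp_eval_superset[of ?S]) auto
qed

lemma mp_eval_sum: "mp_eval \<iota> s (sum f A) = (\<Sum>i\<in>A. mp_eval \<iota> s (f i))"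
proof (induction A rule: infinite_finite_induct)
qed (simp_all add: mp_eval_add mp_eval_def[of _ _ 0])

lemma mp_eval_mult: "mp_eval \<iota> s (f * g) = mp_eval \<iota> s f * mp_eval \<iota> s g"
proof -
  have "mp_eval \<iota> s (f * g) = (\<Sum>a\<in>keys f. \<Sum>b\<in>keys g.
     (\<iota> (lookup f a) * mon_eval s a) * (\<iota> (lookup g b) * mon_eval s b))"
    unfolding mult_eq_sum_single[of f g] mp_eval_sum mp_eval_single
    by (simp add: \<iota>.hom_mult mon_eval_add mult_ac)
  then show ?thesis by (simp add: mp_eval_def sum_product)
qed

lemma mp_eval_hom: "comm_ring_hom (mp_eval \<iota> s)"
  using mp_eval_const[of 1]
  by unfold_locales (simp_all add: mp_eval_add mp_eval_mult mp_eval_def[of _ _ 0])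

text \<open>A homomorphism is determined by its values on constants and on the variables that
  occur. Comparing compositions of substitutions becomes a check on variables.\<close>

lemma hom_eq_mp_eval:
  assumes h: "comm_ring_hom h" and c: "\<And>c. h (single 0 c) = \<iota> c"
    and v: "\<And>w. w \<in> V \<Longrightarrow> h (mvar w) = s w" and g: "g \<in> polys V"
  shows "h g = mp_eval \<iota> s g"
proof -
  interpret h: comm_ring_hom h by (rule h)
  have mon: "h (single m 1) = mon_eval s m" if "m \<in> monomials_in V" for m
  proof -
    have "h (single m 1) = h (mon_eval mvar m)" by (simp add: mon_eval_mvar)
    also have "\<dots> = (\<Prod>w\<in>keys m. h (mvar w) ^ lookup m w)"
      by (simp add: mon_eval_def h.hom_prod h.hom_power)
    also have "\<dots> = mon_eval s m"
      unfolding mon_eval_def using that by (intro prod.cong refl) (auto simp: v monomials_in_def)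
    finally show ?thesis .
  qed
  have sg: "h (single m c) = \<iota> c * mon_eval s m" if "m \<in> monomials_in V" for m c
  proof -
    have "single m c = single 0 c * single m 1"
      by (simp add: mult_single)
    then show ?thesis by (simp add: h.hom_mult c mon[OF that])
  qed
  have "h g = h (\<Sum>m\<in>keys g. single m (lookup g m))"
    using poly_eq_sum_single[of g] by simp
  also have "\<dots> = mp_eval \<iota> s g"
    unfolding h.hom_sum mp_eval_def
    using g by (intro sum.cong refl) (auto simp: sg mem_polys)
  finally show ?thesis .
qed

end

lemma const_hom: "comm_ring_hom (\<lambda>c. single 0 c :: ('v, 'k::comm_ring_1) mpoly)"
  by unfold_locales (simp_all add: single_add mult_single)

lemma mp_eval_id:
  assumes "\<And>w. w \<in> V \<Longrightarrow> s w = mvar w" "g \<in> polys V"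
  shows "mp_eval (single 0) s g = (g :: ('v, 'k::comm_ring_1) mpoly)"
  by (rule hom_eq_mp_eval[OF const_hom, of "\<lambda>x. x", symmetric])
     (use assms in \<open>auto intro: comm_ring_hom.intro comm_semiring_hom.intro semiring_hom.intro\<close>, unfold_locales, auto)

section \<open>Well-foundedness of the lexicographic order\<close>

lemma less_poly_mapping_iff:
  fixes a b :: "'v::linorder \<Rightarrow>\<^sub>0 nat"
  shows "a < b \<longleftrightarrow> (\<exists>k. lookup a k < lookup b k \<and>
      (\<forall>k'<k. lookup a k' = lookup b k'))"
  by transfer (simp add: less_fun_def)

text \<open>With infinitely many variables the order may fail to be well-founded. For finitely many, listing
  the exponents in increasing order of the variables turns it into the lexicographic order on
  lists of a fixed length.\<close>

lemma wf_less_monomials_in: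
  fixes V :: "'v::linorder set"
  assumes "finite V"
  shows "wf {(a, b). a \<in> monomials_in V \<and> b \<in> monomials_in V \<and> a < b}"
proof (rule wf_subset)
  let ?f = "\<lambda>m. map (lookup m) (sorted_list_of_set V)"
  show "wf (inv_image (lex less_than) ?f)" by (intro wf_inv_image wf_lex wf_less_than)
  show "{(a, b). a \<in> monomials_in V \<and> b \<in> monomials_in V \<and> a < b} \<subseteq> inv_image (lex less_than) ?f"
  proof clarify
    fix a b :: "'v monomial"
    assume a: "a \<in> monomials_in V" and b: "b \<in> monomials_in V" and "a < b"
    then obtain k where k: "lookup a k < lookup b k"
      "\<And>k'. k' < k \<Longrightarrow> lookup a k' = lookup b k'"
      by (auto simp: less_poly_mapping_iff)
    have "k \<in> keys b" using k(1) by (auto simp: in_keys_iff)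
    then have "k \<in> set (sorted_list_of_set V)" using b assms by (auto simp: monomials_in_def)
    then obtain xs ys where xy: "sorted_list_of_set V = xs @ k # ys" by (meson split_list)
    have srt: "sorted (xs @ k # ys)" "distinct (xs @ k # ys)"
      using assms by (simp_all flip: xy)
    have eq: "map (lookup a) xs = map (lookup b) xs"
      using srt k(2) by (auto simp: sorted_append order.strict_iff_order)
    show "(a, b) \<in> inv_image (lex less_than) ?f"
      unfolding in_inv_image xy map_append list.map(2) eq
      by (rule lex_append_leftI) (use k(1) in simp)
  qed
qed

section \<open>Minors of matrices of variables\<close>

lemma lookup_sum_single:
  "finite A \<Longrightarrow> lookup (\<Sum>k\<in>A. single (w k) (1::nat)) u = (\<Sum>k\<in>A. if w k = u then 1 else 0)"
  by (simp only: lookup_sum lookup_single when_def)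

text \<open>Every diagonal position carries the most significant variable among the rows and columns
  from it on. At the first place where a permutation leaves the diagonal, it misses this
  variable for good, so its monomial is smaller. Entries may be \<open>0\<close> off the diagonal, as in the
  block matrices \<open>D\<^sup>*\<close> and \<open>D\<^sub>*\<close>.\<close>

lemma lm_det_variables:
  fixes A :: "('v::linorder, 'k::idom) mpoly mat"
  assumes A: "A \<in> carrier_mat L L"
    and entry: "\<And>i j. i < L \<Longrightarrow> j < L \<Longrightarrow> A $$ (i, j) = mvar (w i j) \<or> A $$ (i, j) = 0"
    and diag: "\<And>i. i < L \<Longrightarrow> A $$ (i, i) = mvar (w i i)"
    and mono: "\<And>i i' j'. i \<le> i' \<Longrightarrow> i \<le> j' \<Longrightarrow> i' < L \<Longrightarrow> j' < L \<Longrightarrow> (i', j') \<noteq> (i, i) \<Longrightarrow> w i i < w i' j'"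
  shows "det A \<noteq> 0" and "lm (det A) = (\<Sum>i<L. single (w i i) 1)"
    and "lookup (det A) (lm (det A)) = 1"
proof -
  have dom: "(\<Sum>i<L. lm (A $$ (i, p i))) < (\<Sum>i<L. lm (A $$ (i, i)))"
    if p: "p permutes {0..<L}" "p \<noteq> id" and nz: "\<And>i. i < L \<Longrightarrow> A $$ (i, p i) \<noteq> 0" for p
  proof -
    have pL: "p i < L" if "i < L" for i using permutes_in_image[OF p(1), of i] that by simp
    define i where "i = (LEAST i. p i \<noteq> i)"
    have ex: "\<exists>i. p i \<noteq> i" using p(2) by auto
    have pi: "p i \<noteq> i" unfolding i_def by (rule LeastI_ex[OF ex])
    have fixed: "p k = k" if "k < i" for k using not_less_Least[of k "\<lambda>i. p i \<noteq> i"] that i_def by auto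
    have iL: "i < L" using pi p(1) by (meson atLeastLessThan_iff not_le permutes_def zero_le)
    have pge: "i \<le> p k" if "i \<le> k" for k
    proof (rule ccontr)
      assume "\<not> i \<le> p k"
      then have "p (p k) = p k" by (intro fixed) simp
      then have "p k = k" using permutes_inj[OF p(1)] by (auto dest: injD)
      then show False using that \<open>\<not> i \<le> p k\<close> by simp
    qed
    have eqp: "(\<Sum>i<L. lm (A $$ (i, p i))) = (\<Sum>k<L. single (w k (p k)) 1)"
    proof (rule sum.cong[OF refl])
      fix k assume "k \<in> {..<L}"
      then have "A $$ (k, p k) = mvar (w k (p k))" using entry[of k "p k"] nz[of k] pL[of k] by auto
      then show "lm (A $$ (k, p k)) = single (w k (p k)) 1" by simp
    qed
    have eqd: "(\<Sum>i<L. lm (A $$ (i, i))) = (\<Sum>k<L. single (w k k) 1)"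
      by (rule sum.cong) (auto simp: diag)
    have gt: "w i i < w k (p k)" if "i \<le> k" "k < L" for k
      by (rule mono) (use that pge[of k] pL[of k] pi in auto)
    have gt': "w i i < w k k" if "i < k" "k < L" for k
      by (rule mono) (use that in auto)
    show ?thesis
      unfolding eqp eqd less_poly_mapping_iff lookup_sum_single[OF finite_lessThan]
    proof (intro exI[of _ "w i i"] conjI allI impI)
      show "(\<Sum>k<L. if w k (p k) = w i i then 1 else 0) < (\<Sum>k<L. if w k k = w i i then 1 else (0::nat))"
      proof (rule sum_strict_mono_ex1)
        have "(if w k (p k) = w i i then 1 else 0) \<le> (if w k k = w i i then 1 else (0::nat))" if "k < L" for k
          using gt[of k] fixed[of k] that by (cases "k < i") auto
        then show "\<forall>k\<in>{..<L}. (if w k (p k) = w i i then 1 else 0) \<le> (if w k k = w i i then 1 else (0::nat))"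
          by blast
        show "\<exists>k\<in>{..<L}. (if w k (p k) = w i i then 1 else 0) < (if w k k = w i i then 1 else (0::nat))"
          using gt[of i] iL by (intro bexI[of _ i]) auto
      qed simp
    next
      fix u assume u: "u < w i i"
      have "w k (p k) = u \<longleftrightarrow> w k k = u" if "k < L" for k
        using gt[of k] gt'[of k] fixed[of k] that u by (cases k i rule: linorder_cases) auto
      then show "(\<Sum>k<L. if w k (p k) = u then 1 else 0) = (\<Sum>k<L. if w k k = u then 1 else (0::nat))"
        by (intro sum.cong) auto
    qed
  qed
  note * = lm_det_dominant_diagonal[OF A _ dom]
  have nz: "A $$ (i, i) \<noteq> 0" if "i < L" for i using diag[OF that] by simp
  show "det A \<noteq> 0" by (rule *(1)) (use nz in auto)
  have "lm (det A) = (\<Sum>i<L. lm (A $$ (i, i)))" by (rule *(2)) (use nz in auto)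
  also have "\<dots> = (\<Sum>k<L. single (w k k) 1)"
    by (rule sum.cong) (auto simp: diag)
  finally show "lm (det A) = (\<Sum>i<L. single (w i i) 1)" .
  have "lookup (det A) (lm (det A)) =
      (\<Prod>i<L. lookup (A $$ (i, i)) (lm (A $$ (i, i))))" by (rule *(3)) (use nz in auto)
  also have "\<dots> = 1" by (rule prod.neutral) (auto simp: diag)
  finally show "lookup (det A) (lm (det A)) = 1" .
qed

lemma lookup_mult_single_add:
  fixes c :: "('v, 'k::comm_ring_1) mpoly"
  shows "lookup (c * single t 1) (a + t) = lookup c a"
proof -
  have "lookup (c * single t 1) (a + t) =
    (\<Sum>b\<in>keys c. if b = a then lookup c b else 0)"
    unfolding mult_eq_sum_single[of c] by (simp add: lookup_sum lookup_single when_def)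
  then show ?thesis by (simp add: in_keys_iff)
qed

lemma keys_mult_single:
  fixes c :: "('v, 'k::comm_ring_1) mpoly"
  assumes "m \<in> keys (c * single t 1)"
  obtains a where "a \<in> keys c" "m = a + t"
  using assms keys_mult[of c "single t 1"] by auto

text \<open>The summands \<open>c j * u j\<close> of a linear form whose coefficients involve none of the variables
  \<open>u j\<close> have disjoint sets of monomials, so nothing cancels: the variable \<open>u j0\<close> in the leading
  monomial identifies the summand from which it comes, and the other summands are smaller.\<close>

lemma lm_linear_form:
  fixes c :: "'i \<Rightarrow> ('v::linorder, 'k::comm_ring_1) mpoly"
  assumes S: "finite S" and inj: "inj_on u S"
    and free: "\<And>j. j \<in> S \<Longrightarrow> c j \<in> polys W" "\<And>j. j \<in> S \<Longrightarrow> u j \<notin> W"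
    and g: "g = (\<Sum>j\<in>S. c j * mvar (u j))" "g \<noteq> 0"
    and j0: "j0 \<in> S" "lookup (lm g) (u j0) \<noteq> 0"
  shows "c j0 \<noteq> 0" and "lm g = lm (c j0) + single (u j0) 1"
    and "\<And>j. j \<in> S \<Longrightarrow> j \<noteq> j0 \<Longrightarrow> c j \<noteq> 0 \<Longrightarrow> lm (c j) + single (u j) 1 < lm g"
proof -
  have zero: "lookup a (u i) = 0" if "a \<in> keys (c j)" "i \<in> S" "j \<in> S" for a i j
  proof -
    have "keys a \<subseteq> W"
      using free(1)[OF that(3)] that(1) by (auto simp: mem_polys monomials_in_def)
    then have "u i \<notin> keys a" using free(2)[OF that(2)] by blast
    then show ?thesis by (simp add: in_keys_iff)
  qed
  have at: "lookup (a + single (u j) 1) (u i) = (if i = j then 1 else 0)"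
    if "a \<in> keys (c j)" "i \<in> S" "j \<in> S" for a i j
    using zero[OF that] that inj by (auto simp: lookup_add lookup_single when_def inj_on_def)
  have key: "a + single (u j) 1 \<in> keys g"
    if a: "a \<in> keys (c j)" and j: "j \<in> S" for a j
  proof -
    have "lookup (c i * mvar (u i)) (a + single (u j) 1) = 0"
      if i: "i \<in> S" "i \<noteq> j" for i
    proof (rule ccontr)
      assume "lookup (c i * mvar (u i)) (a + single (u j) 1) \<noteq> 0"
      then have "a + single (u j) 1 \<in> keys (c i * single (single (u i) 1) 1)"
        by (simp add: in_keys_iff mvar_def)
      then obtain b where b: "b \<in> keys (c i)"
        "a + single (u j) 1 = b + single (u i) 1"
        by (rule keys_mult_single)
      then show False using at[OF a i(1) j] at[OF b(1) i(1) i(1)] i(2) by simp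
    qed
    then have "lookup g (a + single (u j) 1) =
        lookup (c j * mvar (u j)) (a + single (u j) 1)"
      unfolding g(1) lookup_sum using S j by (subst sum.remove[of S j]) auto
    also have "\<dots> = lookup (c j) a"
      unfolding mvar_def by (rule lookup_mult_single_add)
    finally show ?thesis using a by (simp add: in_keys_iff)
  qed
  have "lm g \<in> (\<Union>j\<in>S. keys (c j * mvar (u j)))"
    using lm_in_keys[OF g(2)] keys_sum_subset_UN[of "\<lambda>j. c j * mvar (u j)" S] unfolding g(1) by blast
  then obtain i where i: "i \<in> S" "lm g \<in> keys (c i * single (single (u i) 1) 1)"
    by (auto simp: mvar_def)
  then obtain a where a: "a \<in> keys (c i)" "lm g = a + single (u i) 1"
    by (blast elim: keys_mult_single)
  have "i = j0" using j0 at[OF a(1) j0(1) i(1)] a(2) by (auto split: if_splits)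
  note a = a[unfolded this]
  show nz: "c j0 \<noteq> 0" using a(1) by auto
  have "lm (c j0) + single (u j0) 1 \<le> lm g"
    by (rule le_lm, rule key[OF lm_in_keys[OF nz] j0(1)])
  moreover have "lm g \<le> lm (c j0) + single (u j0) 1"
    unfolding a(2) using le_lm[OF a(1)] by (rule add_right_mono)
  ultimately show "lm g = lm (c j0) + single (u j0) 1" by (rule order.antisym[rotated])
  fix j assume j: "j \<in> S" "j \<noteq> j0" "c j \<noteq> 0"
  have "lm (c j) + single (u j) 1 \<le> lm g"
    by (rule le_lm, rule key[OF lm_in_keys[OF j(3)] j(1)])
  moreover have "lm (c j) + single (u j) 1 \<noteq> lm g"
    using at[OF lm_in_keys[OF j(3)] j0(1) j(1)] j0(2) j(2) by auto
  ultimately show "lm (c j) + single (u j) 1 < lm g" by (simp add: order_less_le)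
qed

lemma mult_sign_cases: "(-1) ^ k * (P :: 'a::comm_ring_1) = P \<or> (-1) ^ k * P = - P"
  by (cases "even k") auto

lemma lm_uminus [simp]: "lm (- g :: ('v::linorder, 'k::comm_ring_1) mpoly) = lm g"
proof -
  have "keys (- g) = keys g" by (auto simp: in_keys_iff)
  then show ?thesis by (simp add: lm_def)
qed

lemma lm_sign [simp]: "lm ((-1) ^ k * (P :: ('v::linorder, 'k::comm_ring_1) mpoly)) = lm P"
  using mult_sign_cases[of k P] by auto

lemma sign_mult_eq_0 [simp]: "(-1) ^ k * (P :: 'a::comm_ring_1) = 0 \<longleftrightarrow> P = 0"
  using mult_sign_cases[of k P] by auto

lemma sign_add_mult: "(-1) ^ k * ((-1) ^ (i + k) * c) = (-1) ^ i * (c :: 'a::comm_ring_1)"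
  by (cases "even k"; cases "even i") auto

definition increasing :: "nat \<Rightarrow> nat \<Rightarrow> (nat \<Rightarrow> nat) \<Rightarrow> bool" where
  "increasing k N \<kappa> \<longleftrightarrow> (\<forall>l<k. \<kappa> l < N) \<and> (\<forall>l l'. l < l' \<longrightarrow> l' < k \<longrightarrow> \<kappa> l < \<kappa> l')"

lemma increasing_less: "increasing k N \<kappa> \<Longrightarrow> l < l' \<Longrightarrow> l' < k \<Longrightarrow> \<kappa> l < \<kappa> l'"
  and increasing_le: "increasing k N \<kappa> \<Longrightarrow> l \<le> l' \<Longrightarrow> l' < k \<Longrightarrow> \<kappa> l \<le> \<kappa> l'"
  and increasing_bound: "increasing k N \<kappa> \<Longrightarrow> l < k \<Longrightarrow> \<kappa> l < N"
  by (auto simp: increasing_def order_le_less)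

definition insert_at :: "nat \<Rightarrow> nat \<Rightarrow> (nat \<Rightarrow> nat) \<Rightarrow> nat \<Rightarrow> nat" where
  "insert_at i j \<tau> l = (if l < i then \<tau> l else if l = i then j else \<tau> (l - 1))"

text \<open>The assumption \<open>v_mono\<close> says nothing about two positions on an antidiagonal; that their
  variables differ is part of \<open>v_inj\<close>. The set \<open>V\<close> may contain further variables.\<close>

locale variable_matrix =
  fixes V :: "'v::linorder set" and n N :: nat and v :: "nat \<Rightarrow> nat \<Rightarrow> 'v"
  assumes finite_V: "finite V" and n_pos: "0 < n" and n_le_N: "n \<le> N"
    and v_in_V: "\<And>i j. i < n \<Longrightarrow> j < N \<Longrightarrow> v i j \<in> V"
    and v_mono: "\<And>i j i' j'. i \<le> i' \<Longrightarrow> j \<le> j' \<Longrightarrow> i' < n \<Longrightarrow> j' < N \<Longrightarrow> (i, j) \<noteq> (i', j') \<Longrightarrow> v i j < v i' j'"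
    and v_inj: "\<And>i j i' j'. i < n \<Longrightarrow> j < N \<Longrightarrow> i' < n \<Longrightarrow> j' < N \<Longrightarrow> v i j = v i' j' \<Longrightarrow> i = i' \<and> j = j'"
begin

abbreviation x :: "nat \<Rightarrow> nat \<Rightarrow> ('v, 'k::comm_ring_1) mpoly" where
  "x i j \<equiv> mvar (v i j)"

definition minor_cols :: "(nat \<Rightarrow> nat) \<Rightarrow> ('v, 'k::comm_ring_1) mpoly" where
  "minor_cols \<kappa> = det (mat n n (\<lambda>(i, l). x i (\<kappa> l)))"

text \<open>An \<open>n\<close>-minor of a matrix with \<open>n\<close> rows uses all rows, so it is given by an increasing
  choice of columns.\<close>

definition max_minors_ideal :: "('v, 'k::comm_ring_1) mpoly set" where
  "max_minors_ideal = Idl\<^bsub>mpoly_ring V\<^esub> {minor_cols \<kappa> | \<kappa>. increasing n N \<kappa>}"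

definition sub_minor :: "(nat \<Rightarrow> nat) \<Rightarrow> nat \<Rightarrow> ('v, 'k::comm_ring_1) mpoly" where
  "sub_minor \<tau> i = det (mat (n - 1) (n - 1) (\<lambda>(r, l). x (insert_index i r) (\<tau> l)))"

lemma minor_cols_polys:
  "(\<And>l. l < n \<Longrightarrow> \<kappa> l < N) \<Longrightarrow> minor_cols \<kappa> \<in> polys V"
  unfolding minor_cols_def by (rule polys_det[of _ n]) (auto intro!: polys_mvar v_in_V)

lemma lm_minor_cols:
  assumes "increasing n N \<kappa>"
  shows "minor_cols \<kappa> \<noteq> (0 :: ('v, 'k::idom) mpoly)"
    and "lm (minor_cols \<kappa> :: ('v, 'k::idom) mpoly) = (\<Sum>i<n. single (v i (\<kappa> i)) 1)"
    and "lookup (minor_cols \<kappa> :: ('v, 'k::idom) mpoly) (\<Sum>i<n. single (v i (\<kappa> i)) 1) = 1"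
proof -
  let ?A = "mat n n (\<lambda>(i, l). x i (\<kappa> l)) :: ('v, 'k) mpoly mat"
  have mono: "v i (\<kappa> i) < v i' (\<kappa> j')" if "i \<le> i'" "i \<le> j'" "i' < n" "j' < n" "(i', j') \<noteq> (i, i)" for i i' j'
  proof (rule v_mono)
    show "(i, \<kappa> i) \<noteq> (i', \<kappa> j')"
      using that increasing_less[OF assms, of i j'] by (cases "i = i'") auto
  qed (use that increasing_le[OF assms] increasing_bound[OF assms] in auto)
  note * = lm_det_variables[of ?A n "\<lambda>i l. v i (\<kappa> l)", OF _ _ _ mono]
  show "minor_cols \<kappa> \<noteq> (0 :: ('v, 'k) mpoly)"
    unfolding minor_cols_def by (rule *(1)) auto
  show lm: "lm (minor_cols \<kappa> :: ('v, 'k) mpoly) = (\<Sum>i<n. single (v i (\<kappa> i)) 1)"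
    unfolding minor_cols_def by (rule *(2)) auto
  show "lookup (minor_cols \<kappa> :: ('v, 'k) mpoly) (\<Sum>i<n. single (v i (\<kappa> i)) 1) = 1"
    unfolding lm[symmetric] unfolding minor_cols_def by (rule *(3)) auto
qed

lemma ideal_max_minors: "ideal max_minors_ideal (mpoly_ring V)"
  unfolding max_minors_ideal_def
  by (rule ring.genideal_ideal[OF cring.axioms(1)[OF cring_mpoly_ring]])
     (auto intro!: minor_cols_polys simp: increasing_def)

lemma minor_cols_in_ideal:
  assumes "increasing n N \<kappa>"
  shows "minor_cols \<kappa> \<in> max_minors_ideal"
proof -
  let ?G = "{minor_cols \<kappa> | \<kappa>. increasing n N \<kappa>}"
  have "?G \<subseteq> polys V" by (auto intro!: minor_cols_polys simp: increasing_def)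
  then have "?G \<subseteq> max_minors_ideal"
    unfolding max_minors_ideal_def by (rule ring.genideal_self[OF cring.axioms(1)[OF cring_mpoly_ring]])
  then show ?thesis using assms by blast
qed

lemma max_minors_ideal_subset:
  assumes "ideal J (mpoly_ring V)" "\<And>\<kappa>. increasing n N \<kappa> \<Longrightarrow> minor_cols \<kappa> \<in> J"
  shows "max_minors_ideal \<subseteq> J"
  unfolding max_minors_ideal_def
  by (rule ring.genideal_minimal[OF cring.axioms(1)[OF cring_mpoly_ring] assms(1)]) (use assms(2) in auto)

lemma sub_minor_polys:
  assumes "\<And>r l. r < n \<Longrightarrow> r \<noteq> i \<Longrightarrow> l < n - 1 \<Longrightarrow> v r (\<tau> l) \<in> W"
  shows "sub_minor \<tau> i \<in> polys W"
  unfolding sub_minor_def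
proof (rule polys_det[of _ "n - 1"])
  fix r l assume "r < n - 1" "l < n - 1"
  then show "mat (n - 1) (n - 1) (\<lambda>(r, l). x (insert_index i r) (\<tau> l)) $$ (r, l) \<in> polys W"
    by (auto intro!: polys_mvar assms simp: insert_index_def)
qed simp

lemma sub_minor_nonzero:
  assumes "increasing (n - 1) N \<tau>"
  shows "sub_minor \<tau> i \<noteq> (0 :: ('v, 'k::idom) mpoly)"
proof -
  have mono: "v (insert_index i r) (\<tau> r) < v (insert_index i r') (\<tau> l')"
    if "r \<le> r'" "r \<le> l'" "r' < n - 1" "l' < n - 1" "(r', l') \<noteq> (r, r)" for r r' l'
  proof (rule v_mono)
    show "(insert_index i r, \<tau> r) \<noteq> (insert_index i r', \<tau> l')"
      using that increasing_less[OF assms, of r l'] by (cases "r = r'") (auto simp: insert_index_def)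
  qed (use that increasing_le[OF assms] increasing_bound[OF assms] in \<open>auto simp: insert_index_def\<close>)
  show ?thesis unfolding sub_minor_def
    by (rule lm_det_variables(1)[of _ "n - 1" "\<lambda>r l. v (insert_index i r) (\<tau> l)"]) (use mono in auto)
qed

text \<open>The row vector of signed maximal minors of the columns \<open>\<tau>\<close>. It spans the left kernel of
  these \<open>n - 1\<close> columns generically, and its product with a further column is an \<open>n\<close>-minor up
  to sign.\<close>

definition cokernel :: "(nat \<Rightarrow> nat) \<Rightarrow> nat \<Rightarrow> ('v, 'k::comm_ring_1) mpoly" where
  "cokernel \<tau> i = (-1) ^ i * sub_minor \<tau> i"

lemma minor_cols_insert_at:
  assumes "i0 < n"
  shows "(minor_cols (insert_at i0 j \<tau>) :: ('v, 'k::comm_ring_1) mpoly) =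
    (\<Sum>i<n. (-1) ^ (i + i0) * sub_minor \<tau> i * x i j)"
proof -
  let ?A = "mat n n (\<lambda>(i, l). x i (insert_at i0 j \<tau> l)) :: ('v, 'k) mpoly mat"
  have n: "n = Suc (n - 1)" using n_pos by simp
  have "(minor_cols (insert_at i0 j \<tau>) :: ('v, 'k) mpoly) = (\<Sum>i<n. ?A $$ (i, i0) * cofactor ?A i i0)"
    unfolding minor_cols_def by (rule laplace_expansion_column) (use assms in auto)
  also have "\<dots> = (\<Sum>i<n. (-1) ^ (i + i0) * sub_minor \<tau> i * x i j)"
  proof (rule sum.cong[OF refl])
    fix i assume i: "i \<in> {..<n}"
    have "mat_delete ?A i i0 = mat (n - 1) (n - 1) (\<lambda>(r, l). x (insert_index i r) (\<tau> l))"
    proof (rule eq_matI)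
      fix r l assume "r < dim_row (mat (n - 1) (n - 1) (\<lambda>(r, l). x (insert_index i r) (\<tau> l)))"
        "l < dim_col (mat (n - 1) (n - 1) (\<lambda>(r, l). x (insert_index i r) (\<tau> l)))"
      then have rl: "r < n - 1" "l < n - 1" by auto
      have "mat_delete ?A i i0 $$ (r, l) = ?A $$ (insert_index i r, insert_index i0 l)"
        by (rule mat_delete_index[symmetric, of _ "n - 1"]) (use i assms rl n in auto)
      also have "\<dots> = x (insert_index i r) (\<tau> l)"
        using rl i assms by (auto simp: insert_at_def insert_index_def)
      finally show "mat_delete ?A i i0 $$ (r, l) = mat (n - 1) (n - 1) (\<lambda>(r, l). x (insert_index i r) (\<tau> l)) $$ (r, l)"
        using rl by simp
    qed auto
    moreover have "?A $$ (i, i0) = x i j" using i assms by (simp add: insert_at_def)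
    ultimately show "?A $$ (i, i0) * cofactor ?A i i0 = (-1) ^ (i + i0) * sub_minor \<tau> i * x i j"
      by (simp only: cofactor_def sub_minor_def mult_ac)
  qed
  finally show ?thesis .
qed

lemma cokernel_minor:
  assumes "i0 < n"
  shows "(\<Sum>i<n. cokernel \<tau> i * x i j) = (-1) ^ i0 * minor_cols (insert_at i0 j \<tau>)"
  unfolding minor_cols_insert_at[OF assms] sum_distrib_left cokernel_def
  by (intro sum.cong refl) (simp only: mult.assoc sign_add_mult)

lemma cokernel_zero:
  assumes "l < n - 1"
  shows "(\<Sum>i<n. cokernel \<tau> i * x i (\<tau> l)) = (0 :: ('v, 'k::comm_ring_1) mpoly)"
proof -
  let ?\<kappa> = "insert_at (n - 1) (\<tau> l) \<tau>"
  let ?A = "mat n n (\<lambda>(i, l). x i (?\<kappa> l)) :: ('v, 'k) mpoly mat"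
  have "col ?A l = col ?A (n - 1)" using assms by (intro eq_vecI) (auto simp: insert_at_def)
  then have "minor_cols ?\<kappa> = (0 :: ('v, 'k) mpoly)" unfolding minor_cols_def
    by (intro det_identical_columns[of _ n l "n - 1"]) (use assms in auto)
  moreover have "(\<Sum>i<n. cokernel \<tau> i * x i (\<tau> l)) = (-1) ^ (n - 1) * (minor_cols ?\<kappa> :: ('v, 'k) mpoly)"
    by (rule cokernel_minor) (use n_pos in simp)
  ultimately show ?thesis by simp
qed

text \<open>A column \<open>j\<close> that is not chosen falls into exactly one gap between the chosen columns;
  if it is the gap before \<open>\<tau> i\<close> (or after all of them, for \<open>i = n - 1\<close>), then \<open>(i, j)\<close> is on the
  diagonal of the \<open>n\<close>-minor of the columns \<open>\<tau>\<close> and \<open>j\<close>. These are the positions called gaps.\<close>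

definition gap :: "(nat \<Rightarrow> nat) \<Rightarrow> nat \<Rightarrow> nat \<Rightarrow> bool" where
  "gap \<tau> i j \<longleftrightarrow> i < n \<and> j < N \<and> (\<forall>l<i. \<tau> l < j) \<and> (\<forall>l. i \<le> l \<longrightarrow> l < n - 1 \<longrightarrow> j < \<tau> l)"

lemma gap_increasing:
  assumes "increasing (n - 1) N \<tau>" "gap \<tau> i j"
  shows "increasing n N (insert_at i j \<tau>)"
  unfolding increasing_def
proof (intro conjI allI impI)
  fix l assume "l < n"
  then show "insert_at i j \<tau> l < N" using assms by (auto simp: insert_at_def increasing_def gap_def)
next
  fix l l' assume l: "l < l'" "l' < n"
  have st: "\<tau> a < \<tau> b" if "a < b" "b < n - 1" for a b using assms(1) that by (auto simp: increasing_def)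
  have lo: "\<tau> a < j" if "a < i" for a using assms(2) that by (auto simp: gap_def)
  have hi: "j < \<tau> a" if "i \<le> a" "a < n - 1" for a using assms(2) that by (auto simp: gap_def)
  have i: "i < n" using assms(2) by (simp add: gap_def)
  consider "l' < i" | "l' = i" | "l < i" "l' > i" | "l = i" | "l > i" using l by linarith
  then show "insert_at i j \<tau> l < insert_at i j \<tau> l'"
  proof cases
    case 1 then show ?thesis using st[of l l'] l i by (auto simp: insert_at_def)
  next
    case 2 then show ?thesis using lo[of l] l by (auto simp: insert_at_def)
  next
    case 3
    then have "\<tau> l < j" "j < \<tau> (l' - 1)" using lo[of l] hi[of "l' - 1"] l by auto
    then have "\<tau> l < \<tau> (l' - 1)" by (rule less_trans)
    then show ?thesis using 3 by (simp add: insert_at_def)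
  next
    case 4 then show ?thesis using hi[of "l' - 1"] l by (auto simp: insert_at_def)
  next
    case 5 then show ?thesis using st[of "l - 1" "l' - 1"] l by (auto simp: insert_at_def)
  qed
qed

lemma gap_unique:
  assumes "gap \<tau> i j" "gap \<tau> i' j"
  shows "i = i'"
proof -
  have False if "gap \<tau> a j" "gap \<tau> b j" "a < b" for a b
  proof -
    have "\<tau> a < j" using that(2,3) by (simp add: gap_def)
    moreover have "a < n - 1" using that unfolding gap_def by linarith
    then have "j < \<tau> a" using that(1) by (simp add: gap_def)
    ultimately show False by simp
  qed
  then show ?thesis using assms by (metis linorder_neqE_nat)
qed

lemma gap_exists:
  assumes "increasing (n - 1) N \<tau>" "j < N" "\<And>l. l < n - 1 \<Longrightarrow> \<tau> l \<noteq> j"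
  shows "\<exists>i. gap \<tau> i j"
proof -
  define i where "i = (LEAST i. i = n - 1 \<or> j < \<tau> i)"
  have ii: "i = n - 1 \<or> j < \<tau> i" unfolding i_def by (rule LeastI[of _ "n - 1"]) simp
  have le: "i \<le> n - 1" unfolding i_def by (rule Least_le) simp
  have lo: "\<tau> l < j" if "l < i" for l
  proof -
    have "\<not> (l = n - 1 \<or> j < \<tau> l)" using that unfolding i_def by (rule not_less_Least)
    then show ?thesis using that le assms(3)[of l] by (metis less_le_trans linorder_neqE_nat)
  qed
  have hi: "j < \<tau> l" if "i \<le> l" "l < n - 1" for l
    using ii that assms(1) by (cases "l = i") (auto simp: increasing_def intro: less_trans)
  show ?thesis using le n_pos lo hi assms(2) by (intro exI[of _ i]) (auto simp: gap_def)
qed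

text \<open>Expand the \<open>n\<close>-minor of the columns \<open>\<tau>\<close> and \<open>j\<close> along column \<open>j\<close>. Its leading monomial is its
  diagonal, which passes through row \<open>i0\<close>, so the summand of row \<open>i0\<close> dominates.\<close>

lemma lm_cokernel_less:
  assumes \<tau>: "increasing (n - 1) N \<tau>" and gap: "gap \<tau> i0 j" and i: "i < n" "i \<noteq> i0"
  shows "lm (cokernel \<tau> i :: ('v, 'k::idom) mpoly) + single (v i j) 1 <
     lm (cokernel \<tau> i0 :: ('v, 'k::idom) mpoly) + single (v i0 j) 1"
proof -
  let ?g = "minor_cols (insert_at i0 j \<tau>) :: ('v, 'k) mpoly"
  let ?c = "\<lambda>i. (-1) ^ (i + i0) * sub_minor \<tau> i :: ('v, 'k) mpoly"
  let ?W = "{v r (\<tau> l) | r l. r < n \<and> l < n - 1}"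
  have i0: "i0 < n" "j < N" using gap by (auto simp: gap_def)
  have ne: "\<tau> l \<noteq> j" if "l < n - 1" for l
  proof (cases "l < i0")
    case True then show ?thesis using gap by (auto simp: gap_def)
  next
    case False then have "j < \<tau> l" using gap that unfolding gap_def by auto
    then show ?thesis by simp
  qed
  have tN: "\<tau> l < N" if "l < n - 1" for l using \<tau> that by (auto simp: increasing_def)
  note inc = gap_increasing[OF \<tau> gap]
  have lmg: "lm ?g = (\<Sum>i<n. single (v i (insert_at i0 j \<tau> i)) 1)" by (rule lm_minor_cols[OF inc])
  have lk: "lookup (lm ?g) (v i0 j) \<noteq> 0"
    unfolding lmg lookup_sum_single[OF finite_lessThan]
    using i0 by (auto simp: insert_at_def intro!: exI[of _ i0])
  have free: "?c i \<in> carrier (mpoly_ring ?W)" for i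
    by (intro polys_mult polys_power polys_uminus polys_1 sub_minor_polys) auto
  have nW: "v i j \<notin> ?W" if "i < n" for i
    using v_inj[OF that i0(2)] ne tN by fastforce
  have inj: "inj_on (\<lambda>i. v i j) {..<n}"
    using v_inj i0(2) by (auto simp: inj_on_def)
  note L = lm_linear_form[of "{..<n}" "\<lambda>i. v i j" ?c ?W ?g i0, OF _ inj free _ minor_cols_insert_at[OF i0(1)]
    lm_minor_cols(1)[OF inc] _ lk]
  have c: "?c i \<noteq> 0" using sub_minor_nonzero[OF \<tau>, of i] by simp
  have "lm (?c i) + single (v i j) 1 < lm ?g"
    by (rule L(3)) (use nW i0 i c in auto)
  also have "lm ?g = lm (?c i0) + single (v i0 j) 1"
    by (rule L(2)) (use nW i0 in auto)
  finally show ?thesis by (simp add: cokernel_def)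
qed

end

(* Indices are written n - 1 and t + 1 throughout; the simplifier must not turn the 1 into Suc 0. *)
declare One_nat_def [simp del]

section \<open>Size of rational functions\<close>

text \<open>A rational function has as leading monomial the quotient of those of numerator and
  denominator, which need not be a monomial. To avoid quotients of monomials, only comparisons with
  a monomial \<open>\<mu>\<close> are defined, after multiplication by the denominator.\<close>

definition at_most :: "('v::linorder, 'k::field) mpoly fract \<Rightarrow> 'v monomial \<Rightarrow> bool" where
  "at_most z \<mu> \<longleftrightarrow> (\<exists>a b. b \<noteq> 0 \<and> z = to_fract a / to_fract b \<and> (\<forall>m\<in>keys a. m \<le> lm b + \<mu>))"

definition below :: "('v::linorder, 'k::field) mpoly fract \<Rightarrow> 'v monomial \<Rightarrow> bool" where
  "below z \<mu> \<longleftrightarrow> (\<exists>a b. b \<noteq> 0 \<and> z = to_fract a / to_fract b \<and> (\<forall>m\<in>keys a. m < lm b + \<mu>))"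

lemma at_most_mult:
  assumes "at_most z \<mu>" "at_most z' \<mu>'"
  shows "at_most (z * z') (\<mu> + \<mu>')"
proof -
  obtain a b where ab: "b \<noteq> 0" "z = to_fract a / to_fract b" "\<And>m. m \<in> keys a \<Longrightarrow> m \<le> lm b + \<mu>"
    using assms(1) by (auto simp: at_most_def)
  obtain a' b' where ab': "b' \<noteq> 0" "z' = to_fract a' / to_fract b'" "\<And>m. m \<in> keys a' \<Longrightarrow> m \<le> lm b' + \<mu>'"
    using assms(2) by (auto simp: at_most_def)
  have "m \<le> lm (b * b') + (\<mu> + \<mu>')" if m: "m \<in> keys (a * a')" for m
  proof -
    obtain k k' where k: "m = k + k'" "k \<in> keys a" "k' \<in> keys a'"
      using subsetD[OF keys_mult m] by blast
    have "k + k' \<le> (lm b + \<mu>) + (lm b' + \<mu>')" by (rule add_mono[OF ab(3)[OF k(2)] ab'(3)[OF k(3)]])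
    then show ?thesis unfolding lm_mult[OF ab(1) ab'(1)] k(1) by (simp only: add_ac)
  qed
  then show ?thesis unfolding at_most_def
    using ab(1,2) ab'(1,2) by (intro exI[of _ "a * a'"] exI[of _ "b * b'"]) auto
qed

lemma at_most_1: "at_most 1 0"
  unfolding at_most_def by (rule exI[of _ 1], rule exI[of _ 1]) (auto simp: lm_def)

lemma at_most_const: "at_most (to_fract (single 0 c)) 0"
  unfolding at_most_def
  by (rule exI[of _ "single 0 c"], rule exI[of _ 1]) (auto simp: lm_def split: if_splits)

lemma at_most_power: "at_most z \<mu> \<Longrightarrow> at_most (z ^ k) (\<Sum>i<k. \<mu>)"
proof (induction k)
  case (Suc k)
  then have "at_most (z * z ^ k) (\<mu> + (\<Sum>i<k. \<mu>))" by (intro at_most_mult)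
  then show ?case by (simp add: add.commute del: sum_constant)
qed (simp add: at_most_1)

lemma at_most_prod:
  "finite A \<Longrightarrow> (\<And>w. w \<in> A \<Longrightarrow> at_most (z w) (\<mu> w)) \<Longrightarrow> at_most (\<Prod>w\<in>A. z w) (\<Sum>w\<in>A. \<mu> w)"
  by (induction A rule: finite_induct) (auto simp: at_most_1 intro: at_most_mult)

lemma at_most_mon_eval:
  assumes "\<And>w. at_most (s w) (single w 1)"
  shows "at_most (mon_eval s m) m"
proof -
  have sm: "(\<Sum>i<k. single w (1::nat)) = single w k" for k w
  proof (induction k)
    case (Suc k)
    have "(\<Sum>i<Suc k. single w (1::nat)) = single w (k + 1)"
      unfolding sum.lessThan_Suc Suc.IH single_add ..
    then show ?case by (simp only: Suc_eq_plus1)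
  qed simp
  have "at_most (mon_eval s m) (\<Sum>w\<in>keys m. single w (lookup m w))"
    unfolding mon_eval_def
    by (rule at_most_prod) (use at_most_power[OF assms, unfolded sm] in auto)
  then show ?thesis using poly_eq_sum_single[of m] by simp
qed

lemma below_of_at_most:
  assumes "at_most z m" "m < \<mu>"
  shows "below z \<mu>"
proof -
  obtain a b where ab: "b \<noteq> 0" "z = to_fract a / to_fract b" "\<And>k. k \<in> keys a \<Longrightarrow> k \<le> lm b + m"
    using assms(1) by (auto simp: at_most_def)
  have "k < lm b + \<mu>" if "k \<in> keys a" for k
    using ab(3)[OF that] add_strict_left_mono[OF assms(2), of "lm b"] by (rule le_less_trans)
  then show ?thesis using ab(1,2) unfolding below_def by blast
qed

lemma below_add:
  assumes "below z \<mu>" "below z' \<mu>"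
  shows "below (z + z') \<mu>"
proof -
  obtain a b where ab: "b \<noteq> 0" "z = to_fract a / to_fract b" "\<And>m. m \<in> keys a \<Longrightarrow> m < lm b + \<mu>"
    using assms(1) by (auto simp: below_def)
  obtain a' b' where ab': "b' \<noteq> 0" "z' = to_fract a' / to_fract b'" "\<And>m. m \<in> keys a' \<Longrightarrow> m < lm b' + \<mu>"
    using assms(2) by (auto simp: below_def)
  have *: "m < lm (b * b') + \<mu>" if m: "m \<in> keys (p * q)"
    and p: "\<And>m. m \<in> keys p \<Longrightarrow> m < lm c + \<mu>" and q: "q \<noteq> 0" "lm c + lm q = lm (b * b')" for m p q c
  proof -
    obtain k k' where k: "m = k + k'" "k \<in> keys p" "k' \<in> keys q"
      using m keys_mult[of p q] by blast
    have "k + k' < (lm c + \<mu>) + lm q" by (rule add_less_le_mono[OF p[OF k(2)] le_lm[OF k(3)]])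
    also have "\<dots> = lm (b * b') + \<mu>" unfolding q(2)[symmetric] by (simp only: add_ac)
    finally show ?thesis unfolding k(1) .
  qed
  have "m < lm (b * b') + \<mu>" if "m \<in> keys (a * b' + a' * b)" for m
  proof -
    have "m \<in> keys (a * b') \<or> m \<in> keys (a' * b)"
      using that Poly_Mapping.keys_add[of "a * b'" "a' * b"] by blast
    then show ?thesis
      using *[of m a b' b] *[of m a' b b'] ab(1,3) ab'(1,3) lm_mult[OF ab(1) ab'(1)] by (auto simp: add.commute)
  qed
  moreover have "z + z' = to_fract (a * b' + a' * b) / to_fract (b * b')"
    using ab(1,2) ab'(1,2) by (simp add: field_simps)
  ultimately show ?thesis unfolding below_def using ab(1) ab'(1)
    by (intro exI[of _ "a * b' + a' * b"] exI[of _ "b * b'"]) auto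
qed

lemma below_0: "below 0 \<mu>"
  unfolding below_def by (rule exI[of _ 0], rule exI[of _ 1]) auto

lemma below_sum: "(\<And>i. i \<in> A \<Longrightarrow> below (z i) \<mu>) \<Longrightarrow> below (sum z A) \<mu>"
  by (induction A rule: infinite_finite_induct) (auto simp: below_0 intro: below_add)

lemma not_below_monomial:
  assumes "c \<noteq> 0"
  shows "\<not> below (- to_fract (single \<mu> c)) \<mu>"
proof
  assume "below (- to_fract (single \<mu> c)) \<mu>"
  then obtain a b where ab: "b \<noteq> 0" "- to_fract (single \<mu> c) = to_fract a / to_fract b"
    "\<And>m. m \<in> keys a \<Longrightarrow> m < lm b + \<mu>"
    by (auto simp: below_def)
  then have "to_fract a = to_fract (- (single \<mu> c * b))"
    by (simp add: field_simps)
  then have a: "a = - (single \<mu> c * b)" by (simp only: to_fract_eq_iff)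
  have s: "single \<mu> c \<noteq> 0" using assms by (metis lookup_single_eq lookup_zero)
  then have "a \<noteq> 0" using a ab(1) by simp
  moreover have "lm a = lm b + \<mu>" using a lm_mult[OF s ab(1)] assms by (simp add: add.commute)
  ultimately show False using ab(3)[OF lm_in_keys] by auto
qed

lemma to_fract_hom: "comm_ring_hom (to_fract :: 'a::idom \<Rightarrow> 'a fract)"
  by unfold_locales auto

lemma comp_hom:
  assumes "comm_ring_hom f" "comm_ring_hom g"
  shows "comm_ring_hom (\<lambda>a. f (g a))"
proof -
  interpret f: comm_ring_hom f by fact
  interpret g: comm_ring_hom g by fact
  show ?thesis by unfold_locales (simp_all add: f.hom_add f.hom_mult g.hom_add g.hom_mult)
qed

section \<open>Matrices of rank less than \<open>n\<close>\<close>

context variable_matrix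
begin

lemma last_less [simp]: "n - 1 < n"
  using n_pos by linarith

definition last_row :: "'v set" where
  "last_row = v (n - 1) ` {..<N}"

text \<open>The last row is replaced by a generic linear combination of the other rows. No new
  variables are needed for the coefficients: the first \<open>n - 1\<close> variables of the last row are free
  to serve as such, since the substitution removes their original occurrences.\<close>

definition param_point :: "'v \<Rightarrow> ('v, 'k::comm_ring_1) mpoly" where
  "param_point w = (if w \<in> last_row
     then \<Sum>i<n - 1. x (n - 1) i * x i (THE j. j < N \<and> w = v (n - 1) j) else mvar w)"

definition param :: "('v, 'k::comm_ring_1) mpoly \<Rightarrow> ('v, 'k) mpoly" where
  "param = mp_eval (single 0) param_point"

lemma param_hom: "comm_ring_hom (param :: ('v, 'k::comm_ring_1) mpoly \<Rightarrow> _)"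
  unfolding param_def by (rule mp_eval_hom[OF const_hom])

lemma param_point_last: "j < N \<Longrightarrow> param_point (v (n - 1) j) = (\<Sum>i<n - 1. x (n - 1) i * x i j)"
proof -
  assume j: "j < N"
  have "(THE j'. j' < N \<and> v (n - 1) j = v (n - 1) j') = j"
  proof (rule the_equality)
    fix j' assume "j' < N \<and> v (n - 1) j = v (n - 1) j'"
    then show "j' = j" using v_inj[OF last_less j last_less, of j'] by metis
  qed (use j in simp)
  then show ?thesis using j by (simp add: param_point_def last_row_def)
qed

lemma param_mvar: "param (mvar w) = param_point w"
  unfolding param_def by (rule mp_eval_mvar[OF const_hom])

lemma param_free: "c \<in> polys (V - last_row) \<Longrightarrow> param c = c"
  unfolding param_def by (rule mp_eval_id) (auto simp: param_point_def)

lemma free_var: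
  assumes "i < n - 1" "j < N"
  shows "v i j \<in> V - last_row"
proof -
  have "v i j \<noteq> v (n - 1) j'" if "j' < N" for j'
  proof
    assume "v i j = v (n - 1) j'"
    then have "i = n - 1" using v_inj[of i j "n - 1" j'] assms that by simp
    then show False using assms by simp
  qed
  then show ?thesis using assms v_in_V[of i j] by (auto simp: last_row_def)
qed

text \<open>Minors that contain the last row of \<open>X\<close> have this property by expansion along that row:
  \<open>c\<close> collects the cofactors, and expanding along the wrong row gives \<open>0\<close>.\<close>

definition row_linear :: "('v, 'k::comm_ring_1) mpoly \<Rightarrow> (nat \<Rightarrow> ('v, 'k) mpoly) \<Rightarrow> bool" where
  "row_linear g c \<longleftrightarrow> (\<forall>j<N. c j \<in> polys (V - last_row)) \<and>
     g = (\<Sum>j<N. c j * x (n - 1) j) \<and> (\<forall>i<n - 1. (\<Sum>j<N. c j * x i j) = 0)"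

lemma param_row_linear:
  assumes "row_linear (g :: ('v, 'k::comm_ring_1) mpoly) c"
  shows "param g = 0"
proof -
  interpret param: comm_ring_hom "param :: ('v, 'k) mpoly \<Rightarrow> _" by (rule param_hom)
  have "param g = (\<Sum>j<N. param (c j) * param (x (n - 1) j))"
    using assms by (simp add: row_linear_def param.hom_sum param.hom_mult)
  also have "\<dots> = (\<Sum>j<N. c j * (\<Sum>i<n - 1. x (n - 1) i * x i j))"
    by (rule sum.cong) (use assms in \<open>auto simp: row_linear_def param_free param_mvar param_point_last\<close>)
  also have "\<dots> = (\<Sum>i<n - 1. x (n - 1) i * (\<Sum>j<N. c j * x i j))"
    unfolding sum_distrib_left by (subst sum.swap) (simp add: mult_ac)
  also have "\<dots> = 0" using assms by (simp add: row_linear_def)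
  finally show ?thesis .
qed

text \<open>The matrix \<open>Z\<close> contains rows of \<open>X\<close>, restricted to a choice of columns and padded with zeros, at
  the positions \<open>\<rho>\<close>; the column \<open>l\<close> of \<open>Z\<close> comes from the column \<open>\<gamma> l\<close> of \<open>X\<close>. This covers both the
  minors of \<open>X\<close> and the larger minors of \<open>D\<^sup>*\<close> and \<open>D\<^sub>*\<close>, in which \<open>X\<close> is a block row.\<close>

lemma row_linear_det:
  fixes Z :: "('v, 'k::comm_ring_1) mpoly mat"
  assumes Z: "Z \<in> carrier_mat L L"
    and \<rho>: "\<And>i. i < n \<Longrightarrow> \<rho> i < L" "\<And>i. i < n - 1 \<Longrightarrow> \<rho> i \<noteq> \<rho> (n - 1)"
    and C: "C \<subseteq> {..<L}" "\<gamma> ` C \<subseteq> {..<N}"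
    and rows: "\<And>i l. i < n \<Longrightarrow> l < L \<Longrightarrow> Z $$ (\<rho> i, l) = (if l \<in> C then x i (\<gamma> l) else 0)"
    and free: "\<And>r l. r < L \<Longrightarrow> l < L \<Longrightarrow> r \<noteq> \<rho> (n - 1) \<Longrightarrow> Z $$ (r, l) \<in> polys (V - last_row)"
  shows "\<exists>c. row_linear (det Z) c"
proof -
  let ?R = "\<rho> (n - 1)"
  have R: "?R < L" by (rule \<rho>(1)) (rule last_less)
  have finC: "finite C" using C(1) finite_subset by blast
  define c where "c j = (\<Sum>l\<in>{l \<in> C. \<gamma> l = j}. cofactor Z ?R l)" for j
  have cof: "cofactor Z ?R l \<in> polys (V - last_row)" if l: "l < L" for l
    by (rule polys_cofactor[OF Z R l free])
  have regroup: "(\<Sum>l<L. Z $$ (\<rho> i, l) * cofactor Z ?R l) = (\<Sum>j<N. c j * x i j)" if i: "i < n" for i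
  proof -
    have "(\<Sum>l<L. Z $$ (\<rho> i, l) * cofactor Z ?R l) = (\<Sum>l\<in>C. cofactor Z ?R l * x i (\<gamma> l))"
      by (rule sum.mono_neutral_cong_right) (use C(1) rows[OF i] in \<open>auto simp: mult.commute\<close>)
    also have "\<dots> = (\<Sum>j<N. \<Sum>l\<in>{l \<in> C. \<gamma> l = j}. cofactor Z ?R l * x i (\<gamma> l))"
      by (rule sum.group[symmetric]) (use finC C(2) in auto)
    also have "\<dots> = (\<Sum>j<N. c j * x i j)"
      unfolding c_def sum_distrib_right by (intro sum.cong) auto
    finally show ?thesis .
  qed
  have "row_linear (det Z) c" unfolding row_linear_def
  proof (intro conjI allI impI)
    fix j show "c j \<in> polys (V - last_row)"
      unfolding c_def by (intro polys_sum cof) (use C(1) in auto)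
  next
    show "det Z = (\<Sum>j<N. c j * x (n - 1) j)"
      unfolding laplace_expansion_row[OF Z R] by (rule regroup) (rule last_less)
  next
    fix i assume i: "i < n - 1"
    have ne: "\<rho> i \<noteq> ?R" and lt: "\<rho> i < L" using \<rho>(1)[of i] \<rho>(2)[OF i] i by auto
    have "(\<Sum>l<L. Z $$ (\<rho> i, l) * cofactor Z ?R l) = (Z * adj_mat Z) $$ (\<rho> i, ?R)"
      using Z R lt by (simp add: scalar_prod_def adj_mat_def atLeast0LessThan)
    also have "\<dots> = 0" unfolding adj_mat(2)[OF Z] using R lt ne by simp
    finally show "(\<Sum>j<N. c j * x i j) = 0" using regroup[of i] i by simp
  qed
  then show ?thesis by blast
qed

lemma row_linear_minor_cols:
  assumes "\<And>l. l < n \<Longrightarrow> \<kappa> l < N"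
  shows "\<exists>c. row_linear (minor_cols \<kappa> :: ('v, 'k::comm_ring_1) mpoly) c"
  unfolding minor_cols_def
proof (rule row_linear_det[of _ n "\<lambda>i. i" "{..<n}" \<kappa>])
  fix r l assume rl: "r < n" "l < n" "r \<noteq> n - 1"
  then have "v r (\<kappa> l) \<in> V - last_row" by (intro free_var assms) auto
  then show "mat n n (\<lambda>(i, l). x i (\<kappa> l)) $$ (r, l) \<in> polys (V - last_row)"
    using rl by (auto intro: polys_mvar)
qed (use assms n_pos in auto)

lemma param_ideal:
  assumes "g \<in> max_minors_ideal"
  shows "param (g :: ('v, 'k::comm_ring_1) mpoly) = 0"
proof -
  interpret param: comm_ring_hom "param :: ('v, 'k) mpoly \<Rightarrow> _" by (rule param_hom)
  have "max_minors_ideal \<subseteq> {g \<in> polys V. param (g :: ('v, 'k) mpoly) = 0}"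
  proof (rule max_minors_ideal_subset)
    show "ideal {g \<in> polys V. param (g :: ('v, 'k) mpoly) = 0} (mpoly_ring V)"
      by (rule mpoly_idealI) (auto simp: param.hom_add param.hom_mult)
    fix \<kappa> assume "increasing n N \<kappa>"
    then have "\<And>l. l < n \<Longrightarrow> \<kappa> l < N" by (simp add: increasing_def)
    then show "minor_cols \<kappa> \<in> {g \<in> polys V. param (g :: ('v, 'k) mpoly) = 0}"
      using row_linear_minor_cols[of \<kappa>] param_row_linear minor_cols_polys[of \<kappa>] by blast
  qed
  then show ?thesis using assms by blast
qed

text \<open>The point \<open>\<xi>\<close> is a matrix over the field of rational functions. Outside the gaps its entries are
  the variables, and the entry in a gap is the only one for which the vector \<open>cokernel \<tau>\<close> annihilates
  its column. So \<open>\<xi>\<close> has a nonzero left kernel vector, its last row is a combination of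
  the others, and evaluation at \<open>\<xi>\<close> factors through \<open>param\<close>. By \<open>lm_cokernel_less\<close> an entry in a gap is
  not larger than the variable that it replaces. As the leading monomial of \<open>g\<close> avoids the gaps, it
  evaluates to itself, whereas all other monomials of \<open>g\<close> evaluate to something smaller.\<close>

lemma param_nonzero:
  fixes g :: "('v, 'k::field) mpoly"
  assumes \<tau>: "increasing (n - 1) N \<tau>" and g: "g \<noteq> 0"
    and std: "\<And>i j. gap \<tau> i j \<Longrightarrow> lookup (lm g) (v i j) = 0"
  shows "param g \<noteq> 0"
proof
  assume param0: "param g = 0"
  interpret param: comm_ring_hom "param :: ('v, 'k) mpoly \<Rightarrow> _" by (rule param_hom)
  let ?c = "cokernel \<tau> :: nat \<Rightarrow> ('v, 'k) mpoly"
  let ?S = "\<lambda>i j. \<Sum>i'\<in>{..<n} - {i}. ?c i' * x i' j"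
  let ?\<iota> = "\<lambda>c. to_fract (single 0 c) :: ('v, 'k) mpoly fract"
  have \<iota>: "comm_ring_hom ?\<iota>" by (rule comp_hom[OF to_fract_hom const_hom])
  have cnz: "?c i \<noteq> 0" for i unfolding cokernel_def using sub_minor_nonzero[OF \<tau>] by simp
  define \<xi> :: "'v \<Rightarrow> ('v, 'k) mpoly fract" where
    "\<xi> w = (if \<exists>i j. gap \<tau> i j \<and> w = v i j
       then case SOME p. gap \<tau> (fst p) (snd p) \<and> w = v (fst p) (snd p) of
         (i, j) \<Rightarrow> - to_fract (?S i j) / to_fract (?c i)
       else to_fract (mvar w))" for w
  have \<xi>_gap: "\<xi> (v i j) = - to_fract (?S i j) / to_fract (?c i)" if gap: "gap \<tau> i j" for i j
  proof -
    have "(SOME p. gap \<tau> (fst p) (snd p) \<and> v i j = v (fst p) (snd p)) = (i, j)"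
    proof (rule some_equality)
      fix p assume "gap \<tau> (fst p) (snd p) \<and> v i j = v (fst p) (snd p)"
      then have "i = fst p \<and> j = snd p" using gap by (intro v_inj) (auto simp: gap_def)
      then show "p = (i, j)" by (simp add: prod_eq_iff)
    qed (use gap in simp)
    then show ?thesis using gap by (auto simp: \<xi>_def)
  qed
  have \<xi>_free: "\<xi> w = to_fract (mvar w)" if "\<And>i j. gap \<tau> i j \<Longrightarrow> w \<noteq> v i j" for w
    using that by (auto simp: \<xi>_def)
  have \<xi>_nogap: "\<xi> (v i j) = to_fract (x i j)" if "\<not> gap \<tau> i j" "i < n" "j < N" for i j
  proof (rule \<xi>_free)
    fix i' j' assume g: "gap \<tau> i' j'"
    show "v i j \<noteq> v i' j'"
    proof
      assume "v i j = v i' j'"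
      then have "i = i' \<and> j = j'" using g that(2,3) by (intro v_inj) (auto simp: gap_def)
      then show False using g that(1) by simp
    qed
  qed
  have kernel: "(\<Sum>i<n. to_fract (?c i) * \<xi> (v i j)) = 0" if j: "j < N" for j
  proof (cases "\<exists>i. gap \<tau> i j")
    case True
    then obtain i0 where i0: "gap \<tau> i0 j" by blast
    then have "i0 < n" by (simp add: gap_def)
    have "(\<Sum>i\<in>{..<n} - {i0}. to_fract (?c i) * \<xi> (v i j)) = (\<Sum>i\<in>{..<n} - {i0}. to_fract (?c i * x i j))"
    proof (rule sum.cong[OF refl])
      fix i assume i: "i \<in> {..<n} - {i0}"
      then have "\<not> gap \<tau> i j" using gap_unique[OF i0] by blast
      then have "\<xi> (v i j) = to_fract (x i j)" by (rule \<xi>_nogap) (use i j in auto)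
      then show "to_fract (?c i) * \<xi> (v i j) = to_fract (?c i * x i j)" by simp
    qed
    then show ?thesis
      using \<open>i0 < n\<close> cnz[of i0] by (subst sum.remove[of _ i0]) (auto simp: \<xi>_gap[OF i0] simp del: to_fract_mult)
  next
    case False
    then obtain l where l: "l < n - 1" "\<tau> l = j" using gap_exists[OF \<tau> j] by blast
    have "(\<Sum>i<n. to_fract (?c i) * \<xi> (v i j)) = to_fract (\<Sum>i<n. ?c i * x i j)"
      unfolding to_fract_sum using False j by (intro sum.cong refl) (auto simp: \<xi>_nogap)
    also have "(\<Sum>i<n. ?c i * x i j) = 0" using cokernel_zero[OF l(1)] l(2) by blast
    finally show ?thesis by simp
  qed
  \<comment> \<open>The coefficients that express the last row of the matrix by the other rows.\<close>
  define s where "s w = (if w \<in> v (n - 1) ` {..<n - 1}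
      then - to_fract (?c (THE i. i < n - 1 \<and> w = v (n - 1) i)) / to_fract (?c (n - 1)) else \<xi> w)" for w
  have s_last: "s (v (n - 1) i) = - to_fract (?c i) / to_fract (?c (n - 1))" if i: "i < n - 1" for i
  proof -
    have "(THE i'. i' < n - 1 \<and> v (n - 1) i = v (n - 1) i') = i"
    proof (rule the_equality)
      fix i' assume i': "i' < n - 1 \<and> v (n - 1) i = v (n - 1) i'"
      then have "i < N" "i' < N" using i n_le_N by linarith+
      then show "i' = i" using v_inj[OF last_less _ last_less, of i i'] i' by metis
    qed (use i in simp)
    then show ?thesis using i by (simp add: s_def)
  qed
  have s_other: "s w = \<xi> w" if "w \<notin> last_row" for w
    using that n_le_N by (auto simp: s_def last_row_def)
  let ?E = "mp_eval ?\<iota> \<xi>" and ?\<theta> = "mp_eval ?\<iota> s"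
  interpret \<theta>: comm_ring_hom ?\<theta> by (rule mp_eval_hom[OF \<iota>])
  have "?\<theta> (param g) = ?E g"
  proof (rule hom_eq_mp_eval[OF \<iota> comp_hom[OF mp_eval_hom[OF \<iota>] param_hom], of _ UNIV])
    show "?\<theta> (param (single 0 c)) = ?\<iota> c" for c
      unfolding param_def mp_eval_const[OF const_hom] mp_eval_const[OF \<iota>] ..
    show "g \<in> polys UNIV" by (simp add: mem_polys monomials_in_def)
    fix w
    show "?\<theta> (param (mvar w)) = \<xi> w"
    proof (cases "w \<in> last_row")
      case False
      then show ?thesis unfolding param_mvar by (simp add: param_point_def mp_eval_mvar[OF \<iota>] s_other)
    next
      case True
      then obtain j where j: "j < N" "w = v (n - 1) j" by (auto simp: last_row_def)
      have eq: "to_fract (?c (n - 1)) * \<xi> (v (n - 1) j) = - (\<Sum>i<n - 1. to_fract (?c i) * \<xi> (v i j))"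
        using kernel[OF j(1)] n_pos by (cases n) (auto simp: add_eq_0_iff2)
      have "?\<theta> (param (mvar w)) = (\<Sum>i<n - 1. s (v (n - 1) i) * s (v i j))"
        unfolding param_mvar j(2) param_point_last[OF j(1)] by (simp add: \<theta>.hom_sum \<theta>.hom_mult mp_eval_mvar[OF \<iota>])
      also have "\<dots> = (\<Sum>i<n - 1. - (to_fract (?c i) * \<xi> (v i j)) / to_fract (?c (n - 1)))"
        using free_var[OF _ j(1)] by (intro sum.cong refl) (auto simp: s_last s_other)
      also have "\<dots> = - (\<Sum>i<n - 1. to_fract (?c i) * \<xi> (v i j)) / to_fract (?c (n - 1))"
        by (simp add: sum_negf sum_divide_distrib)
      also have "\<dots> = \<xi> w" unfolding eq[symmetric] j(2) using cnz by simp
      finally show ?thesis .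
    qed
  qed
  then have E0: "?E g = 0" using param0 by simp
  have bound: "at_most (\<xi> w) (single w 1)" for w
  proof (cases "\<exists>i j. gap \<tau> i j \<and> w = v i j")
    case False
    then have "\<xi> w = to_fract (mvar w) / to_fract 1" using \<xi>_free[of w] by auto
    then show ?thesis unfolding at_most_def
      by (intro exI[of _ "mvar w"] exI[of _ 1]) (auto simp: mvar_def lm_def)
  next
    case True
    then obtain i j where ij: "gap \<tau> i j" "w = v i j" by blast
    have "m \<le> lm (?c i) + single w 1" if m: "m \<in> keys (- ?S i j)" for m
    proof -
      have "m \<in> keys (?S i j)" using m by (simp add: in_keys_iff)
      then obtain i' where i': "i' < n" "i' \<noteq> i" "m \<in> keys (?c i' * x i' j)"
        using keys_sum_subset_UN[of "\<lambda>i'. ?c i' * x i' j" "{..<n} - {i}"] by blast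
      have "m \<le> lm (?c i' * x i' j)" by (rule le_lm[OF i'(3)])
      also have "\<dots> = lm (?c i') + single (v i' j) 1" using cnz by (simp add: lm_mult)
      also have "\<dots> < lm (?c i) + single (v i j) 1" by (rule lm_cokernel_less[OF \<tau> ij(1) i'(1,2)])
      finally show ?thesis unfolding ij(2) by simp
    qed
    moreover have "\<xi> w = to_fract (- ?S i j) / to_fract (?c i)" unfolding ij(2) \<xi>_gap[OF ij(1)] by simp
    ultimately show ?thesis unfolding at_most_def using cnz[of i] by blast
  qed
  let ?\<mu> = "lm g"
  let ?rest = "\<Sum>m\<in>keys g - {?\<mu>}. ?\<iota> (lookup g m) * mon_eval \<xi> m"
  have lead: "mon_eval \<xi> ?\<mu> = to_fract (single ?\<mu> 1)"
  proof -
    interpret tf: comm_ring_hom "to_fract :: ('v, 'k) mpoly \<Rightarrow> _" by (rule to_fract_hom)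
    have "mon_eval \<xi> ?\<mu> = (\<Prod>w\<in>keys ?\<mu>. to_fract (mvar w) ^ lookup ?\<mu> w)"
      unfolding mon_eval_def
    proof (intro prod.cong refl)
      fix w assume "w \<in> keys ?\<mu>"
      then have "\<xi> w = to_fract (mvar w)" by (intro \<xi>_free) (auto simp: in_keys_iff std)
      then show "\<xi> w ^ lookup ?\<mu> w = to_fract (mvar w) ^ lookup ?\<mu> w" by simp
    qed
    also have "\<dots> = to_fract (mon_eval mvar ?\<mu>)"
      by (simp add: mon_eval_def tf.hom_prod tf.hom_power)
    finally show ?thesis by (simp add: mon_eval_mvar)
  qed
  have "below ?rest ?\<mu>"
  proof (rule below_sum)
    fix m assume m: "m \<in> keys g - {?\<mu>}"
    have "at_most (?\<iota> (lookup g m) * mon_eval \<xi> m) (0 + m)"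
      by (intro at_most_mult at_most_const at_most_mon_eval bound)
    moreover have "m < ?\<mu>" using m le_lm[of m g] by (simp add: order_less_le)
    ultimately show "below (?\<iota> (lookup g m) * mon_eval \<xi> m) ?\<mu>"
      by (intro below_of_at_most[of _ m]) simp_all
  qed
  moreover have "?E g = to_fract (single ?\<mu> (lookup g ?\<mu>)) + ?rest"
  proof -
    have "?\<iota> c * to_fract (single ?\<mu> 1) = to_fract (single ?\<mu> c)" for c
      by (simp add: mult_single flip: to_fract_mult)
    then show ?thesis
      unfolding mp_eval_def using lm_in_keys[OF g] by (subst sum.remove[of _ ?\<mu>]) (auto simp: lead)
  qed
  ultimately show False
    using E0 not_below_monomial[of "lookup g ?\<mu>" ?\<mu>] lookup_lm_nonzero[OF g]
    by (simp add: add_eq_0_iff)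
qed

end

text \<open>Choose \<open>\<tau> i\<close> as the first column after \<open>\<tau> (i - 1)\<close> that is marked in row \<open>i\<close>, but not beyond the
  last column that leaves room for the remaining choices. By construction no gap of the
  first \<open>n - 1\<close> rows is marked. If the bound was reached once, then \<open>\<tau>\<close> ends with the last column and row
  \<open>n - 1\<close> has no gap. Otherwise a marked gap of that row would extend \<open>\<tau>\<close> to a marked diagonal.\<close>

lemma greedy_columns:
  fixes A :: "nat \<Rightarrow> nat \<Rightarrow> bool"
  assumes n: "0 < n" "n \<le> N"
    and none: "\<And>\<kappa>. increasing n N \<kappa> \<Longrightarrow> \<exists>i<n. \<not> A i (\<kappa> i)"
  obtains \<tau> where "increasing (n - 1) N \<tau>"
    and "\<And>i j. i < n \<Longrightarrow> j < N \<Longrightarrow> (\<And>l. l < i \<Longrightarrow> \<tau> l < j) \<Longrightarrow>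
      (\<And>l. i \<le> l \<Longrightarrow> l < n - 1 \<Longrightarrow> j < \<tau> l) \<Longrightarrow> \<not> A i j"
proof -
  define B where "B i j \<longleftrightarrow> A i j \<or> N - n + 1 + i \<le> j" for i j
  define \<tau> where "\<tau> = rec_nat (LEAST j. B 0 j) (\<lambda>i t. LEAST j. t < j \<and> B (Suc i) j)"
  have t0: "\<tau> 0 = (LEAST j. B 0 j)" and tS: "\<tau> (Suc i) = (LEAST j. \<tau> i < j \<and> B (Suc i) j)" for i
    by (simp_all add: \<tau>_def)
  have B_cap: "B i (N - n + 1 + i)" for i by (simp add: B_def)
  have cap: "\<tau> i \<le> N - n + 1 + i" for i
  proof (induction i)
    case 0 show ?case unfolding t0 by (rule Least_le) (use B_cap[of 0] in simp)
  next
    case (Suc i) show ?case unfolding tS by (rule Least_le) (use Suc B_cap[of "Suc i"] in auto)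
  qed
  have step: "\<tau> i < \<tau> (Suc i) \<and> B (Suc i) (\<tau> (Suc i))" for i
    unfolding tS by (rule LeastI[of _ "N - n + 1 + Suc i"]) (use cap[of i] B_cap[of "Suc i"] in auto)
  have B: "B i (\<tau> i)" for i
  proof (cases i)
    case 0
    have "B 0 (\<tau> 0)" unfolding t0 by (rule LeastI[of _ "N - n + 1 + 0"]) (rule B_cap)
    then show ?thesis using 0 by simp
  next
    case (Suc k) then show ?thesis using step[of k] by simp
  qed
  have mono: "\<tau> l < \<tau> l'" if "l < l'" for l l'
    by (rule lift_Suc_mono_less[of \<tau>, OF _ that]) (use step in blast)
  have inc: "increasing (n - 1) N \<tau>"
    unfolding increasing_def
  proof (intro conjI allI impI)
    fix l assume "l < n - 1" then show "\<tau> l < N" using cap[of l] n by linarith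
  next
    fix l l' :: nat assume "l < l'" then show "\<tau> l < \<tau> l'" by (rule mono)
  qed
  show thesis
  proof (rule that[OF inc])
    fix i j assume i: "i < n" and j: "j < N" and lo: "\<And>l. l < i \<Longrightarrow> \<tau> l < j"
      and hi: "\<And>l. i \<le> l \<Longrightarrow> l < n - 1 \<Longrightarrow> j < \<tau> l"
    show "\<not> A i j"
    proof (cases "i < n - 1")
      case True
      then have jt: "j < \<tau> i" by (intro hi) auto
      have "\<not> B i j"
      proof (cases i)
        case 0 then show ?thesis using jt not_less_Least[of j "B 0"] unfolding t0[symmetric] by blast
      next
        case (Suc i')
        then show ?thesis using jt lo[of i'] not_less_Least[of j "\<lambda>j. \<tau> i' < j \<and> B (Suc i') j"]
            unfolding tS[symmetric] by blast
      qed
      then show ?thesis by (simp add: B_def)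
    next
      case False
      then have i': "i = n - 1" using i by simp
      show ?thesis
      proof
        assume Aj: "A i j"
        define \<kappa> where "\<kappa> l = (if l = n - 1 then j else \<tau> l)" for l
        have "increasing n N \<kappa>"
          unfolding increasing_def
        proof (intro conjI allI impI)
          fix l assume "l < n"
          then show "\<kappa> l < N" using j increasing_bound[OF inc, of l] by (cases "l = n - 1") (auto simp: \<kappa>_def)
        next
          fix l l' assume l: "l < l'" "l' < n"
          then have "l < n - 1" by linarith
          then have "\<kappa> l = \<tau> l" "\<tau> l < j" using lo[of l] i' by (auto simp: \<kappa>_def)
          then show "\<kappa> l < \<kappa> l'" using mono[OF l(1)] by (simp add: \<kappa>_def)
        qed
        then obtain l where l: "l < n" "\<not> A l (\<kappa> l)" using none by blast
        then have l1: "l < n - 1" using Aj i' by (cases "l = n - 1") (auto simp: \<kappa>_def)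
        then have "\<not> A l (\<tau> l)" using l by (simp add: \<kappa>_def)
        then have "N - n + 1 + l \<le> \<tau> l" using B[of l] by (simp add: B_def)
        moreover have "\<tau> l + d \<le> \<tau> (l + d)" for d
        proof (induction d)
          case (Suc d) then show ?case using step[of "l + d"] by simp
        qed simp
        from this[of "n - 2 - l"] have "\<tau> l + (n - 2 - l) \<le> \<tau> (n - 2)" using l1 by simp
        moreover have "\<tau> (n - 2) < j" using l1 by (intro lo) (simp add: i')
        ultimately show False using j l1 n by linarith
      qed
    qed
  qed
qed

context variable_matrix
begin

lemma not_standard_divides:
  fixes m :: "'v monomial"
  assumes "increasing n N \<kappa>" "\<And>i. i < n \<Longrightarrow> lookup m (v i (\<kappa> i)) \<noteq> 0"
  obtains q where "m = q + (\<Sum>i<n. single (v i (\<kappa> i)) 1)"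
proof
  let ?d = "\<Sum>i<n. single (v i (\<kappa> i)) (1::nat)"
  have "lookup ?d u \<le> lookup m u" for u
  proof (cases "\<exists>i<n. u = v i (\<kappa> i)")
    case True
    then obtain i where i: "i < n" "u = v i (\<kappa> i)" by blast
    have "lookup ?d u = (\<Sum>k<n. if k = i then 1 else 0)"
      unfolding lookup_sum_single[OF finite_lessThan] i(2)
    proof (rule sum.cong[OF refl])
      fix k assume "k \<in> {..<n}"
      then have "v k (\<kappa> k) = v i (\<kappa> i) \<longleftrightarrow> k = i"
        using v_inj[of k "\<kappa> k" i "\<kappa> i"] i(1) increasing_bound[OF assms(1)] by auto
      then show "(if v k (\<kappa> k) = v i (\<kappa> i) then 1 else 0) = (if k = i then 1 else (0::nat))" by simp
    qed
    also have "\<dots> = 1" using i(1) by simp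
    finally show ?thesis using assms(2)[OF i(1)] i(2) by simp
  next
    case False
    then have "lookup ?d u = 0"
      unfolding lookup_sum_single[OF finite_lessThan] by (intro sum.neutral) auto
    then show ?thesis by simp
  qed
  then show "m = (m - ?d) + ?d"
    by (intro poly_mapping_eqI) (simp add: lookup_add lookup_minus)
qed

text \<open>The second fundamental theorem for maximal minors: a polynomial that vanishes on all
  matrices of rank less than \<open>n\<close> is a combination of \<open>n\<close>-minors. The proof is division by the minors,
  by induction on the leading monomial.\<close>

theorem param_eq_0_imp_in_ideal:
  fixes g :: "('v, 'k::field) mpoly"
  assumes "g \<in> polys V" "param g = 0"
  shows "g \<in> max_minors_ideal"
proof -
  interpret param: comm_ring_hom "param :: ('v, 'k) mpoly \<Rightarrow> _" by (rule param_hom)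
  have "\<forall>g :: ('v, 'k) mpoly. lm g = m \<longrightarrow> g \<noteq> 0 \<longrightarrow> g \<in> polys V \<longrightarrow> param g = 0 \<longrightarrow> g \<in> max_minors_ideal" for m
  proof (induction m rule: wf_induct_rule[OF wf_less_monomials_in[OF finite_V]])
    case (1 m)
    show ?case
    proof (intro allI impI)
      fix g :: "('v, 'k) mpoly"
      assume m: "lm g = m" and g: "g \<noteq> 0" "g \<in> polys V" "param g = 0"
      have mV: "m \<in> monomials_in V" using lm_in_keys[OF g(1)] g(2) by (auto simp: m mem_polys)
      show "g \<in> max_minors_ideal"
      proof (cases "\<exists>\<kappa>. increasing n N \<kappa> \<and> (\<forall>i<n. lookup m (v i (\<kappa> i)) \<noteq> 0)")
        case False
        have "\<exists>i<n. \<not> lookup m (v i (\<kappa> i)) \<noteq> 0" if "increasing n N \<kappa>" for \<kappa>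
          using False that by blast
        from greedy_columns[where A = "\<lambda>i j. lookup m (v i j) \<noteq> 0", OF n_pos n_le_N this] obtain \<tau> where \<tau>: "increasing (n - 1) N \<tau>"
          and gaps: "\<And>i j. i < n \<Longrightarrow> j < N \<Longrightarrow> (\<And>l. l < i \<Longrightarrow> \<tau> l < j) \<Longrightarrow>
            (\<And>l. i \<le> l \<Longrightarrow> l < n - 1 \<Longrightarrow> j < \<tau> l) \<Longrightarrow> \<not> lookup m (v i j) \<noteq> 0" by blast
        have "param g \<noteq> 0"
          by (rule param_nonzero[OF \<tau> g(1)]) (use gaps in \<open>auto simp: m gap_def\<close>)
        then show ?thesis using g(3) by blast
      next
        case True
        then obtain \<kappa> where \<kappa>: "increasing n N \<kappa>" "\<And>i. i < n \<Longrightarrow> lookup m (v i (\<kappa> i)) \<noteq> 0"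
          by blast
        let ?d = "\<Sum>i<n. single (v i (\<kappa> i)) (1::nat)"
        obtain q where q: "m = q + ?d" by (rule not_standard_divides[OF \<kappa>])
        have qV: "q \<in> monomials_in V"
          using mV unfolding q monomials_in_def
          by (auto simp: in_keys_iff lookup_add subset_iff)
        let ?c = "lookup g m"
        let ?t = "single q ?c :: ('v, 'k) mpoly"
        let ?D = "minor_cols \<kappa> :: ('v, 'k) mpoly"
        have c: "?c \<noteq> 0" using lookup_lm_nonzero[OF g(1)] m by simp
        have t: "?t \<noteq> 0" using c by (metis lookup_single_eq lookup_zero)
        have lt: "lm ?t = q" using c by (rule lm_single)
        note D = lm_minor_cols[OF \<kappa>(1), where ?'k = 'k]
        have "lm (?t * ?D) = q + ?d" using lm_mult[OF t D(1)] unfolding lt D(2) .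
        then have lmtD: "lm (?t * ?D) = m" unfolding q[symmetric] .
        have lktD: "lookup (?t * ?D) m = ?c"
          using lookup_mult_lm[OF t D(1)] unfolding lt D(2) D(3) q[symmetric] by simp
        have tp: "?t \<in> polys V" using qV by (rule polys_single)
        have tD: "?t * ?D \<in> max_minors_ideal"
          by (rule ideal_mult_left[OF ideal_max_minors minor_cols_in_ideal[OF \<kappa>(1)] tp])
        let ?g = "g - ?t * ?D"
        have "?g \<in> max_minors_ideal"
        proof (cases "?g = 0")
          case True
          then show ?thesis using ideal_0[OF ideal_max_minors] by simp
        next
          case nz: False
          have "lookup ?g m = 0" unfolding lookup_minus lktD by simp
          then have ne: "lm ?g \<noteq> m" using lookup_lm_nonzero[OF nz] by auto
          have "lm ?g \<in> keys g \<union> keys (?t * ?D)"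
            using lm_in_keys[OF nz] by (auto simp: in_keys_iff lookup_minus)
          then have le: "lm ?g \<le> m" using le_lm[of "lm ?g" g] le_lm[of "lm ?g" "?t * ?D"] m lmtD by auto
          have gp: "?g \<in> polys V"
            using g(2) ideal_subset_polys[OF ideal_max_minors tD] by (rule polys_diff)
          have "lm ?g \<in> monomials_in V" using lm_in_keys[OF nz] gp by (auto simp: mem_polys)
          then have rel: "(lm ?g, m) \<in> {(a, b). a \<in> monomials_in V \<and> b \<in> monomials_in V \<and> a < b}"
            using mV le ne by (simp add: order_less_le)
          have "param ?g = 0" using g(3) param_ideal[OF tD] by (simp add: param.hom_minus)
          then show ?thesis using 1[OF rel] nz gp by blast
        qed
        from ideal_add[OF ideal_max_minors this tD] show ?thesis by simp
      qed
    qed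
  qed
  then show ?thesis using assms ideal_0[OF ideal_max_minors] by (cases "g = 0") auto
qed

section \<open>The ideal of maximal minors as a colon ideal\<close>

definition first_minor :: "('v, 'k::comm_ring_1) mpoly" where
  "first_minor = cokernel (\<lambda>l. l) (n - 1)"

text \<open>Up to sign, \<open>bordered j\<close> is the minor of the first \<open>n - 1\<close> columns and column \<open>j\<close>; it vanishes if
  \<open>j < n - 1\<close>.\<close>

definition bordered :: "nat \<Rightarrow> ('v, 'k::comm_ring_1) mpoly" where
  "bordered j = (\<Sum>i<n. cokernel (\<lambda>l. l) i * x i j)"

lemma increasing_id: "increasing (n - 1) N (\<lambda>l. l)"
  using n_le_N n_pos by (auto simp: increasing_def)

lemma bordered_in_ideal:
  assumes "n - 1 \<le> j" "j < N"
  shows "bordered j \<in> max_minors_ideal"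
proof -
  have "gap (\<lambda>l. l) (n - 1) j" using assms n_pos by (auto simp: gap_def)
  then have "increasing n N (insert_at (n - 1) j (\<lambda>l. l))" by (rule gap_increasing[OF increasing_id])
  then have "(-1) ^ (n - 1) * minor_cols (insert_at (n - 1) j (\<lambda>l. l)) \<in> max_minors_ideal"
    by (intro ideal_mult_left[OF ideal_max_minors minor_cols_in_ideal] polys_power polys_uminus polys_1)
  then show ?thesis unfolding bordered_def cokernel_minor[OF last_less] .
qed

lemma first_minor_free: "first_minor \<in> polys (V - last_row)"
  unfolding first_minor_def cokernel_def
  by (intro polys_mult polys_power polys_uminus polys_1 sub_minor_polys free_var) (use n_le_N in auto)

lemma first_minor_nonzero: "first_minor \<noteq> (0 :: ('v, 'k::idom) mpoly)"
  unfolding first_minor_def cokernel_def using sub_minor_nonzero[OF increasing_id] by simp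

text \<open>Sum the columns of \<open>X\<close> with weights \<open>c\<close> before pairing with \<open>cokernel\<close>: only the last row
  survives, with the value \<open>g\<close>.\<close>

lemma first_minor_mult:
  assumes "row_linear (g :: ('v, 'k::comm_ring_1) mpoly) c"
  shows "first_minor * g = (\<Sum>u<N - n + 1. c (n - 1 + u) * bordered (n - 1 + u))"
proof -
  have "(\<Sum>j<N. c j * bordered j) = (\<Sum>i<n. cokernel (\<lambda>l. l) i * (\<Sum>j<N. c j * x i j))"
    unfolding bordered_def sum_distrib_left by (subst sum.swap) (simp add: mult_ac)
  also have "\<dots> = (\<Sum>i\<in>{n - 1}. cokernel (\<lambda>l. l) i * (\<Sum>j<N. c j * x i j))"
  proof (rule sum.mono_neutral_right)
    show "\<forall>i\<in>{..<n} - {n - 1}. cokernel (\<lambda>l. l) i * (\<Sum>j<N. c j * x i j) = 0"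
    proof
      fix i assume "i \<in> {..<n} - {n - 1}"
      then have "i < n - 1" by auto
      then show "cokernel (\<lambda>l. l) i * (\<Sum>j<N. c j * x i j) = 0"
        using assms by (simp add: row_linear_def)
    qed
  qed (use n_pos in auto)
  also have "\<dots> = first_minor * g"
    using assms by (simp add: row_linear_def first_minor_def)
  finally have "first_minor * g = (\<Sum>j<N. c j * bordered j)" ..
  also have "\<dots> = (\<Sum>j\<in>{n - 1..<N}. c j * bordered j)"
  proof (rule sum.mono_neutral_right)
    show "\<forall>j\<in>{..<N} - {n - 1..<N}. c j * bordered j = 0"
    proof
      fix j assume "j \<in> {..<N} - {n - 1..<N}"
      then have "j < n - 1" by auto
      then have "bordered j = (0 :: ('v, 'k) mpoly)" unfolding bordered_def by (rule cokernel_zero)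
      then show "c j * bordered j = 0" by simp
    qed
  qed auto
  also have "\<dots> = (\<Sum>u<N - n + 1. c (n - 1 + u) * bordered (n - 1 + u))"
    by (rule sum.reindex_bij_witness[of _ "\<lambda>u. n - 1 + u" "\<lambda>j. j - (n - 1)"]) (use n_pos n_le_N in auto)
  finally show ?thesis .
qed

text \<open>The coefficient matrix of the \<open>first_minor * g u\<close> with respect to the bordered minors is square.
  In row \<open>u\<close> the diagonal entry times its variable of the last row has a larger leading monomial than any other
  entry times its variable. The product of these variables over a permutation is the
  same for all permutations, so the diagonal dominates the Leibniz expansion as well.\<close>

theorem max_minors_ideal_eq_colon:
  fixes J :: "('v, 'k::field) mpoly set"
  assumes J: "ideal J (mpoly_ring V)" "J \<subseteq> max_minors_ideal"
    and g: "\<And>u. u \<le> N - n \<Longrightarrow> g u \<in> J" "\<And>u. u \<le> N - n \<Longrightarrow> g u \<noteq> 0"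
    and lin: "\<And>u. u \<le> N - n \<Longrightarrow> row_linear (g u) (c u)"
    and lead: "\<And>u. u \<le> N - n \<Longrightarrow> lookup (lm (g u)) (v (n - 1) (n - 1 + u)) \<noteq> 0"
  shows "\<exists>b\<in>polys V. colon_ideal (mpoly_ring V) J (PIdl\<^bsub>mpoly_ring V\<^esub> b) = max_minors_ideal"
proof -
  interpret R: cring "mpoly_ring V :: ('v, 'k) mpoly ring" by (rule cring_mpoly_ring)
  interpret param: comm_ring_hom "param :: ('v, 'k) mpoly \<Rightarrow> _" by (rule param_hom)
  let ?K = "N - n + 1"
  let ?A = "mat ?K ?K (\<lambda>(u, u'). c u (n - 1 + u'))"
  have A: "?A \<in> carrier_mat ?K ?K" by simp
  have bound: "n - 1 + u < N" if "u < ?K" for u using that n_pos n_le_N by linarith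
  have entry: "c u (n - 1 + u') \<in> polys (V - last_row)" if "u < ?K" "u' < ?K" for u u'
    using lin[of u] that bound[of u'] by (auto simp: row_linear_def)
  have inj: "inj_on (\<lambda>j. v (n - 1) j) {..<N}" using v_inj[of "n - 1" _ "n - 1"] by (auto simp: inj_on_def)
  let ?y = "\<lambda>u. single (v (n - 1) (n - 1 + u)) (1::nat)"
  note dominant = lm_linear_form[of "{..<N}" "\<lambda>j. v (n - 1) j" "c u" "V - last_row" "g u" "n - 1 + u" for u]
  have form: "c u (n - 1 + u) \<noteq> 0"
    "\<And>u'. u' < ?K \<Longrightarrow> u' \<noteq> u \<Longrightarrow> c u (n - 1 + u') \<noteq> 0 \<Longrightarrow>
       lm (c u (n - 1 + u')) + ?y u' < lm (c u (n - 1 + u)) + ?y u" if u: "u < ?K" for u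
  proof -
    have u': "u \<le> N - n" using u by simp
    have p1: "\<And>j. j \<in> {..<N} \<Longrightarrow> c u j \<in> polys (V - last_row)"
      and p2: "\<And>j. j \<in> {..<N} \<Longrightarrow> v (n - 1) j \<notin> V - last_row"
      and p3: "g u = (\<Sum>j<N. c u j * x (n - 1) j)" and p4: "n - 1 + u \<in> {..<N}"
      using lin[OF u'] bound[OF u] by (auto simp: row_linear_def last_row_def)
    note d = dominant[OF finite_lessThan inj p1 p2 p3 g(2)[OF u'] p4 lead[OF u']]
    show "c u (n - 1 + u) \<noteq> 0" by (rule d(1))
    fix w assume w: "w < ?K" "w \<noteq> u" "c u (n - 1 + w) \<noteq> 0"
    have "lm (c u (n - 1 + w)) + ?y w < lm (g u)" by (rule d(3)) (use w bound[of w] in auto)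
    also have "lm (g u) = lm (c u (n - 1 + u)) + ?y u" by (rule d(2))
    finally show "lm (c u (n - 1 + w)) + ?y w < lm (c u (n - 1 + u)) + ?y u" .
  qed
  have dom: "(\<Sum>i<?K. lm (?A $$ (i, p i))) < (\<Sum>i<?K. lm (?A $$ (i, i)))"
    if p: "p permutes {0..<?K}" "p \<noteq> id" and nz: "\<And>i. i < ?K \<Longrightarrow> ?A $$ (i, p i) \<noteq> 0" for p
  proof -
    have pK: "p i < ?K" if "i < ?K" for i using permutes_in_image[OF p(1), of i] that by simp
    have bij: "bij_betw p {..<?K} {..<?K}" using permutes_imp_bij[OF p(1)] by (simp add: atLeast0LessThan)
    have "(\<Sum>i<?K. lm (?A $$ (i, p i))) + (\<Sum>i<?K. ?y i) = (\<Sum>i<?K. lm (c i (n - 1 + p i)) + ?y (p i))"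
      using pK sum.reindex_bij_betw[OF bij, of ?y] by (simp add: sum.distrib)
    also have "\<dots> < (\<Sum>i<?K. lm (c i (n - 1 + i)) + ?y i)"
    proof (rule sum_strict_mono_ex1)
      have le: "lm (c i (n - 1 + p i)) + ?y (p i) \<le> lm (c i (n - 1 + i)) + ?y i" if "i < ?K" for i
        using form(2)[OF that pK[OF that]] nz[OF that] that pK[OF that] by (cases "p i = i") (auto intro: less_imp_le)
      then show "\<forall>i\<in>{..<?K}. lm (c i (n - 1 + p i)) + ?y (p i) \<le> lm (c i (n - 1 + i)) + ?y i" by blast
      obtain i where i: "p i \<noteq> i" using p(2) by (metis ext id_apply)
      then have iK: "i < ?K" using p(1) by (meson atLeastLessThan_iff not_le permutes_def zero_le)
      have "lm (c i (n - 1 + p i)) + ?y (p i) < lm (c i (n - 1 + i)) + ?y i"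
        by (rule form(2)[OF iK pK[OF iK] i]) (use nz[OF iK] iK pK[OF iK] in auto)
      then show "\<exists>i\<in>{..<?K}. lm (c i (n - 1 + p i)) + ?y (p i) < lm (c i (n - 1 + i)) + ?y i" using iK by blast
    qed simp
    also have "\<dots> = (\<Sum>i<?K. lm (?A $$ (i, i))) + (\<Sum>i<?K. ?y i)" by (simp add: sum.distrib)
    finally show ?thesis by (simp only: add_less_cancel_right)
  qed
  have det_nz: "det ?A \<noteq> 0"
    by (rule lm_det_dominant_diagonal(1)[OF A _ dom]) (use form(1) in auto)
  have det_free: "det ?A \<in> polys (V - last_row)"
    by (rule polys_det[OF A]) (use entry in auto)
  define b where "b = first_minor * det ?A"
  have b_free: "b \<in> polys (V - last_row)"
    unfolding b_def by (intro polys_mult first_minor_free det_free)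
  have b_nz: "b \<noteq> 0" unfolding b_def using det_nz first_minor_nonzero by simp
  have b_poly: "b \<in> polys V" by (rule polys_mono[OF _ b_free]) auto
  have sub: "a \<in> polys V" if "a \<in> polys (V - last_row)" for a :: "('v, 'k) mpoly"
    by (rule polys_mono[OF _ that]) auto
  have h_in: "det ?A * bordered (n - 1 + u') \<in> J" if u': "u' < ?K" for u'
  proof -
    have adj: "adj_mat ?A $$ (u', u) \<in> polys V" if u: "u < ?K" for u
    proof -
      have "cofactor ?A u u' \<in> polys V"
        by (rule polys_cofactor[OF A u u']) (use entry sub in auto)
      then show ?thesis using u u' by (simp add: adj_mat_def)
    qed
    have prod: "(\<Sum>u<?K. adj_mat ?A $$ (u', u) * c u (n - 1 + w)) = (if u' = w then det ?A else 0)" if "w < ?K" for w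
    proof -
      have "(\<Sum>u<?K. adj_mat ?A $$ (u', u) * c u (n - 1 + w)) = (adj_mat ?A * ?A) $$ (u', w)"
        using adj_mat(1)[OF A] u' that by (simp add: scalar_prod_def atLeast0LessThan)
      then show ?thesis unfolding adj_mat(3)[OF A] using u' that by simp
    qed
    have "(\<Sum>u<?K. adj_mat ?A $$ (u', u) * (first_minor * g u)) =
       (\<Sum>u<?K. \<Sum>w<?K. adj_mat ?A $$ (u', u) * c u (n - 1 + w) * bordered (n - 1 + w))"
    proof (rule sum.cong[OF refl])
      fix u assume "u \<in> {..<?K}"
      then have "u \<le> N - n" by auto
      from first_minor_mult[OF lin[OF this]]
      show "adj_mat ?A $$ (u', u) * (first_minor * g u) =
        (\<Sum>w<?K. adj_mat ?A $$ (u', u) * c u (n - 1 + w) * bordered (n - 1 + w))"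
        by (simp only: sum_distrib_left mult.assoc)
    qed
    also have "\<dots> = (\<Sum>w<?K. (\<Sum>u<?K. adj_mat ?A $$ (u', u) * c u (n - 1 + w)) * bordered (n - 1 + w))"
      unfolding sum_distrib_right by (rule sum.swap)
    also have "\<dots> = (\<Sum>w<?K. if u' = w then det ?A * bordered (n - 1 + w) else 0)"
      by (intro sum.cong refl) (simp add: prod)
    also have "\<dots> = det ?A * bordered (n - 1 + u')" using u' by simp
    finally have eq: "(\<Sum>u<?K. adj_mat ?A $$ (u', u) * (first_minor * g u)) = det ?A * bordered (n - 1 + u')" .
    have "(\<Sum>u<?K. adj_mat ?A $$ (u', u) * (first_minor * g u)) \<in> J"
      by (intro ideal_sum[OF J(1)] ideal_mult_left[OF J(1)] g(1) adj sub first_minor_free) auto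
    then show ?thesis unfolding eq .
  qed
  have minor_in: "b * minor_cols \<kappa> \<in> J" if \<kappa>: "increasing n N \<kappa>" for \<kappa>
  proof -
    obtain d where d: "row_linear (minor_cols \<kappa> :: ('v, 'k) mpoly) d"
      using row_linear_minor_cols[of \<kappa>] increasing_bound[OF \<kappa>] by blast
    have "b * minor_cols \<kappa> = det ?A * (first_minor * minor_cols \<kappa>)" by (simp add: b_def mult_ac)
    also have "\<dots> = (\<Sum>u<?K. d (n - 1 + u) * (det ?A * bordered (n - 1 + u)))"
      unfolding first_minor_mult[OF d] by (simp add: sum_distrib_left mult_ac)
    also have "\<dots> \<in> J"
      using d bound by (intro ideal_sum[OF J(1)] ideal_mult_left[OF J(1)] h_in sub) (auto simp: row_linear_def)
    finally show ?thesis .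
  qed
  have "colon_ideal (mpoly_ring V) J (PIdl\<^bsub>mpoly_ring V\<^esub> b) = max_minors_ideal"
  proof
    show "colon_ideal (mpoly_ring V) J (PIdl\<^bsub>mpoly_ring V\<^esub> b) \<subseteq> max_minors_ideal"
    proof
      fix a assume "a \<in> colon_ideal (mpoly_ring V) J (PIdl\<^bsub>mpoly_ring V\<^esub> b)"
      then have a: "a \<in> polys V" "a * b \<in> J"
        using R.cgenideal_self[OF b_poly] by (auto simp: colon_ideal_def)
      then have "param (a * b) = 0" using J(2) param_ideal by blast
      then have "param a = 0" using b_nz by (simp add: param.hom_mult param_free[OF b_free])
      then show "a \<in> max_minors_ideal" by (rule param_eq_0_imp_in_ideal[OF a(1)])
    qed
    let ?Q = "{a \<in> polys V. b * a \<in> J}"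
    have "max_minors_ideal \<subseteq> ?Q"
    proof (rule max_minors_ideal_subset)
      show "ideal ?Q (mpoly_ring V)"
        by (rule mpoly_idealI) (auto simp: distrib_left mult.left_commute ideal_0[OF J(1)] intro: ideal_add[OF J(1)] ideal_mult_left[OF J(1)])
      fix \<kappa> assume \<kappa>: "increasing n N \<kappa>"
      then show "minor_cols \<kappa> \<in> ?Q" using minor_in[OF \<kappa>] minor_cols_polys[of \<kappa>] increasing_bound[OF \<kappa>] by blast
    qed
    moreover have "?Q \<subseteq> colon_ideal (mpoly_ring V) J (PIdl\<^bsub>mpoly_ring V\<^esub> b)"
    proof
      fix a assume a: "a \<in> ?Q"
      have "a * y \<in> J" if y: "y \<in> PIdl\<^bsub>mpoly_ring V\<^esub> b" for y
      proof -
        obtain r where r: "r \<in> polys V" "y = r * b"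
          using y by (auto simp: cgenideal_def)
        have "r * (b * a) \<in> J" by (rule ideal_mult_left[OF J(1) _ r(1)]) (use a in simp)
        then show ?thesis unfolding r(2) by (simp only: mult_ac)
      qed
      then show "a \<in> colon_ideal (mpoly_ring V) J (PIdl\<^bsub>mpoly_ring V\<^esub> b)"
        using a by (simp add: colon_ideal_def)
    qed
    ultimately show "max_minors_ideal \<subseteq> colon_ideal (mpoly_ring V) J (PIdl\<^bsub>mpoly_ring V\<^esub> b)" by blast
  qed
  then show ?thesis using b_poly by blast
qed

end

section \<open>Closure properties of the class of Knutson ideals\<close>

lemma ideal_colon:
  fixes I :: "('v, 'k::comm_ring_1) mpoly set"
  assumes I: "ideal I (mpoly_ring V)" and J: "ideal J (mpoly_ring V)"
  shows "ideal (colon_ideal (mpoly_ring V) I J) (mpoly_ring V)"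
proof (rule mpoly_idealI)
  fix a c :: "('v, 'k) mpoly"
  assume a: "a \<in> colon_ideal (mpoly_ring V) I J" and c: "c \<in> polys V"
  then show "c * a \<in> colon_ideal (mpoly_ring V) I J"
    by (auto simp: colon_ideal_def mult.assoc intro: ideal_mult_left[OF I])
qed (auto simp: colon_ideal_def distrib_right intro: ideal_0[OF I] ideal_add[OF I])

lemma knutson_class_ideal:
  fixes f :: "('v, 'k::comm_ring_1) mpoly"
  assumes "I \<in> knutson_class (mpoly_ring V) f" "f \<in> polys V"
  shows "ideal I (mpoly_ring V)"
proof -
  interpret R: cring "mpoly_ring V :: ('v, 'k) mpoly ring" by (rule cring_mpoly_ring)
  show ?thesis using assms(1)
  proof induction
    case principal show ?case by (rule R.cgenideal_ideal[OF assms(2)])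
  next
    case colon then show ?case by (intro ideal_colon)
  next
    case sum then show ?case by (intro R.add_ideals)
  next
    case inter then show ?case by (intro R.i_intersect)
  qed
qed

lemma mem_PIdl: "a \<in> PIdl\<^bsub>mpoly_ring V\<^esub> (b :: ('v, 'k::comm_ring_1) mpoly) \<longleftrightarrow> (\<exists>c\<in>polys V. a = c * b)"
  by (auto simp: cgenideal_def)

text \<open>In a domain \<open>(g h) : (h) = (g)\<close>.\<close>

lemma knutson_class_divisor:
  fixes g h :: "('v::linorder, 'k::idom) mpoly"
  assumes g: "g \<in> polys V" and h: "h \<in> polys V" "h \<noteq> 0"
  shows "PIdl\<^bsub>mpoly_ring V\<^esub> g \<in> knutson_class (mpoly_ring V) (g * h)"
proof -
  interpret R: cring "mpoly_ring V :: ('v, 'k) mpoly ring" by (rule cring_mpoly_ring)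
  have "colon_ideal (mpoly_ring V) (PIdl\<^bsub>mpoly_ring V\<^esub> (g * h)) (PIdl\<^bsub>mpoly_ring V\<^esub> h) = PIdl\<^bsub>mpoly_ring V\<^esub> g"
  proof
    show "colon_ideal (mpoly_ring V) (PIdl\<^bsub>mpoly_ring V\<^esub> (g * h)) (PIdl\<^bsub>mpoly_ring V\<^esub> h) \<subseteq> PIdl\<^bsub>mpoly_ring V\<^esub> g"
    proof
      fix a assume "a \<in> colon_ideal (mpoly_ring V) (PIdl\<^bsub>mpoly_ring V\<^esub> (g * h)) (PIdl\<^bsub>mpoly_ring V\<^esub> h)"
      then have "a * h \<in> PIdl\<^bsub>mpoly_ring V\<^esub> (g * h)"
        using R.cgenideal_self[OF h(1)] by (auto simp: colon_ideal_def)
      then obtain c where c: "c \<in> polys V" "a * h = c * (g * h)" by (auto simp: mem_PIdl)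
      then have "a * h = (c * g) * h" by (simp add: mult.assoc)
      then have "a = c * g" using h(2) by simp
      then show "a \<in> PIdl\<^bsub>mpoly_ring V\<^esub> g" using c(1) by (auto simp: mem_PIdl)
    qed
    show "PIdl\<^bsub>mpoly_ring V\<^esub> g \<subseteq> colon_ideal (mpoly_ring V) (PIdl\<^bsub>mpoly_ring V\<^esub> (g * h)) (PIdl\<^bsub>mpoly_ring V\<^esub> h)"
    proof
      fix a assume "a \<in> PIdl\<^bsub>mpoly_ring V\<^esub> g"
      then obtain c where c: "c \<in> polys V" "a = c * g" by (auto simp: mem_PIdl)
      have "a * y \<in> PIdl\<^bsub>mpoly_ring V\<^esub> (g * h)" if y: "y \<in> PIdl\<^bsub>mpoly_ring V\<^esub> h" for y
      proof -
        obtain d where d: "d \<in> polys V" "y = d * h" using y by (auto simp: mem_PIdl)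
        have "a * y = (c * d) * (g * h)" unfolding c(2) d(2) by (simp only: mult_ac)
        then show ?thesis unfolding mem_PIdl using polys_mult[OF c(1) d(1)] by blast
      qed
      then show "a \<in> colon_ideal (mpoly_ring V) (PIdl\<^bsub>mpoly_ring V\<^esub> (g * h)) (PIdl\<^bsub>mpoly_ring V\<^esub> h)"
        using polys_mult[OF c(1) g] c(2) by (simp add: colon_ideal_def)
    qed
  qed
  moreover have "colon_ideal (mpoly_ring V) (PIdl\<^bsub>mpoly_ring V\<^esub> (g * h)) (PIdl\<^bsub>mpoly_ring V\<^esub> h)
      \<in> knutson_class (mpoly_ring V) (g * h)"
    by (intro knutson_class.colon knutson_class.principal R.cgenideal_ideal h(1))
  ultimately show ?thesis by simp
qed

text \<open>The class is closed under finite nonempty sums; the sum enters only through being the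
  least ideal above all summands.\<close>

lemma knutson_class_sum:
  fixes f :: "('v, 'k::comm_ring_1) mpoly"
  assumes f: "f \<in> polys V" and A: "finite A" "A \<noteq> {}"
    and K: "\<And>u. u \<in> A \<Longrightarrow> K u \<in> knutson_class (mpoly_ring V) f"
  shows "\<exists>J\<in>knutson_class (mpoly_ring V) f. (\<forall>u\<in>A. K u \<subseteq> J) \<and>
      (\<forall>I. ideal I (mpoly_ring V) \<longrightarrow> (\<forall>u\<in>A. K u \<subseteq> I) \<longrightarrow> J \<subseteq> I)"
  using A K
proof (induction A rule: finite_ne_induct)
  case (singleton u) then show ?case by (intro bexI[of _ "K u"]) auto
next
  case (insert u F)
  then obtain J where J: "J \<in> knutson_class (mpoly_ring V) f" "\<forall>u\<in>F. K u \<subseteq> J"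
    "\<forall>I. ideal I (mpoly_ring V) \<longrightarrow> (\<forall>u\<in>F. K u \<subseteq> I) \<longrightarrow> J \<subseteq> I" by blast
  have Ku: "K u \<in> knutson_class (mpoly_ring V) f" using insert by blast
  have memI: "a \<in> K u <+>\<^bsub>mpoly_ring V\<^esub> J \<longleftrightarrow> (\<exists>b\<in>K u. \<exists>c\<in>J. a = b + c)" for a
    by (auto simp: set_add_def')
  have z: "0 \<in> K u" "0 \<in> J" using ideal_0 knutson_class_ideal[OF _ f] Ku J(1) by blast+
  show ?case
  proof (intro bexI[of _ "K u <+>\<^bsub>mpoly_ring V\<^esub> J"] conjI ballI allI impI)
    show "K u <+>\<^bsub>mpoly_ring V\<^esub> J \<in> knutson_class (mpoly_ring V) f"
      by (rule knutson_class.sum[OF Ku J(1)])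
    fix w assume w: "w \<in> insert u F"
    show "K w \<subseteq> K u <+>\<^bsub>mpoly_ring V\<^esub> J"
    proof
      fix a assume a: "a \<in> K w"
      show "a \<in> K u <+>\<^bsub>mpoly_ring V\<^esub> J"
      proof (cases "w = u")
        case True
        then show ?thesis unfolding memI using a z(2) by (intro bexI[of _ a] bexI[of _ 0]) auto
      next
        case False
        then have "a \<in> J" using w J(2) a by blast
        then show ?thesis unfolding memI using z(1) by (intro bexI[of _ 0] bexI[of _ a]) auto
      qed
    qed
  next
    fix I assume I: "ideal I (mpoly_ring V)" "\<forall>w\<in>insert u F. K w \<subseteq> I"
    then have "K u \<subseteq> I" "J \<subseteq> I" using J(3) by auto
    then show "K u <+>\<^bsub>mpoly_ring V\<^esub> J \<subseteq> I"
      unfolding subset_iff memI using ideal_add[OF I(1)] by blast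
  qed
qed

section \<open>The generic matrices\<close>

lemma pick_increasing:
  assumes "increasing k N \<kappa>" "l < k"
  shows "pick (\<kappa> ` {..<k}) l = \<kappa> l"
proof -
  have "{a \<in> \<kappa> ` {..<k}. a < \<kappa> l} = \<kappa> ` {..<l}"
  proof
    show "{a \<in> \<kappa> ` {..<k}. a < \<kappa> l} \<subseteq> \<kappa> ` {..<l}"
    proof
      fix a assume "a \<in> {a \<in> \<kappa> ` {..<k}. a < \<kappa> l}"
      then obtain m where m: "m < k" "a = \<kappa> m" "\<kappa> m < \<kappa> l" by auto
      then have "m < l" using increasing_le[OF assms(1), of l m] by (meson not_le)
      then show "a \<in> \<kappa> ` {..<l}" using m by blast
    qed
    show "\<kappa> ` {..<l} \<subseteq> {a \<in> \<kappa> ` {..<k}. a < \<kappa> l}"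
      using assms increasing_less[OF assms(1), of _ l] by auto
  qed
  moreover have "inj_on \<kappa> {..<l}"
  proof (rule inj_onI)
    fix a b assume ab: "a \<in> {..<l}" "b \<in> {..<l}" "\<kappa> a = \<kappa> b"
    then have "a < k" "b < k" using assms(2) by auto
    then show "a = b" using increasing_less[OF assms(1), of a b] increasing_less[OF assms(1), of b a] ab(3)
      by (cases a b rule: linorder_cases) auto
  qed
  ultimately have "card {a \<in> \<kappa> ` {..<k}. a < \<kappa> l} = l" by (simp add: card_image)
  moreover have "\<kappa> l \<in> \<kappa> ` {..<k}" using assms(2) by blast
  ultimately show ?thesis using pick_card_in_set[of "\<kappa> l" "\<kappa> ` {..<k}"] by simp
qed

lemma increasing_inj: "increasing k N \<kappa> \<Longrightarrow> inj_on \<kappa> {..<k}"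
proof (rule inj_onI)
  fix a b assume ab: "increasing k N \<kappa>" "a \<in> {..<k}" "b \<in> {..<k}" "\<kappa> a = \<kappa> b"
  then show "a = b" using increasing_less[OF ab(1), of a b] increasing_less[OF ab(1), of b a]
    by (cases a b rule: linorder_cases) auto
qed

lemma pick_interval: "l < k \<Longrightarrow> pick {s..<s + k} l = s + l"
proof -
  assume l: "l < k"
  have inc: "increasing k (s + k) (\<lambda>l. s + l)" by (simp add: increasing_def)
  have "(\<lambda>l. s + l) ` {..<k} = {s..<s + k}"
  proof (intro equalityI subsetI)
    fix a assume "a \<in> {s..<s + k}"
    then have "a = s + (a - s)" "a - s \<in> {..<k}" by auto
    then show "a \<in> (\<lambda>l. s + l) ` {..<k}" by (rule image_eqI)
  qed auto
  then show ?thesis using pick_increasing[OF inc l] by metis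
qed

lemma pick_lessThan: "l < k \<Longrightarrow> pick {..<k} l = l"
  using pick_interval[of l k 0] by (simp add: atLeast0LessThan)

text \<open>In \<open>D\<^sup>*\<close> and in \<open>D\<^sub>*\<close>, block \<open>(a, b)\<close>, counted from \<open>0\<close>, is \<open>X\<^sub>a\<^sub>+\<^sub>b\<^sub>+\<^sub>1\<close> unless it is zero.
  Assigning to every position \<open>(R, C)\<close> the variable that this rule predicts gives a matrix
  whose variables increase along rows and columns and whose first block row is \<open>H\<close>, so all
  matrices can be treated at once. With the flag \<open>tr\<close> every block is transposed, which turns
  statements about \<open>H\<close> into statements about the transpose of \<open>V\<close>.\<close>

definition block_var :: "bool \<Rightarrow> nat \<Rightarrow> nat \<Rightarrow> nat \<Rightarrow> nat \<times> nat \<times> nat" where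
  "block_var tr n R C = (R div n + C div n + 1,
     if tr then (C mod n + 1, R mod n + 1) else (R mod n + 1, C mod n + 1))"

lemma block_var_less:
  assumes "R \<le> R'" "C \<le> C'" "(R, C) \<noteq> (R', C')"
  shows "block_var tr n R C < block_var tr n R' C'"
proof -
  have le: "R div n \<le> R' div n" "C div n \<le> C' div n" using assms by (simp_all add: div_le_mono)
  show ?thesis
  proof (cases "R div n = R' div n \<and> C div n = C' div n")
    case False
    then have "R div n + C div n < R' div n + C' div n" using le by linarith
    then show ?thesis by (simp add: block_var_def less_prod_def')
  next
    case True
    have d: "m = n * (m div n) + m mod n" for m by simp
    have "R mod n \<le> R' mod n" "C mod n \<le> C' mod n"
      using assms(1,2) d[of R] d[of R'] d[of C] d[of C'] True by (metis nat_add_left_cancel_le)+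
    moreover have "R mod n \<noteq> R' mod n \<or> C mod n \<noteq> C' mod n"
      using assms(3) d[of R] d[of R'] d[of C] d[of C'] True by metis
    ultimately show ?thesis using True by (auto simp: block_var_def less_prod_def')
  qed
qed

lemma block_var_inj:
  assumes "block_var tr n R C = block_var tr n R' C'" "R div n = R' div n"
  shows "R = R' \<and> C = C'"
proof -
  have "R mod n = R' mod n" "C mod n = C' mod n" "C div n = C' div n"
    using assms by (auto simp: block_var_def split: if_splits)
  then show ?thesis using assms(2) by (metis div_mult_mod_eq)
qed

lemma block_var_gvars:
  assumes "0 < n" "R div n + C div n < r"
  shows "block_var tr n R C \<in> gvars r n"
proof -
  have "R mod n + 1 \<le> n" "C mod n + 1 \<le> n"
    using mod_less_divisor[OF assms(1), of R] mod_less_divisor[OF assms(1), of C] by linarith+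
  then show ?thesis using assms(2) by (auto simp: block_var_def gvars_def)
qed

text \<open>All block rows show the same blocks, up to a shift of the columns.\<close>

lemma block_var_shift: "block_var tr n (a * n + i) C = block_var tr n i (a * n + C)"
  by (cases "n = 0") (simp_all add: block_var_def)

text \<open>Columns \<open>w, w + 1, \<dots>\<close> of the first block row.\<close>

definition window_var :: "bool \<Rightarrow> nat \<Rightarrow> nat \<Rightarrow> nat \<Rightarrow> nat \<Rightarrow> nat \<times> nat \<times> nat" where
  "window_var tr n w i j = block_var tr n i (w + j)"

lemma variable_matrix_window:
  assumes "0 < n" "n \<le> N" "w + N \<le> r * n"
  shows "variable_matrix (gvars r n) n N (window_var tr n w)"
  unfolding window_var_def
proof
  show "finite (gvars r n)" by (simp add: gvars_def)
  show "0 < n" "n \<le> N" by fact+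
  fix i j assume "i < n" "j < N"
  then have "(w + j) div n < r" using assms by (simp add: less_mult_imp_div_less)
  then show "block_var tr n i (w + j) \<in> gvars r n"
    using assms(1) \<open>i < n\<close> by (intro block_var_gvars) auto
next
  fix i j i' j' assume "i \<le> i'" "j \<le> j'" "i' < n" "j' < N" "(i, j) \<noteq> (i', j')"
  then show "block_var tr n i (w + j) < block_var tr n i' (w + j')" by (intro block_var_less) auto
next
  fix i j i' j' assume "i < n" "i' < n" "block_var tr n i (w + j) = block_var tr n i' (w + j')"
  then show "i = i' \<and> j = j'" using block_var_inj[of tr n i "w + j" i' "w + j'"] by auto
qed

definition window_ideal :: "nat \<Rightarrow> bool \<Rightarrow> nat \<Rightarrow> nat \<Rightarrow> nat \<Rightarrow> 'k::comm_ring_1 gpoly set" where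
  "window_ideal r tr n w N = variable_matrix.max_minors_ideal (gvars r n) n N (window_var tr n w)"

lemma minors_ideal_transpose:
  "minors_ideal R t (M\<^sup>T) = minors_ideal R t (M :: 'a::comm_ring_1 mat)"
proof -
  have sub: "det (submatrix (M\<^sup>T) B A) = det (submatrix M A B)"
    if AB: "A \<subseteq> {..<dim_row M}" "B \<subseteq> {..<dim_col M}" "card A = t" "card B = t" for A B
  proof -
    have A: "{i. i < dim_row M \<and> i \<in> A} = A" and B: "{i. i < dim_col M \<and> i \<in> B} = B" using AB by auto
    have "submatrix (M\<^sup>T) B A = (submatrix M A B)\<^sup>T"
    proof (rule eq_matI)
      fix i j assume "i < dim_row ((submatrix M A B)\<^sup>T)" "j < dim_col ((submatrix M A B)\<^sup>T)"
      then have ij: "i < card B" "j < card A" by (simp_all add: submatrix_def A B)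
      have "pick B i \<in> B" "pick A j \<in> A" using ij pick_in_set_le by blast+
      then have "pick B i < dim_col M" "pick A j < dim_row M" using AB(1,2) by auto
      then show "submatrix (M\<^sup>T) B A $$ (i, j) = (submatrix M A B)\<^sup>T $$ (i, j)"
        using ij AB(1,2) by (auto simp: submatrix_def A B)
    qed (simp_all add: submatrix_def)
    moreover have "submatrix M A B \<in> carrier_mat t t" using AB(3,4) by (auto simp: submatrix_def A B)
    ultimately show ?thesis by (simp add: det_transpose)
  qed
  show ?thesis
    unfolding minors_ideal_def
    by (rule arg_cong[where f = "genideal R"]) (auto simp: sub; metis sub)
qed

lemma minors_ideal_window:
  fixes M :: "'k::comm_ring_1 gpoly mat"
  assumes n: "0 < n" "0 < r" and M: "M \<in> carrier_mat n (r * n)"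
    and entry: "\<And>i j. i < n \<Longrightarrow> j < r * n \<Longrightarrow> M $$ (i, j) = mvar (block_var tr n i j)"
  shows "minors_ideal (mpoly_ring (gvars r n)) n M = window_ideal r tr n 0 (r * n)"
proof -
  interpret vm: variable_matrix "gvars r n" n "r * n" "window_var tr n 0"
    by (rule variable_matrix_window) (use n in auto)
  have dim: "dim_row M = n" "dim_col M = r * n" using M by auto
  have sub: "det (submatrix M {..<n} (\<kappa> ` {..<n})) = vm.minor_cols \<kappa>" if \<kappa>: "increasing n (r * n) \<kappa>" for \<kappa>
  proof -
    have "{j. j < dim_col M \<and> j \<in> \<kappa> ` {..<n}} = \<kappa> ` {..<n}" "{i. i < dim_row M \<and> i \<in> {..<n}} = {..<n}"
      using increasing_bound[OF \<kappa>] by (auto simp: dim)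
    then have "submatrix M {..<n} (\<kappa> ` {..<n}) = mat n n (\<lambda>(i, l). mvar (window_var tr n 0 i (\<kappa> l)))"
      unfolding submatrix_def
      by (intro eq_matI) (auto simp: card_image[OF increasing_inj[OF \<kappa>]] pick_increasing[OF \<kappa>] pick_lessThan
        entry increasing_bound[OF \<kappa>] window_var_def)
    then show ?thesis by (simp add: vm.minor_cols_def)
  qed
  have "{det (submatrix M A B) | A B. A \<subseteq> {..<dim_row M} \<and> B \<subseteq> {..<dim_col M} \<and> card A = n \<and> card B = n} =
     {vm.minor_cols \<kappa> | \<kappa>. increasing n (r * n) \<kappa>}" (is "?L = ?R")
  proof (rule Set.set_eqI, rule iffI)
    fix d assume "d \<in> ?L"
    then obtain A B where AB: "d = det (submatrix M A B)" "A \<subseteq> {..<n}" "B \<subseteq> {..<r * n}" "card A = n" "card B = n"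
      by (auto simp: dim)
    have A: "A = {..<n}" using AB(2,4) by (intro card_subset_eq) auto
    have inc: "increasing n (r * n) (pick B)"
      unfolding increasing_def using AB(3,5) pick_in_set_le pick_mono_le by (auto simp: subset_iff)
    have "pick B ` {..<n} = B"
    proof (rule card_subset_eq)
      show "finite B" using AB(3) finite_subset by blast
      show "pick B ` {..<n} \<subseteq> B" using pick_in_set_le AB(5) by auto
      show "card (pick B ` {..<n}) = card B" using card_image[OF increasing_inj[OF inc]] AB(5) by simp
    qed
    then show "d \<in> ?R" using sub[OF inc] inc AB(1) A by auto
  next
    fix d assume "d \<in> ?R"
    then obtain \<kappa> where \<kappa>: "d = vm.minor_cols \<kappa>" "increasing n (r * n) \<kappa>" by blast
    show "d \<in> ?L"
    proof -
      have "d = det (submatrix M {..<n} (\<kappa> ` {..<n}))" using sub[OF \<kappa>(2)] \<kappa>(1) by simp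
      moreover have "\<kappa> ` {..<n} \<subseteq> {..<dim_col M}" using increasing_bound[OF \<kappa>(2)] by (auto simp: dim)
      moreover have "card (\<kappa> ` {..<n}) = n" using card_image[OF increasing_inj[OF \<kappa>(2)]] by simp
      moreover have "{..<n} \<subseteq> {..<dim_row M}" "card {..<n} = n" by (simp_all add: dim)
      ultimately show ?thesis by blast
    qed
  qed
  then show ?thesis unfolding minors_ideal_def window_ideal_def vm.max_minors_ideal_def by simp
qed

lemma minors_ideal_H:
  assumes n: "0 < n" "0 < r"
  shows "minors_ideal (mpoly_ring (gvars r n)) n (H_mat r n) = (window_ideal r False n 0 (r * n) :: 'k::comm_ring_1 gpoly set)"
proof (rule minors_ideal_window[OF n])
  show "H_mat r n \<in> carrier_mat n (r * n)" by (simp add: H_mat_def block_mat_def)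
  fix i j assume "i < n" "j < r * n"
  then show "H_mat r n $$ (i, j) = mvar (block_var False n i j)"
    using n by (simp add: H_mat_def block_mat_def X_mat_def block_var_def)
qed

lemma minors_ideal_V:
  assumes n: "0 < n" "0 < r"
  shows "minors_ideal (mpoly_ring (gvars r n)) n (V_mat r n) = (window_ideal r True n 0 (r * n) :: 'k::comm_ring_1 gpoly set)"
proof -
  have "minors_ideal (mpoly_ring (gvars r n)) n ((V_mat r n)\<^sup>T) = (window_ideal r True n 0 (r * n) :: 'k gpoly set)"
  proof (rule minors_ideal_window[OF n])
    show "(V_mat r n)\<^sup>T \<in> carrier_mat n (r * n)" by (simp add: V_mat_def block_mat_def)
    fix i j assume "i < n" "j < r * n"
    then show "(V_mat r n)\<^sup>T $$ (i, j) = mvar (block_var True n i j)"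
      using n by (simp add: V_mat_def block_mat_def X_mat_def block_var_def)
  qed
  then show ?thesis by (simp only: minors_ideal_transpose)
qed

section \<open>From pairs of neighbouring blocks to all blocks\<close>

text \<open>Any \<open>n\<close> consecutive columns lie in a pair of neighbouring blocks. The minors of
  consecutive columns therefore belong to the sum of the ideals of the pairs, and their diagonals end in
  different columns of the last row.\<close>

lemma window_ideal_knutson:
  fixes f :: "'k::field gpoly"
  assumes n: "0 < n" and r: "2 \<le> r" and f: "f \<in> polys (gvars r n)"
    and pairs: "\<And>q. q + 2 \<le> r \<Longrightarrow> window_ideal r tr n (q * n) (2 * n) \<in> knutson_class (mpoly_ring (gvars r n)) f"
  shows "window_ideal r tr n 0 (r * n) \<in> knutson_class (mpoly_ring (gvars r n)) f"
proof -
  let ?S = "mpoly_ring (gvars r n) :: 'k gpoly ring"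
  interpret R: cring ?S by (rule cring_mpoly_ring)
  interpret vm: variable_matrix "gvars r n" n "r * n" "window_var tr n 0"
    by (rule variable_matrix_window) (use n r in auto)
  have pr: "variable_matrix (gvars r n) n (2 * n) (window_var tr n (q * n))" if "q + 2 \<le> r" for q
  proof (rule variable_matrix_window)
    have "(q + 2) * n \<le> r * n" using that by (rule mult_le_mono1)
    then show "q * n + 2 * n \<le> r * n" by (simp only: distrib_right)
  qed (use n in auto)
  have Q: "finite {..r - 2}" "{..r - 2} \<noteq> {}" by auto
  have q2: "q + 2 \<le> r" if "q \<in> {..r - 2}" for q using that r by auto
  have Qc: "window_ideal r tr n (q * n) (2 * n) \<in> knutson_class ?S f" if "q \<in> {..r - 2}" for q
    by (rule pairs[OF q2[OF that]])
  have "\<exists>J\<in>knutson_class ?S f. (\<forall>q\<in>{..r - 2}. window_ideal r tr n (q * n) (2 * n) \<subseteq> J) \<and>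
      (\<forall>I. ideal I ?S \<longrightarrow> (\<forall>q\<in>{..r - 2}. window_ideal r tr n (q * n) (2 * n) \<subseteq> I) \<longrightarrow> J \<subseteq> I)"
    by (rule knutson_class_sum[OF f Q Qc])
  then obtain J where J: "J \<in> knutson_class ?S f"
    "\<forall>q\<in>{..r - 2}. window_ideal r tr n (q * n) (2 * n) \<subseteq> J"
    "\<forall>I. ideal I ?S \<longrightarrow> (\<forall>q\<in>{..r - 2}. window_ideal r tr n (q * n) (2 * n) \<subseteq> I) \<longrightarrow> J \<subseteq> I"
    by (elim bexE conjE)
  let ?I = "vm.max_minors_ideal :: 'k gpoly set"
  have sub: "J \<subseteq> ?I"
  proof (rule J(3)[rule_format, OF vm.ideal_max_minors])
    fix q assume q: "q \<in> {..r - 2}"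
    interpret pm: variable_matrix "gvars r n" n "2 * n" "window_var tr n (q * n)"
      by (rule pr[OF q2[OF q]])
    show "window_ideal r tr n (q * n) (2 * n) \<subseteq> ?I"
      unfolding window_ideal_def
    proof (rule pm.max_minors_ideal_subset[OF vm.ideal_max_minors])
      fix \<kappa> assume \<kappa>: "increasing n (2 * n) \<kappa>"
      have "(q + 2) * n \<le> r * n" using q2[OF q] by (rule mult_le_mono1)
      then have "increasing n (r * n) (\<lambda>l. q * n + \<kappa> l)"
        using \<kappa> by (auto simp: increasing_def distrib_right intro: less_le_trans)
      then have "vm.minor_cols (\<lambda>l. q * n + \<kappa> l) \<in> ?I" by (rule vm.minor_cols_in_ideal)
      then show "pm.minor_cols \<kappa> \<in> ?I" by (simp add: vm.minor_cols_def pm.minor_cols_def window_var_def)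
    qed
  qed
  have inc: "increasing n (r * n) (\<lambda>l. u + l)" if "u \<le> r * n - n" for u
  proof -
    have "1 * n \<le> r * n" using r by (intro mult_le_mono1) simp
    then have "u + n \<le> r * n" using that by linarith
    then show ?thesis by (simp add: increasing_def)
  qed
  have "\<exists>c. vm.row_linear (vm.minor_cols (\<lambda>l. u + l) :: 'k gpoly) c" if "u \<le> r * n - n" for u
    using increasing_bound[OF inc[OF that]] by (intro vm.row_linear_minor_cols)
  then obtain c where c: "\<And>u. u \<le> r * n - n \<Longrightarrow> vm.row_linear (vm.minor_cols (\<lambda>l. u + l) :: 'k gpoly) (c u)"
    by metis
  have "\<exists>b\<in>carrier ?S. colon_ideal ?S J (PIdl\<^bsub>?S\<^esub> b) = ?I"
  proof (rule vm.max_minors_ideal_eq_colon[OF knutson_class_ideal[OF J(1) f] sub _ _ c])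
    fix u assume u: "u \<le> r * n - n"
    show "vm.minor_cols (\<lambda>l. u + l) \<noteq> (0 :: 'k gpoly)" by (rule vm.lm_minor_cols(1)[OF inc[OF u]])
    show "lookup (lm (vm.minor_cols (\<lambda>l. u + l) :: 'k gpoly)) (window_var tr n 0 (n - 1) (n - 1 + u)) \<noteq> 0"
      unfolding vm.lm_minor_cols(2)[OF inc[OF u]] lookup_sum_single[OF finite_lessThan]
      using n by (auto intro!: bexI[of _ "n - 1"] simp: add.commute)
    define q where "q = min (u div n) (r - 2)"
    have q: "q \<in> {..r - 2}" by (simp add: q_def)
    interpret pm: variable_matrix "gvars r n" n "2 * n" "window_var tr n (q * n)"
      by (rule pr[OF q2[OF q]])
    have "q * n \<le> (u div n) * n" unfolding q_def by (rule mult_le_mono1) simp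
    also have "\<dots> \<le> u" by simp
    finally have qu: "q * n \<le> u" .
    have un: "u - q * n \<le> n"
    proof (cases "u div n \<le> r - 2")
      case True
      then have "q = u div n" by (simp add: q_def)
      moreover have "u - u div n * n = u mod n" by (simp add: minus_div_mult_eq_mod)
      ultimately show ?thesis using mod_less_divisor[OF n, of u] by simp
    next
      case False
      then have "q = r - 2" by (simp add: q_def)
      then have "q * n = r * n - 2 * n" by (simp add: diff_mult_distrib)
      moreover have "2 * n \<le> r * n" using r by (rule mult_le_mono1)
      ultimately show ?thesis using u by linarith
    qed
    have "increasing n (2 * n) (\<lambda>l. (u - q * n) + l)" using un by (auto simp: increasing_def)
    then have "pm.minor_cols (\<lambda>l. (u - q * n) + l) \<in> window_ideal r tr n (q * n) (2 * n)"
      unfolding window_ideal_def by (rule pm.minor_cols_in_ideal)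
    then have "pm.minor_cols (\<lambda>l. (u - q * n) + l) \<in> J" using bspec[OF J(2) q] by blast
    moreover have "pm.minor_cols (\<lambda>l. (u - q * n) + l) = (vm.minor_cols (\<lambda>l. u + l) :: 'k gpoly)"
      unfolding pm.minor_cols_def vm.minor_cols_def using qu by (intro arg_cong[where f = det] eq_matI) (auto simp: window_var_def)
    ultimately show "vm.minor_cols (\<lambda>l. u + l) \<in> J" by simp
  qed
  then obtain b where "b \<in> carrier ?S" "colon_ideal ?S J (PIdl\<^bsub>?S\<^esub> b) = ?I" by blast
  then have "?I \<in> knutson_class ?S f"
    using knutson_class.colon[OF J(1) R.cgenideal_ideal] by metis
  then show ?thesis unfolding window_ideal_def by simp
qed

section \<open>The minors of the block matrices\<close>

text \<open>For \<open>e = 0\<close> the nonzero blocks \<open>(a, b)\<close> are those with \<open>b = a\<close> or \<open>b = a + 1\<close>, as in \<open>D\<^sup>*\<close>; for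
  \<open>e = 1\<close> those with \<open>b = a\<close> or \<open>b = a - 1\<close>, as in \<open>D\<^sub>*\<close>.\<close>

definition band_entry :: "nat \<Rightarrow> bool \<Rightarrow> nat \<Rightarrow> nat \<Rightarrow> nat \<Rightarrow> 'k::comm_ring_1 gpoly" where
  "band_entry e tr n R C =
     (if C div n + e = R div n \<or> C div n + e = R div n + 1 then mvar (block_var tr n R C) else 0)"

definition band_mat :: "nat \<Rightarrow> bool \<Rightarrow> nat \<Rightarrow> nat \<Rightarrow> nat \<Rightarrow> 'k::comm_ring_1 gpoly mat" where
  "band_mat e tr n s L = mat L L (\<lambda>(i, j). band_entry e tr n (i + e * s) (j + (1 - e) * s))"

text \<open>The minors \<open>\<Delta>\<^sup>s\<close> and \<open>\<Delta>\<^sub>s\<close> have the same size, because \<open>D\<^sub>*\<close> has the shape of the transpose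
  of \<open>D\<^sup>*\<close>.\<close>

definition band_size :: "nat \<Rightarrow> nat \<Rightarrow> nat \<Rightarrow> nat" where
  "band_size r n s = min ((r + 1) div 2 * n) ((r div 2 + 1) * n - s)"

definition band_minor :: "nat \<Rightarrow> nat \<Rightarrow> bool \<Rightarrow> nat \<Rightarrow> nat \<Rightarrow> 'k::comm_ring_1 gpoly" where
  "band_minor e r tr n s = det (band_mat e tr n s (band_size r n s))"

text \<open>Transposing a matrix of shape \<open>D\<^sup>*\<close> gives one of shape \<open>D\<^sub>*\<close> with transposed blocks. Hence the
  factors of \<open>f\<close> serve for \<open>tr\<close> as well as for its negation.\<close>

lemma band_minor_transpose:
  assumes "e \<le> 1"
  shows "band_minor (1 - e) r (\<not> tr) n s = (band_minor e r tr n s :: 'k::comm_ring_1 gpoly)"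
proof -
  have bv: "block_var (\<not> tr) n C R = block_var tr n R C" for R C by (simp add: block_var_def)
  have "band_entry (1 - e) (\<not> tr) n C R = (band_entry e tr n R C :: 'k gpoly)" for R C
    using assms unfolding band_entry_def bv by (intro if_cong refl) linarith
  then have "band_mat (1 - e) (\<not> tr) n s L = ((band_mat e tr n s L)\<^sup>T :: 'k gpoly mat)" for L
    using assms unfolding band_mat_def by (intro eq_matI) auto
  moreover have "det ((band_mat e tr n s L)\<^sup>T :: 'k gpoly mat) = det (band_mat e tr n s L)" for L
    by (rule det_transpose[of _ L]) (simp add: band_mat_def)
  ultimately show ?thesis unfolding band_minor_def by simp
qed

lemma D_upper_entry:
  assumes "i < (r + 1) div 2 * n" "j < (r div 2 + 1) * n"
  shows "D_upper r n $$ (i, j) = band_entry 0 False n i j"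
proof -
  have n: "0 < n" using assms(1) by (cases n) auto
  have "j div n < r div 2 + 1" using assms(2) n by (simp add: div_less_iff_less_mult)
  then show ?thesis
    using assms n
    by (auto simp: D_upper_def block_mat_def band_entry_def X_mat_def block_var_def intro!: arg_cong[where f = mvar])
qed

lemma D_lower_entry:
  assumes "i < (r div 2 + 1) * n" "j < (r + 1) div 2 * n"
  shows "D_lower r n $$ (i, j) = band_entry 1 False n i j"
proof -
  have n: "0 < n" using assms(2) by (cases n) auto
  have "i div n < r div 2 + 1" using assms(1) n by (simp add: div_less_iff_less_mult)
  then show ?thesis
    using assms n
    by (auto simp: D_lower_def block_mat_def band_entry_def X_mat_def block_var_def intro!: arg_cong[where f = mvar])
qed

lemma Delta_upper_eq: "Delta_upper r n s = (band_minor 0 r False n s :: 'k::comm_ring_1 gpoly)"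
proof -
  let ?D = "D_upper r n :: 'k gpoly mat" and ?L = "band_size r n s"
  have dim: "dim_row ?D = (r + 1) div 2 * n" "dim_col ?D = (r div 2 + 1) * n"
    by (simp_all add: D_upper_def block_mat_def)
  have L: "?L \<le> (r + 1) div 2 * n" "?L \<le> (r div 2 + 1) * n - s" by (simp_all add: band_size_def)
  have sets: "{i. i < dim_row ?D \<and> i \<in> {0..<0 + ?L}} = {0..<0 + ?L}"
    "{j. j < dim_col ?D \<and> j \<in> {s..<s + ?L}} = {s..<s + ?L}"
    using L unfolding dim by auto
  have "submatrix ?D {0..<0 + ?L} {s..<s + ?L} = band_mat 0 False n s ?L"
    unfolding submatrix_def sets
  proof (rule eq_matI)
    fix i j assume "i < dim_row (band_mat 0 False n s ?L :: 'k gpoly mat)" "j < dim_col (band_mat 0 False n s ?L :: 'k gpoly mat)"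
    then have ij: "i < ?L" "j < ?L" by (simp_all add: band_mat_def)
    have "?D $$ (0 + i, s + j) = band_entry 0 False n (0 + i) (s + j)"
      using ij L by (intro D_upper_entry) linarith+
    then show "mat (card {0..<0 + ?L}) (card {s..<s + ?L}) (\<lambda>(i, j). ?D $$ (pick {0..<0 + ?L} i, pick {s..<s + ?L} j)) $$ (i, j) =
        band_mat 0 False n s ?L $$ (i, j)"
      using ij by (simp add: pick_interval[of i ?L 0, simplified] pick_interval band_mat_def add.commute)
  qed (simp_all add: band_mat_def)
  then show ?thesis by (simp add: Delta_upper_def Let_def dim band_minor_def band_size_def[symmetric])
qed

lemma Delta_lower_eq: "Delta_lower r n s = (band_minor 1 r False n s :: 'k::comm_ring_1 gpoly)"
proof -
  let ?D = "D_lower r n :: 'k gpoly mat" and ?L = "band_size r n s"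
  have dim: "dim_col ?D = (r + 1) div 2 * n" "dim_row ?D = (r div 2 + 1) * n"
    by (simp_all add: D_lower_def block_mat_def)
  have L: "?L \<le> (r + 1) div 2 * n" "?L \<le> (r div 2 + 1) * n - s" by (simp_all add: band_size_def)
  have sets: "{i. i < dim_col ?D \<and> i \<in> {0..<0 + ?L}} = {0..<0 + ?L}"
    "{j. j < dim_row ?D \<and> j \<in> {s..<s + ?L}} = {s..<s + ?L}"
    using L unfolding dim by auto
  have "submatrix ?D {s..<s + ?L} {0..<0 + ?L} = band_mat 1 False n s ?L"
    unfolding submatrix_def sets
  proof (rule eq_matI)
    fix i j assume "i < dim_row (band_mat 1 False n s ?L :: 'k gpoly mat)" "j < dim_col (band_mat 1 False n s ?L :: 'k gpoly mat)"
    then have ij: "i < ?L" "j < ?L" by (simp_all add: band_mat_def)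
    have "?D $$ (s + i, 0 + j) = band_entry 1 False n (s + i) (0 + j)"
      using ij L by (intro D_lower_entry) linarith+
    then show "mat (card {s..<s + ?L}) (card {0..<0 + ?L}) (\<lambda>(i, j). ?D $$ (pick {s..<s + ?L} i, pick {0..<0 + ?L} j)) $$ (i, j) =
        band_mat 1 False n s ?L $$ (i, j)"
      using ij by (simp add: pick_interval[of j ?L 0, simplified] pick_interval band_mat_def add.commute)
  qed (simp_all add: band_mat_def)
  then show ?thesis by (simp add: Delta_lower_def Let_def dim band_minor_def band_size_def[symmetric])
qed

lemma lm_band_minor:
  assumes e: "e \<le> 1" and s: "s < n"
  shows "band_minor e r tr n s \<noteq> (0 :: 'k::idom gpoly)"
    and "lm (band_minor e r tr n s :: 'k gpoly) =
      (\<Sum>t<band_size r n s. single (block_var tr n (t + e * s) (t + (1 - e) * s)) 1)"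
    and "lookup (band_minor e r tr n s :: 'k gpoly) (lm (band_minor e r tr n s :: 'k gpoly)) = 1"
proof -
  let ?L = "band_size r n s"
  let ?w = "\<lambda>i j. block_var tr n (i + e * s) (j + (1 - e) * s)"
  have e01: "e = 0 \<or> e = 1" using e by linarith
  have n: "0 < n" using s by simp
  have shift: "(t + s) div n = t div n \<or> (t + s) div n = t div n + 1" for t
  proof -
    have "t div n \<le> (t + s) div n" by (rule div_le_mono) simp
    moreover have "(t + s) div n \<le> (t + n) div n" by (rule div_le_mono) (use s in simp)
    moreover have "(t + n) div n = t div n + 1" using n by simp
    ultimately show ?thesis by linarith
  qed
  have diag: "band_mat e tr n s ?L $$ (i, i) = mvar (?w i i)" if "i < ?L" for i
    using that shift[of i] e01 n by (auto simp: band_mat_def band_entry_def)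
  have entry: "band_mat e tr n s ?L $$ (i, j) = mvar (?w i j) \<or> band_mat e tr n s ?L $$ (i, j) = 0"
    if "i < ?L" "j < ?L" for i j
    using that by (auto simp: band_mat_def band_entry_def)
  have mono: "?w i i < ?w i' j'" if "i \<le> i'" "i \<le> j'" "(i', j') \<noteq> (i, i)" for i i' j'
    by (rule block_var_less) (use that in auto)
  note * = lm_det_variables[of "band_mat e tr n s ?L :: 'k gpoly mat" ?L ?w, OF _ entry diag mono]
  show "band_minor e r tr n s \<noteq> (0 :: 'k gpoly)"
    unfolding band_minor_def by (rule *(1)) (simp_all add: band_mat_def)
  show "lm (band_minor e r tr n s :: 'k gpoly) =
      (\<Sum>t<?L. single (block_var tr n (t + e * s) (t + (1 - e) * s)) 1)"
    unfolding band_minor_def by (rule *(2)) (simp_all add: band_mat_def)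
  show "lookup (band_minor e r tr n s :: 'k gpoly) (lm (band_minor e r tr n s :: 'k gpoly)) = 1"
    unfolding band_minor_def by (rule *(3)) (simp_all add: band_mat_def)
qed

lemma band_position:
  assumes e: "e \<le> 1" and s: "s \<le> n" and ij: "i < band_size r n s" "j < band_size r n s"
  shows "(i + e * s) div n + (j + (1 - e) * s) div n < r"
proof -
  let ?L = "band_size r n s"
  have n: "0 < n" using ij by (cases n) (auto simp: band_size_def)
  have e01: "e = 0 \<or> e = 1" using e by linarith
  have L: "?L \<le> (r + 1) div 2 * n" "?L \<le> (r div 2 + 1) * n - s" by (simp_all add: band_size_def)
  have lo: "t div n < (r + 1) div 2" if "t < ?L" for t
    unfolding div_less_iff_less_mult[OF n] using that L by linarith
  have hi: "(t + s) div n < r div 2 + 1" if "t < ?L" for t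
    unfolding div_less_iff_less_mult[OF n] using that L by linarith
  have "(r + 1) div 2 + r div 2 = r" by presburger
  then show ?thesis using lo[OF ij(1)] lo[OF ij(2)] hi[OF ij(1)] hi[OF ij(2)] e01 by auto
qed

lemma band_minor_polys:
  assumes "e \<le> 1" "s \<le> n"
  shows "band_minor e r tr n s \<in> polys (gvars r n)"
  unfolding band_minor_def
proof (rule polys_det[of _ "band_size r n s"])
  fix i j assume ij: "i < band_size r n s" "j < band_size r n s"
  then have "0 < n" by (cases n) (auto simp: band_size_def)
  then show "band_mat e tr n s (band_size r n s) $$ (i, j) \<in> polys (gvars r n)"
    using ij band_position[OF assms ij] by (auto simp: band_mat_def band_entry_def intro!: polys_mvar block_var_gvars)
qed (simp add: band_mat_def)

section \<open>Pairs of neighbouring blocks\<close>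

text \<open>Row \<open>A\<close> of the staircase consists of the two blocks whose indices have the sum \<open>2 A - e\<close> and
  \<open>2 A - e + 1\<close>. So the sum determines the row, and every block of variables occurs only once.\<close>

lemma band_block_row:
  fixes A B q b e :: nat
  assumes "A + B = q \<or> A + B = q + 1" "B + e = A \<or> B + e = A + 1" "q = 2 * b + e" "e \<le> 1"
  shows "A = b + e"
proof (rule linorder_cases[of A "b + e"])
  assume "A < b + e"
  then show ?thesis using assms by (elim disjE) linarith+
next
  assume "b + e < A"
  then show ?thesis using assms by (elim disjE) linarith+
qed

text \<open>The blocks \<open>q\<close> and \<open>q + 1\<close>, counted from \<open>0\<close>, form a block row of \<open>D\<^sup>*\<close> if \<open>q\<close> is even and of \<open>D\<^sub>*\<close>
  if \<open>q\<close> is odd. The minors \<open>\<Delta>\<^sup>s\<close> or \<open>\<Delta>\<^sub>s\<close> of that matrix contain all \<open>n\<close> rows of this block row, whose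
  variables occur nowhere else, so they are linear in the last of these rows. Their diagonals leave the block
  row in \<open>n - 1\<close> different columns of the last row; the diagonals of the two determinants account for the
  remaining two.\<close>

lemma pair_ideal_knutson:
  fixes f :: "'k::field gpoly"
  assumes n: "0 < n" and q: "q + 2 \<le> r" and f: "f \<in> polys (gvars r n)"
    and blocks: "\<And>k. k < r \<Longrightarrow> PIdl\<^bsub>mpoly_ring (gvars r n)\<^esub> (det (mat n n (\<lambda>(i, l). mvar (block_var tr n i (k * n + l)))))
       \<in> knutson_class (mpoly_ring (gvars r n)) f"
    and bands: "\<And>e s. e \<le> 1 \<Longrightarrow> 1 \<le> s \<Longrightarrow> s < n \<Longrightarrow> PIdl\<^bsub>mpoly_ring (gvars r n)\<^esub> (band_minor e r tr n s)
       \<in> knutson_class (mpoly_ring (gvars r n)) f"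
  shows "window_ideal r tr n (q * n) (2 * n) \<in> knutson_class (mpoly_ring (gvars r n)) f"
proof -
  let ?S = "mpoly_ring (gvars r n) :: 'k gpoly ring"
  interpret R: cring ?S by (rule cring_mpoly_ring)
  have qr: "q * n + 2 * n \<le> r * n" using mult_le_mono1[OF q, of n] by (simp only: distrib_right)
  interpret vm: variable_matrix "gvars r n" n "2 * n" "window_var tr n (q * n)"
    by (rule variable_matrix_window) (use n qr in auto)
  let ?I = "vm.max_minors_ideal :: 'k gpoly set"
  define e b a where "e = q mod 2" and "b = q div 2" and "a = b + e"
  have e: "e \<le> 1" by (simp add: e_def)
  have e01: "e = 0 \<or> e = 1" using e by linarith
  have qab: "q = a + b" "q = 2 * b + e" unfolding a_def e_def b_def by presburger+
  \<comment> \<open>The diagonal of the minor with offset \<open>S u\<close> meets the last row in column \<open>n - 1 + u\<close> of the pair.\<close>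
  define S where "S u = (if e = 0 then u else n - u)" for u
  define g :: "nat \<Rightarrow> 'k gpoly" where "g u = (if u = 0 then vm.minor_cols (\<lambda>l. l)
      else if u = n then vm.minor_cols (\<lambda>l. n + l) else band_minor e r tr n (S u))" for u
  have inc0: "increasing n (2 * n) (\<lambda>l. l)" and incn: "increasing n (2 * n) (\<lambda>l. n + l)"
    by (auto simp: increasing_def)
  have S: "1 \<le> S u" "S u < n" if "u \<noteq> 0" "u < n" for u using that by (auto simp: S_def)
  have offset: "e * s \<le> a * n" "(a + 1) * n \<le> band_size r n s + e * s" if s: "s < n" for s
  proof -
    show "e * s \<le> a * n" using e01 s by (auto simp: a_def distrib_right)
    have b1: "(b + 1) * n \<le> r div 2 * n" using q qab by (intro mult_le_mono1) linarith
    have b2: "(a + 1) * n \<le> (r + 1) div 2 * n" using q qab e by (intro mult_le_mono1) linarith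
    have b3: "(a + 1) * n = (b + 1) * n + e * n" by (simp add: a_def algebra_simps)
    have b4: "(r div 2 + 1) * n = r div 2 * n + n" by (simp add: distrib_right)
    have "(a + 1) * n \<le> ((r div 2 + 1) * n - s) + e * s"
      using e01
    proof
      assume "e = 0"
      then have "(a + 1) * n = (b + 1) * n" "e * s = 0" using b3 by simp_all
      then show ?thesis using b1 b4 s by linarith
    next
      assume "e = 1"
      then have "(a + 1) * n = (b + 1) * n + n" "e * s = s" using b3 by simp_all
      then show ?thesis using b1 b4 s by linarith
    qed
    then show "(a + 1) * n \<le> band_size r n s + e * s"
      using b2 unfolding band_size_def min_def by (auto intro: trans_le_add1)
  qed
  have band_linear: "\<exists>c. vm.row_linear (band_minor e r tr n s :: 'k gpoly) c" if s: "s < n" for s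
  proof -
    let ?L = "band_size r n s" and ?ro = "e * s" and ?co = "(1 - e) * s"
    have ro: "?ro \<le> a * n" and rows: "(a + 1) * n \<le> ?L + ?ro" using offset[OF s] by auto
    let ?\<rho> = "\<lambda>i. a * n + i - ?ro"
    let ?C = "{l. l < ?L \<and> b * n \<le> l + ?co \<and> l + ?co < (b + 2) * n}"
    let ?\<gamma> = "\<lambda>l. l + ?co - b * n"
    have "(a + 1) * n = a * n + n" by (simp add: distrib_right)
    then have rho: "?\<rho> i < ?L" "?\<rho> i + ?ro = a * n + i" if "i < n" for i
      using that ro rows by linarith+
    show ?thesis
      unfolding band_minor_def
    proof (rule vm.row_linear_det[of _ ?L ?\<rho> ?C ?\<gamma>])
      show "band_mat e tr n s ?L \<in> carrier_mat ?L ?L" by (simp add: band_mat_def)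
      show "?\<rho> i < ?L" if "i < n" for i by (rule rho(1)[OF that])
      show "?\<rho> i \<noteq> ?\<rho> (n - 1)" if "i < n - 1" for i using that ro by linarith
      show "?C \<subseteq> {..<?L}" by auto
      show "?\<gamma> ` ?C \<subseteq> {..<2 * n}" by (auto simp: distrib_right)
    next
      fix i l assume i: "i < n" and l: "l < ?L"
      have supp: "(l + ?co) div n + e = a \<or> (l + ?co) div n + e = a + 1 \<longleftrightarrow> l \<in> ?C"
      proof -
        have "(l + ?co) div n + e = a \<or> (l + ?co) div n + e = a + 1 \<longleftrightarrow> b \<le> (l + ?co) div n \<and> (l + ?co) div n < b + 2"
          unfolding a_def by linarith
        then show ?thesis using l by (simp add: less_eq_div_iff_mult_less_eq[OF n] div_less_iff_less_mult[OF n])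
      qed
      have div: "(a * n + i) div n = a" using i by simp
      have var: "block_var tr n (a * n + i) (l + ?co) = window_var tr n (q * n) i (?\<gamma> l)" if "l \<in> ?C"
        using that unfolding block_var_shift window_var_def qab(1) by (simp add: distrib_right)
      have "band_mat e tr n s ?L $$ (?\<rho> i, l) = (band_entry e tr n (?\<rho> i + ?ro) (l + ?co) :: 'k gpoly)"
        unfolding band_mat_def using rho(1)[OF i] l by (simp only: index_mat prod.case)
      also have "\<dots> = (if l \<in> ?C then mvar (block_var tr n (a * n + i) (l + ?co)) else 0)"
        unfolding rho(2)[OF i] band_entry_def div supp ..
      also have "\<dots> = (if l \<in> ?C then mvar (window_var tr n (q * n) i (?\<gamma> l)) else 0)"
      proof (cases "l \<in> ?C")
        case True
        show ?thesis unfolding if_P[OF True] var[OF True] ..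
      next
        case False
        show ?thesis unfolding if_not_P[OF False] ..
      qed
      finally show "band_mat e tr n s ?L $$ (?\<rho> i, l) =
        (if l \<in> ?C then mvar (window_var tr n (q * n) i (?\<gamma> l)) else 0 :: 'k gpoly)" .
    next
      fix i l assume i: "i < ?L" and l: "l < ?L" and ne: "i \<noteq> ?\<rho> (n - 1)"
      let ?A = "(i + ?ro) div n" and ?B = "(l + ?co) div n"
      show "band_mat e tr n s ?L $$ (i, l) \<in> polys (gvars r n - vm.last_row)"
      proof (cases "?B + e = ?A \<or> ?B + e = ?A + 1")
        case False then show ?thesis using i l by (auto simp: band_mat_def band_entry_def)
      next
        case True
        have "block_var tr n (i + ?ro) (l + ?co) \<noteq> window_var tr n (q * n) (n - 1) j" if j: "j < 2 * n" for j
        proof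
          assume eq: "block_var tr n (i + ?ro) (l + ?co) = window_var tr n (q * n) (n - 1) j"
          have "(q * n + j) div n = q + j div n" using n by simp
          moreover have "j div n < 2" using j n by (simp add: div_less_iff_less_mult)
          moreover have "?A + ?B = (n - 1) div n + (q * n + j) div n" "(i + ?ro) mod n = (n - 1) mod n"
            using eq by (auto simp: window_var_def block_var_def split: if_splits)
          ultimately have AB: "?A + ?B = q \<or> ?A + ?B = q + 1" and m: "(i + ?ro) mod n = n - 1" using n by auto
          have "?A = a" unfolding a_def by (rule band_block_row[OF AB True qab(2) e])
          then have "i + ?ro = a * n + (n - 1)" using m div_mult_mod_eq[of "i + ?ro" n] by simp
          then show False using ne by linarith
        qed
        then have "block_var tr n (i + ?ro) (l + ?co) \<notin> vm.last_row" by (auto simp: vm.last_row_def)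
        moreover have "block_var tr n (i + ?ro) (l + ?co) \<in> gvars r n"
          by (rule block_var_gvars[OF n band_position[OF e _ i l]]) (use s in simp)
        ultimately show ?thesis using i l by (auto simp: band_mat_def band_entry_def intro!: polys_mvar)
      qed
    qed
  qed
  have g_cases: "g u = vm.minor_cols (\<lambda>l. l) \<or> g u = vm.minor_cols (\<lambda>l. n + l) \<or>
     g u = band_minor e r tr n (S u) \<and> S u < n" if "u \<le> n" for u
    using S[of u] that by (auto simp: g_def)
  have lin: "\<exists>c. vm.row_linear (g u) c" if "u \<le> n" for u
    using g_cases[OF that]
  proof (elim disjE conjE)
    assume "g u = vm.minor_cols (\<lambda>l. l)"
    then show ?thesis using vm.row_linear_minor_cols[OF increasing_bound[OF inc0]] by simp
  next
    assume "g u = vm.minor_cols (\<lambda>l. n + l)"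
    then show ?thesis using vm.row_linear_minor_cols[OF increasing_bound[OF incn]] by simp
  next
    assume "g u = band_minor e r tr n (S u)" "S u < n"
    then show ?thesis using band_linear[of "S u"] by simp
  qed
  then obtain c where c: "\<And>u. u \<le> n \<Longrightarrow> vm.row_linear (g u) (c u)" by metis
  have g_polys: "g u \<in> carrier ?S" if "u \<le> n" for u
    using g_cases[OF that]
  proof (elim disjE conjE)
    assume "g u = vm.minor_cols (\<lambda>l. l)"
    then show ?thesis using vm.minor_cols_polys[OF increasing_bound[OF inc0]] by simp
  next
    assume "g u = vm.minor_cols (\<lambda>l. n + l)"
    then show ?thesis using vm.minor_cols_polys[OF increasing_bound[OF incn]] by simp
  next
    assume "g u = band_minor e r tr n (S u)" "S u < n"
    then show ?thesis using band_minor_polys[OF e, of "S u" n] by simp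
  qed
  have g_in: "g u \<in> ?I" if "u \<le> n" for u
    by (rule vm.param_eq_0_imp_in_ideal[OF g_polys[OF that] vm.param_row_linear[OF c[OF that]]])
  have g_class: "PIdl\<^bsub>?S\<^esub> (g u) \<in> knutson_class ?S f" if u: "u \<in> {..n}" for u
  proof -
    consider "u = 0" | "u = n" "u \<noteq> 0" | "u \<noteq> 0" "u < n" using u by fastforce
    then show ?thesis
    proof cases
      case 1
      have "q < r" using q by simp
      from blocks[OF this] show ?thesis using 1 by (simp add: g_def vm.minor_cols_def window_var_def)
    next
      case 2
      have "q + 1 < r" using q by simp
      from blocks[OF this] show ?thesis using 2 by (simp add: g_def vm.minor_cols_def window_var_def distrib_right add.assoc)
    next
      case 3
      then show ?thesis using bands[OF e S[OF 3]] by (simp add: g_def)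
    qed
  qed
  have A: "finite {..n}" "{..n} \<noteq> {}" by auto
  have "\<exists>J\<in>knutson_class ?S f. (\<forall>u\<in>{..n}. PIdl\<^bsub>?S\<^esub> (g u) \<subseteq> J) \<and>
      (\<forall>I. ideal I ?S \<longrightarrow> (\<forall>u\<in>{..n}. PIdl\<^bsub>?S\<^esub> (g u) \<subseteq> I) \<longrightarrow> J \<subseteq> I)"
    by (rule knutson_class_sum[OF f A g_class])
  then obtain J where J: "J \<in> knutson_class ?S f" "\<forall>u\<in>{..n}. PIdl\<^bsub>?S\<^esub> (g u) \<subseteq> J"
    "\<forall>I. ideal I ?S \<longrightarrow> (\<forall>u\<in>{..n}. PIdl\<^bsub>?S\<^esub> (g u) \<subseteq> I) \<longrightarrow> J \<subseteq> I"
    by (elim bexE conjE)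
  have sub: "J \<subseteq> ?I"
  proof (rule J(3)[rule_format, OF vm.ideal_max_minors])
    fix u assume "u \<in> {..n}"
    then show "PIdl\<^bsub>?S\<^esub> (g u) \<subseteq> ?I"
      by (intro R.cgenideal_minimal[OF vm.ideal_max_minors] g_in) simp
  qed
  have Nn: "2 * n - n = n" by simp
  have "\<exists>b\<in>carrier ?S. colon_ideal ?S J (PIdl\<^bsub>?S\<^esub> b) = ?I"
  proof (rule vm.max_minors_ideal_eq_colon[OF knutson_class_ideal[OF J(1) f] sub, of g c, unfolded Nn])
    fix u assume u: "u \<le> n"
    show "vm.row_linear (g u) (c u)" by (rule c[OF u])
    have "PIdl\<^bsub>?S\<^esub> (g u) \<subseteq> J" using J(2) u by simp
    then show "g u \<in> J" using R.cgenideal_self[OF g_polys[OF u]] by blast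
    consider "u = 0" | "u = n" "u \<noteq> 0" | "u \<noteq> 0" "u < n" using u by fastforce
    then have "g u \<noteq> 0 \<and> lookup (lm (g u)) (window_var tr n (q * n) (n - 1) (n - 1 + u)) \<noteq> 0"
    proof cases
      case 1
      then show ?thesis
        unfolding g_def using vm.lm_minor_cols(1,2)[OF inc0, where ?'k = 'k] n
        by (auto simp: lookup_sum_single intro!: bexI[of _ "n - 1"])
    next
      case 2
      then have eq: "g u = vm.minor_cols (\<lambda>l. n + l)" by (simp add: g_def)
      note l = vm.lm_minor_cols(1,2)[OF incn, where ?'k = 'k]
      have "window_var tr n (q * n) (n - 1) (n + (n - 1)) = window_var tr n (q * n) (n - 1) (n - 1 + u)"
        using 2 by (simp only: add.commute)
      then have "\<exists>i\<in>{..<n}. window_var tr n (q * n) i (n + i) = window_var tr n (q * n) (n - 1) (n - 1 + u)"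
        using vm.last_less by blast
      then show ?thesis unfolding eq l(2) lookup_sum_single[OF finite_lessThan] using l(1) by auto
    next
      case 3
      let ?s = "S u"
      have gu: "g u = band_minor e r tr n ?s" using 3 by (simp add: g_def)
      note lmb = lm_band_minor[OF e S(2)[OF 3], where ?'k = 'k and r = r and tr = tr]
      let ?t = "a * n + (n - 1) - e * ?s"
      have ro: "e * ?s \<le> a * n" using offset(1)[OF S(2)[OF 3]] .
      have "(a + 1) * n = a * n + n" by (simp add: distrib_right)
      then have tL: "?t < band_size r n ?s" using offset[OF S(2)[OF 3]] n by linarith
      have R: "?t + e * ?s = a * n + (n - 1)" using ro by simp
      have C: "a * n + (?t + (1 - e) * ?s) = q * n + (n - 1 + u)"
      proof (cases "e = 0")
        case True
        then show ?thesis using qab by (simp add: S_def a_def algebra_simps)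
      next
        case False
        then have e1: "e = 1" using e by simp
        have "q * n = a * n + b * n" "a * n = b * n + n" using qab e1 by (simp_all add: a_def algebra_simps)
        then show ?thesis using e1 3 n by (simp add: S_def)
      qed
      have "block_var tr n (?t + e * ?s) (?t + (1 - e) * ?s) = window_var tr n (q * n) (n - 1) (n - 1 + u)"
        unfolding R block_var_shift window_var_def C ..
      then show ?thesis
        unfolding gu using lmb(1) unfolding lmb(2) lookup_sum_single[OF finite_lessThan]
        using tL by auto
    qed
    then show "g u \<noteq> 0" "lookup (lm (g u)) (window_var tr n (q * n) (n - 1) (n - 1 + u)) \<noteq> 0" by auto
  qed
  then obtain b where "b \<in> carrier ?S" "colon_ideal ?S J (PIdl\<^bsub>?S\<^esub> b) = ?I" by blast
  then have "?I \<in> knutson_class ?S f"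
    using knutson_class.colon[OF J(1) R.cgenideal_ideal] by metis
  then show ?thesis unfolding window_ideal_def by simp
qed

section \<open>The leading monomial of the product\<close>

text \<open>The variables on the diagonals of the minors \<open>\<Delta>\<^sup>u\<close>: above the diagonal in the blocks with odd
  number, below it in the others.\<close>

definition upper_vars :: "nat \<Rightarrow> nat \<Rightarrow> (nat \<times> nat \<times> nat) set" where
  "upper_vars r n = {(k, i, j). (k, i, j) \<in> gvars r n \<and> (if odd k then i < j else j < i)}"

lemma block_var_odd:
  "i < n \<Longrightarrow> j < n \<Longrightarrow> block_var False n (a * n + i) (a * n + j) = (2 * a + 1, i + 1, j + 1)"
  and block_var_even:
  "i < n \<Longrightarrow> j < n \<Longrightarrow> block_var False n (a * n + i) ((a + 1) * n + j) = (2 * a + 2, i + 1, j + 1)"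
  by (simp_all add: block_var_def add.assoc)

text \<open>The diagonal of \<open>\<Delta>\<^sup>u\<close> runs at distance \<open>u\<close> above the diagonal of a block with odd number,
  continues at distance \<open>n - u\<close> below the diagonal of the next block, and so on. So a variable in
  \<open>upper_vars\<close> determines \<open>u\<close> and its place on the diagonal.\<close>

lemma sum_upper_vars:
  fixes h :: "nat \<times> nat \<times> nat \<Rightarrow> 'a::comm_monoid_add"
  shows "(\<Sum>u = 1..n - 1. \<Sum>t<band_size r n u. h (block_var False n t (t + u))) = (\<Sum>w\<in>upper_vars r n. h w)"
proof -
  let ?S = "SIGMA u : {1..n - 1}. {..<band_size r n u}"
  let ?fw = "\<lambda>(u, t). block_var False n t (t + u)"
  \<comment> \<open>The inverse of \<open>?fw\<close>: offset and row of the variable \<open>(k, i, j)\<close>.\<close>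
  let ?bw = "\<lambda>(k, i, j). if odd k then (j - i, k div 2 * n + (i - 1)) else (n + j - i, (k div 2 - 1) * n + (i - 1))"
  have "(\<Sum>u = 1..n - 1. \<Sum>t<band_size r n u. h (block_var False n t (t + u))) = (\<Sum>x\<in>?S. h (?fw x))"
    by (subst sum.Sigma) (auto intro!: sum.cong)
  also have "\<dots> = (\<Sum>w\<in>upper_vars r n. h w)"
  proof (rule sum.reindex_bij_witness[of _ ?bw ?fw])
    fix x assume "x \<in> ?S"
    then obtain u t where x: "x = (u, t)" and u: "1 \<le> u" "u < n" and t: "t < band_size r n u" by fastforce
    have n: "0 < n" using u by simp
    define a i where "a = t div n" and "i = t mod n"
    have ti: "t = a * n + i" "i < n" using n by (simp_all add: a_def i_def)
    have pos: "?fw x \<in> gvars r n"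
      using band_position[of 0 u n t r t] t u by (auto simp: x intro!: block_var_gvars[OF n])
    have "?bw (?fw x) = x \<and> ?fw x \<in> upper_vars r n"
    proof (cases "i + u < n")
      case True
      have fw: "?fw x = (2 * a + 1, i + 1, i + u + 1)"
        using block_var_odd[OF ti(2) True, of a] by (simp add: x ti(1) add.assoc)
      then have "?bw (?fw x) = x" by (simp add: x ti(1))
      moreover have "?fw x \<in> upper_vars r n" using pos fw u by (simp add: upper_vars_def)
      ultimately show ?thesis by blast
    next
      case False
      have "t + u = (a + 1) * n + (i + u - n)" using False by (simp add: ti(1) distrib_right)
      moreover have "i + u - n < n" using ti(2) u by linarith
      ultimately have fw: "?fw x = (2 * a + 2, i + 1, i + u - n + 1)"
        using block_var_even[OF ti(2), of "i + u - n" a] by (simp add: x ti(1))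
      have "?bw (?fw x) = x" unfolding fw using False by (simp add: x ti(1))
      moreover have "?fw x \<in> upper_vars r n" using pos fw ti(2) u False by (auto simp: upper_vars_def)
      ultimately show ?thesis by blast
    qed
    then show "?bw (?fw x) = x" "?fw x \<in> upper_vars r n" by blast+
  next
    fix w assume w: "w \<in> upper_vars r n"
    then obtain k i j where kij: "w = (k, i, j)" "k \<in> {1..r}" "i \<in> {1..n}" "j \<in> {1..n}"
      and ij: "if odd k then i < j else j < i" by (auto simp: upper_vars_def gvars_def)
    have up: "(a + 1) * n \<le> c * n" if "a + 1 \<le> c" for a c using that by (rule mult_le_mono1)
    have st: "(a + 1) * n = a * n + n" for a by (simp add: distrib_right)
    have "?fw (?bw w) = w \<and> ?bw w \<in> ?S"
    proof (cases "odd k")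
      case True
      then obtain a where a: "k = 2 * a + 1" by (elim oddE)
      have bw: "?bw w = (j - i, a * n + (i - 1))" by (simp add: kij(1) a)
      have "?fw (?bw w) = block_var False n (a * n + (i - 1)) (a * n + (j - 1))"
        unfolding bw using ij True kij by (simp add: add.assoc)
      also have "\<dots> = w" using block_var_odd[of "i - 1" n "j - 1" a] kij a by auto
      finally have 1: "?fw (?bw w) = w" .
      have "a + 1 \<le> (r + 1) div 2" "a + 1 \<le> r div 2 + 1" using kij(2) a by auto
      from up[OF this(1)] up[OF this(2)] have b: "a * n + n \<le> (r + 1) div 2 * n" "a * n + n \<le> (r div 2 + 1) * n"
        unfolding st[of a] by blast+
      have "1 \<le> i" "i \<le> n" "j \<le> n" "i < j" using kij(3,4) ij True by auto
      with b have "a * n + (i - 1) < band_size r n (j - i)"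
        unfolding band_size_def min_less_iff_conj by linarith
      then have "?bw w \<in> ?S" unfolding bw using kij(3,4) ij True by auto
      with 1 show ?thesis by blast
    next
      case False
      then obtain c where c: "k = 2 * c" unfolding not_not by (rule evenE)
      define a where "a = c - 1"
      have "1 \<le> k" using kij(2) by simp
      then have a: "k = 2 * a + 2" using c unfolding a_def by linarith
      have bw: "?bw w = (n + j - i, a * n + (i - 1))" by (simp add: kij(1) a)
      have "a * n + (i - 1) + (n + j - i) = (a + 1) * n + (j - 1)" using kij(3,4) by (simp add: st)
      then have "?fw (?bw w) = block_var False n (a * n + (i - 1)) ((a + 1) * n + (j - 1))"
        unfolding bw by simp
      also have "\<dots> = w" using block_var_even[of "i - 1" n "j - 1" a] kij a by auto
      finally have 1: "?fw (?bw w) = w" .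
      have "a + 1 \<le> (r + 1) div 2" "(a + 1) + 1 \<le> r div 2 + 1" using kij(2) a by auto
      from up[OF this(1)] up[OF this(2)] have b: "a * n + n \<le> (r + 1) div 2 * n" "(a + 1) * n + n \<le> (r div 2 + 1) * n"
        unfolding st[of a] st[of "a + 1"] by blast+
      have "1 \<le> i" "i \<le> n" "1 \<le> j" "j < i" using kij(3,4) ij False by auto
      with b st[of a] have "a * n + (i - 1) < band_size r n (n + j - i)"
        unfolding band_size_def min_less_iff_conj by linarith
      then have "?bw w \<in> ?S" unfolding bw using kij(3,4) ij False by auto
      with 1 show ?thesis by blast
    qed
    then show "?fw (?bw w) = w" "?bw w \<in> ?S" by blast+
  qed auto
  finally show ?thesis .
qed

text \<open>The diagonals of all factors of \<open>f\<close> together pass through every variable exactly once; the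
  diagonals of the \<open>\<Delta>\<^sub>u\<close> are those of the \<open>\<Delta>\<^sup>u\<close> with both indices inside the blocks exchanged.\<close>

lemma sum_gvars:
  fixes h :: "nat \<times> nat \<times> nat \<Rightarrow> 'a::comm_monoid_add"
  shows "(\<Sum>k = 1..r. \<Sum>i<n. h (k, i + 1, i + 1)) +
     (\<Sum>u = 1..n - 1. (\<Sum>t<band_size r n u. h (block_var False n (t + u) t)) +
        (\<Sum>t<band_size r n u. h (block_var False n t (t + u)))) = (\<Sum>w\<in>gvars r n. h w)"
proof -
  let ?D = "{(k, i, j). (k, i, j) \<in> gvars r n \<and> i = j}"
  let ?W = "{(k, i, j). (k, i, j) \<in> gvars r n \<and> (if odd k then j < i else i < j)}"
  let ?sw = "\<lambda>(k, i, j). (k, j, i) :: nat \<times> nat \<times> nat"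
  have fin: "finite (gvars r n)" by (simp add: gvars_def)
  have D: "(\<Sum>k = 1..r. \<Sum>i<n. h (k, i + 1, i + 1)) = (\<Sum>w\<in>?D. h w)"
    unfolding sum.cartesian_product
    by (rule sum.reindex_bij_witness[of _ "\<lambda>(k, i, j). (k, i - 1)" "\<lambda>(k, i). (k, i + 1, i + 1)"])
       (auto simp: gvars_def)
  have sw: "block_var False n (t + u) t = ?sw (block_var False n t (t + u))" for t u
    by (simp add: block_var_def)
  have W: "(\<Sum>u = 1..n - 1. \<Sum>t<band_size r n u. h (block_var False n (t + u) t)) = (\<Sum>w\<in>?W. h w)"
  proof -
    have "(\<Sum>u = 1..n - 1. \<Sum>t<band_size r n u. h (block_var False n (t + u) t)) = (\<Sum>w\<in>upper_vars r n. h (?sw w))"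
      unfolding sw by (rule sum_upper_vars)
    also have "\<dots> = (\<Sum>w\<in>?W. h w)"
      by (rule sum.reindex_bij_witness[of _ ?sw ?sw]) (auto simp: upper_vars_def gvars_def split: if_splits)
    finally show ?thesis .
  qed
  have "(\<Sum>w\<in>gvars r n. h w) = (\<Sum>w\<in>?D \<union> (?W \<union> upper_vars r n). h w)"
    by (rule sum.cong) (auto simp: upper_vars_def)
  also have "\<dots> = (\<Sum>w\<in>?D. h w) + ((\<Sum>w\<in>?W. h w) + (\<Sum>w\<in>upper_vars r n. h w))"
  proof -
    have f: "finite ?D" "finite ?W" "finite (upper_vars r n)"
      by (rule finite_subset[OF _ fin]; auto simp: upper_vars_def)+
    have "?W \<inter> upper_vars r n = {}" "?D \<inter> (?W \<union> upper_vars r n) = {}"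
      by (auto simp: upper_vars_def split: if_splits)
    then show ?thesis using f by (simp add: sum.union_disjoint)
  qed
  finally show ?thesis by (simp only: D sum.distrib W sum_upper_vars)
qed

lemma det_X_mat:
  "det (X_mat n (k + 1)) = (det (mat n n (\<lambda>(i, l). mvar (block_var tr n i (k * n + l)))) :: 'k::comm_ring_1 gpoly)"
proof -
  let ?B = "mat n n (\<lambda>(i, l). mvar (block_var tr n i (k * n + l))) :: 'k gpoly mat"
  have X: "X_mat n (k + 1) = (if tr then ?B\<^sup>T else ?B)"
    by (auto intro!: eq_matI simp: X_mat_def block_var_def)
  have t: "det (?B\<^sup>T) = det ?B" by (rule det_transpose[of _ n]) simp
  show ?thesis
  proof (cases tr)
    case True
    show ?thesis using t unfolding X if_P[OF True] .
  next
    case False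
    show ?thesis unfolding X if_not_P[OF False] ..
  qed
qed

lemma lm_det_X_mat:
  shows "det (X_mat n k) \<noteq> (0 :: 'k::idom gpoly)"
    and "lm (det (X_mat n k) :: 'k gpoly) = (\<Sum>i<n. single (k, i + 1, i + 1) 1)"
    and "lookup (det (X_mat n k) :: 'k gpoly) (lm (det (X_mat n k) :: 'k gpoly)) = 1"
proof -
  have mono: "(k, i + 1, i + 1) < (k, i' + 1, j' + 1)" if "i \<le> i'" "i \<le> j'" "(i', j') \<noteq> (i, i)" for i i' j' :: nat
    using that by (auto simp: less_prod_def')
  note * = lm_det_variables[of "X_mat n k :: 'k gpoly mat" n "\<lambda>i j. (k, i + 1, j + 1)", OF _ _ _ mono]
  show "det (X_mat n k) \<noteq> (0 :: 'k gpoly)" by (rule *(1)) (simp_all add: X_mat_def)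
  show "lm (det (X_mat n k) :: 'k gpoly) = (\<Sum>i<n. single (k, i + 1, i + 1) 1)"
    by (rule *(2)) (simp_all add: X_mat_def)
  show "lookup (det (X_mat n k) :: 'k gpoly) (lm (det (X_mat n k) :: 'k gpoly)) = 1"
    by (rule *(3)) (simp_all add: X_mat_def)
qed

lemma det_X_mat_polys: "k \<in> {1..r} \<Longrightarrow> det (X_mat n k) \<in> polys (gvars r n)"
  by (rule polys_det[of _ n]) (auto simp: X_mat_def gvars_def intro!: polys_mvar)

lemma f_poly_eq:
  "f_poly r n = (\<Prod>k = 1..r. det (X_mat n k)) *
     (\<Prod>u = 1..n - 1. band_minor 1 r False n u * (band_minor 0 r False n u :: 'k::comm_ring_1 gpoly))"
  by (simp add: f_poly_def Delta_lower_eq Delta_upper_eq)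

lemma lm_f_poly:
  assumes n: "0 < n"
  shows "f_poly r n \<noteq> (0 :: 'k::idom gpoly)"
    and "lm (f_poly r n :: 'k gpoly) = vars_monomial (gvars r n)"
    and "lookup (f_poly r n :: 'k gpoly) (vars_monomial (gvars r n)) = 1"
proof -
  let ?X = "\<lambda>k. det (X_mat n k) :: 'k gpoly"
  let ?B = "\<lambda>e u. band_minor e r False n u :: 'k gpoly"
  have un: "u < n" if "u \<in> {1..n - 1}" for u using that by auto
  note b0 = lm_band_minor[of 0, OF zero_le un, where ?'k = 'k and r = r and tr = False]
  note b1 = lm_band_minor[of 1, OF order_refl un, where ?'k = 'k and r = r and tr = False]
  have nz: "?X k \<noteq> 0" "u \<in> {1..n - 1} \<Longrightarrow> ?B 1 u * ?B 0 u \<noteq> 0" for k u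
    using lm_det_X_mat(1)[of n k, where ?'k = 'k] b0(1)[of u] b1(1)[of u] by auto
  note PX = prod_lm[of "{1..r}" ?X, OF nz(1)]
  have PB: "lm (\<Prod>u = 1..n - 1. ?B 1 u * ?B 0 u) = (\<Sum>u = 1..n - 1. lm (?B 1 u * ?B 0 u))"
    "lookup (\<Prod>u = 1..n - 1. ?B 1 u * ?B 0 u) (lm (\<Prod>u = 1..n - 1. ?B 1 u * ?B 0 u)) =
      (\<Prod>u = 1..n - 1. lookup (?B 1 u * ?B 0 u) (lm (?B 1 u * ?B 0 u)))"
    by (rule prod_lm, rule nz(2), assumption)+
  have pX: "(\<Prod>k = 1..r. ?X k) \<noteq> 0" using nz(1) by simp
  have pB: "(\<Prod>u = 1..n - 1. ?B 1 u * ?B 0 u) \<noteq> 0" using nz(2) by simp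
  show f0: "f_poly r n \<noteq> (0 :: 'k gpoly)" unfolding f_poly_eq using pX pB by simp
  have "lm (f_poly r n :: 'k gpoly) = (\<Sum>k = 1..r. lm (?X k)) + (\<Sum>u = 1..n - 1. lm (?B 1 u * ?B 0 u))"
    unfolding f_poly_eq lm_mult[OF pX pB] PX(1) PB(1) ..
  also have "(\<Sum>u = 1..n - 1. lm (?B 1 u * ?B 0 u)) = (\<Sum>u = 1..n - 1.
      (\<Sum>t<band_size r n u. single (block_var False n (t + u) t) 1) +
      (\<Sum>t<band_size r n u. single (block_var False n t (t + u)) 1))"
    by (rule sum.cong[OF refl]) (simp add: lm_mult b0(1) b1(1), simp add: b0(2) b1(2))
  finally show lm: "lm (f_poly r n :: 'k gpoly) = vars_monomial (gvars r n)"
    unfolding lm_det_X_mat(2) vars_monomial_def sum_gvars[of "\<lambda>w. single w 1", symmetric] .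
  have lB: "lookup (?B 1 u * ?B 0 u) (lm (?B 1 u * ?B 0 u)) = 1" if "u \<in> {1..n - 1}" for u
    using lookup_mult_lm[OF b1(1)[OF that] b0(1)[OF that]] b0(3)[OF that] b1(3)[OF that]
    by (simp add: lm_mult[OF b1(1)[OF that] b0(1)[OF that]])
  have "lookup (f_poly r n :: 'k gpoly) (lm (f_poly r n :: 'k gpoly)) =
     (\<Prod>k = 1..r. lookup (?X k) (lm (?X k))) *
     (\<Prod>u = 1..n - 1. lookup (?B 1 u * ?B 0 u) (lm (?B 1 u * ?B 0 u)))"
    unfolding f_poly_eq lm_mult[OF pX pB] lookup_mult_lm[OF pX pB] PX(2) PB(2) ..
  also have "\<dots> = 1" using lB by (simp add: lm_det_X_mat(3))
  finally show "lookup (f_poly r n :: 'k gpoly) (vars_monomial (gvars r n)) = 1" unfolding lm .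
qed

lemma f_poly_polys: "f_poly r n \<in> polys (gvars r n)"
  unfolding f_poly_eq
  by (intro polys_mult polys_prod det_X_mat_polys band_minor_polys) auto

lemma f_poly_divisor_X:
  assumes "0 < n" "k \<in> {1..r}"
  shows "PIdl\<^bsub>mpoly_ring (gvars r n)\<^esub> (det (X_mat n k)) \<in> knutson_class (mpoly_ring (gvars r n)) (f_poly r n :: 'k::idom gpoly)"
proof -
  let ?h = "(\<Prod>k\<in>{1..r} - {k}. det (X_mat n k)) *
     (\<Prod>u = 1..n - 1. band_minor 1 r False n u * (band_minor 0 r False n u :: 'k gpoly))"
  have f: "f_poly r n = det (X_mat n k) * ?h"
    unfolding f_poly_eq using assms(2) by (subst prod.remove[of "{1..r}" k]) (simp_all add: mult.assoc)
  show ?thesis unfolding f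
  proof (rule knutson_class_divisor)
    show "det (X_mat n k) \<in> polys (gvars r n)" by (rule det_X_mat_polys[OF assms(2)])
    show "?h \<in> polys (gvars r n)"
      by (intro polys_mult polys_prod det_X_mat_polys band_minor_polys) auto
    show "?h \<noteq> 0" using lm_f_poly(1)[OF assms(1), of r, where ?'k = 'k] unfolding f by auto
  qed
qed

lemma f_poly_divisor_band:
  assumes "0 < n" "1 \<le> u" "u < n" "e \<le> 1"
  shows "PIdl\<^bsub>mpoly_ring (gvars r n)\<^esub> (band_minor e r tr n u) \<in> knutson_class (mpoly_ring (gvars r n)) (f_poly r n :: 'k::idom gpoly)"
proof -
  have base: "PIdl\<^bsub>mpoly_ring (gvars r n)\<^esub> (band_minor e r False n u) \<in> knutson_class (mpoly_ring (gvars r n)) (f_poly r n :: 'k gpoly)"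
    if e: "e \<le> 1" for e
  proof -
    let ?P = "\<Prod>u\<in>{1..n - 1} - {u}. band_minor 1 r False n u * (band_minor 0 r False n u :: 'k gpoly)"
    let ?h = "(\<Prod>k = 1..r. det (X_mat n k)) * (band_minor (1 - e) r False n u * ?P) :: 'k gpoly"
    have "u \<in> {1..n - 1}" using assms by auto
    then have pr: "(\<Prod>u = 1..n - 1. band_minor 1 r False n u * (band_minor 0 r False n u :: 'k gpoly)) =
       band_minor 1 r False n u * band_minor 0 r False n u * ?P"
      by (intro prod.remove) simp_all
    have e01: "band_minor 1 r False n u * band_minor 0 r False n u =
        band_minor e r False n u * (band_minor (1 - e) r False n u :: 'k gpoly)"
    proof (cases "e = 0")
      case True
      show ?thesis unfolding True by (simp add: mult.commute)
    next
      case False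
      then have "e = 1" using e by linarith
      then show ?thesis by simp
    qed
    have f: "f_poly r n = band_minor e r False n u * ?h"
      unfolding f_poly_eq pr e01 by (simp only: mult.assoc mult.left_commute)
    show ?thesis unfolding f
    proof (rule knutson_class_divisor)
      show "band_minor e r False n u \<in> polys (gvars r n)"
        using assms e by (intro band_minor_polys) auto
      show "?h \<in> polys (gvars r n)"
        using assms by (intro polys_mult polys_prod det_X_mat_polys band_minor_polys) auto
      show "?h \<noteq> 0" using lm_f_poly(1)[OF assms(1), of r, where ?'k = 'k] unfolding f by auto
    qed
  qed
  show ?thesis
  proof (cases tr)
    case False then show ?thesis using base[OF assms(4)] by simp
  next
    case True
    have "band_minor e r tr n u = (band_minor (1 - e) r False n u :: 'k gpoly)"
      using band_minor_transpose[of e r True n u, where ?'k = 'k] assms(4) True by simp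
    then show ?thesis using base[of "1 - e"] by simp
  qed
qed

lemma window_ideal_knutson_f:
  assumes "0 < n" "2 \<le> r"
  shows "window_ideal r tr n 0 (r * n) \<in> knutson_class (mpoly_ring (gvars r n)) (f_poly r n :: 'k::field gpoly)"
proof (rule window_ideal_knutson[OF assms f_poly_polys])
  fix q assume q: "q + 2 \<le> r"
  show "window_ideal r tr n (q * n) (2 * n) \<in> knutson_class (mpoly_ring (gvars r n)) (f_poly r n :: 'k gpoly)"
  proof (rule pair_ideal_knutson[OF assms(1) q f_poly_polys])
    fix k assume "k < r"
    then have "k + 1 \<in> {1..r}" by simp
    from f_poly_divisor_X[OF assms(1) this]
    show "PIdl\<^bsub>mpoly_ring (gvars r n)\<^esub> (det (mat n n (\<lambda>(i, l). mvar (block_var tr n i (k * n + l)))))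
       \<in> knutson_class (mpoly_ring (gvars r n)) (f_poly r n :: 'k gpoly)"
      unfolding det_X_mat[of n k tr] .
  next
    fix e s :: nat assume "e \<le> 1" "1 \<le> s" "s < n"
    then show "PIdl\<^bsub>mpoly_ring (gvars r n)\<^esub> (band_minor e r tr n s) \<in> knutson_class (mpoly_ring (gvars r n)) (f_poly r n :: 'k gpoly)"
      by (intro f_poly_divisor_band assms(1))
  qed
qed

section \<open>The term order\<close>

lemma zero_le_monomial: "(0 :: 'v::linorder monomial) \<le> m"
proof (rule ccontr)
  assume "\<not> 0 \<le> m"
  then have "m < 0" by simp
  then show False by (simp add: less_poly_mapping_iff)
qed

lemma term_order_lex:
  fixes V :: "'v::linorder set"
  shows "term_order V {(a, b). a \<in> monomials_in V \<and> b \<in> monomials_in V \<and> a \<le> b}"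
  unfolding term_order_def
proof (intro conjI ballI allI impI)
  show "linear_order_on (monomials_in V) {(a, b). a \<in> monomials_in V \<and> b \<in> monomials_in V \<and> a \<le> b}"
    unfolding linear_order_on_def partial_order_on_def preorder_on_def
    by (auto intro!: refl_onI transI antisymI simp: total_on_def)
  show "(0, m) \<in> {(a, b). a \<in> monomials_in V \<and> b \<in> monomials_in V \<and> a \<le> b}" if "m \<in> monomials_in V" for m
    using that zero_le_monomial[of m] by (simp add: monomials_in_def)
  show "(a + c, b + c) \<in> {(a, b). a \<in> monomials_in V \<and> b \<in> monomials_in V \<and> a \<le> b}"
    if "(a, b) \<in> {(a, b). a \<in> monomials_in V \<and> b \<in> monomials_in V \<and> a \<le> b}" "c \<in> monomials_in V" for a b c
    using that by (auto intro: monomials_in_add add_right_mono)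
qed

lemma leading_term_lex:
  fixes g :: "('v::linorder, 'k::comm_ring_1) mpoly"
  assumes "g \<in> polys V" "g \<noteq> 0"
  shows "leading_term {(a, b). a \<in> monomials_in V \<and> b \<in> monomials_in V \<and> a \<le> b} g =
     single (lm g) (lookup g (lm g))"
proof -
  let ?P = "\<lambda>m. m \<in> keys g \<and>
     (\<forall>m'\<in>keys g. (m', m) \<in> {(a, b). a \<in> monomials_in V \<and> b \<in> monomials_in V \<and> a \<le> b})"
  have kV: "m \<in> monomials_in V" if "m \<in> keys g" for m
    using assms(1) that by (auto simp: mem_polys)
  have "(THE m. ?P m) = lm g"
  proof (rule the_equality)
    show "?P (lm g)" using lm_in_keys[OF assms(2)] le_lm[of _ g] kV by auto
    fix m assume "?P m"
    then have "m \<in> keys g" "lm g \<le> m" using lm_in_keys[OF assms(2)] by auto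
    then show "m = lm g" using le_lm[of m g] by (intro order.antisym)
  qed
  then show ?thesis unfolding leading_term_def Let_def by simp
qed

lemma prod_mvar: "(\<Prod>w\<in>V. mvar w) = (single (vars_monomial V) 1 :: ('v, 'k::comm_ring_1) mpoly)"
  unfolding vars_monomial_def
  by (induction V rule: infinite_finite_induct) (simp_all add: mvar_def mult_single)

section \<open>Frobenius splittings\<close>

lemma CHAR_mpoly: "CHAR(('v, 'k::comm_ring_1) mpoly) = CHAR('k)"
proof (rule CHAR_eqI)
  have iff: "(of_nat m :: ('v, 'k) mpoly) = 0 \<longleftrightarrow> (of_nat m :: 'k) = 0" for m
  proof -
    have eq: "(of_nat m :: ('v, 'k) mpoly) = single 0 (of_nat m)" by simp
    show ?thesis
    proof
      assume "(of_nat m :: ('v, 'k) mpoly) = 0"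
      then have "lookup (single 0 (of_nat m) :: ('v, 'k) mpoly) 0 = 0"
        unfolding eq[symmetric] by (simp only: lookup_zero)
      then show "(of_nat m :: 'k) = 0" by (simp only: lookup_single_eq)
    next
      assume "(of_nat m :: 'k) = 0"
      then show "(of_nat m :: ('v, 'k) mpoly) = 0" unfolding eq by (simp only: single_zero)
    qed
  qed
  show "(of_nat CHAR('k) :: ('v, 'k) mpoly) = 0" unfolding iff by simp
  show "CHAR('k) dvd m" if "(of_nat m :: ('v, 'k) mpoly) = 0" for m
    using that unfolding iff of_nat_eq_0_iff_char_dvd .
qed

(* The argument k_type only names the coefficient field. *)
context
  fixes p :: nat and k_type :: "'k::field itself"
  assumes p: "prime p" and char: "CHAR('k) = p" and perfect: "\<forall>a::'k. \<exists>b. b ^ p = a"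
begin

lemma power_p_inject: "(b :: 'k) ^ p = c ^ p \<longleftrightarrow> b = c"
proof
  assume eq: "b ^ p = c ^ p"
  have "((b - c) + c) ^ p = (b - c) ^ p + c ^ p"
    by (rule freshmans_dream) (use p char in auto)
  then have "(b - c) ^ p = 0" using eq by simp
  then show "b = c" by simp
qed simp

lemma pth_root_eq: "(b :: 'k) ^ p = a \<Longrightarrow> pth_root p a = b"
  unfolding pth_root_def by (rule the_equality) (auto simp: power_p_inject)

lemma pth_root_power: "pth_root p (a :: 'k) ^ p = a"
  using perfect pth_root_eq by metis

lemma pth_root_add: "pth_root p (a + b :: 'k) = pth_root p a + pth_root p b"
proof (rule pth_root_eq)
  have "(pth_root p a + pth_root p b) ^ p = pth_root p a ^ p + pth_root p b ^ p"
    by (rule freshmans_dream) (use p char in auto)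
  then show "(pth_root p a + pth_root p b) ^ p = a + b" by (simp add: pth_root_power)
qed

lemma pth_root_mult: "pth_root p (a ^ p * b :: 'k) = a * pth_root p b"
  by (rule pth_root_eq) (simp add: power_mult_distrib pth_root_power)

lemma p_pos: "0 < p" using p by (simp add: prime_gt_0_nat)

lemma pth_root_0: "pth_root p (0 :: 'k) = 0" and pth_root_1: "pth_root p (1 :: 'k) = 1"
  by (rule pth_root_eq; use p_pos in simp)+

lemma trace_map_superset:
  fixes g :: "('v, 'k) mpoly"
  assumes "finite S" "keys g \<subseteq> S"
  shows "trace_map p V g = (\<Sum>m\<in>S. single 0 (pth_root p (lookup g m)) * trace_monomial p V m)"
  unfolding trace_map_def
  by (rule sum.mono_neutral_left) (use assms in \<open>auto simp: in_keys_iff pth_root_0\<close>)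

lemma trace_map_single:
  "trace_map p V (single m c :: ('v, 'k) mpoly) = single 0 (pth_root p c) * trace_monomial p V m"
  by (subst trace_map_superset[of "{m}"]) auto

lemma trace_map_add: "trace_map p V (f + g :: ('v, 'k) mpoly) = trace_map p V f + trace_map p V g"
proof -
  let ?S = "keys f \<union> keys g"
  have "trace_map p V (f + g) =
      (\<Sum>m\<in>?S. single 0 (pth_root p (lookup (f + g) m)) * trace_monomial p V m)"
    by (rule trace_map_superset) (use Poly_Mapping.keys_add[of f g] in auto)
  also have "\<dots> = (\<Sum>m\<in>?S. single 0 (pth_root p (lookup f m)) * trace_monomial p V m) +
      (\<Sum>m\<in>?S. single 0 (pth_root p (lookup g m)) * trace_monomial p V m)"
    by (simp add: lookup_add pth_root_add single_add distrib_right sum.distrib)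
  finally show ?thesis by (subst (1 2) trace_map_superset[of ?S]) auto
qed

lemma trace_map_sum: "trace_map p V (sum f A :: ('v, 'k) mpoly) = (\<Sum>i\<in>A. trace_map p V (f i))"
  by (induction A rule: infinite_finite_induct) (simp_all add: trace_map_add trace_map_def[of _ _ 0])

lemma monomial_pth_power_unique:
  "monomial_pth_power p q m \<Longrightarrow> monomial_pth_power p q' m \<Longrightarrow> q = q'"
  using p_pos by (intro poly_mapping_eqI) (auto simp: monomial_pth_power_def)

lemma trace_monomial_eq:
  "monomial_pth_power p q (m + vars_monomial V) \<Longrightarrow>
    trace_monomial p V m = (single (q - vars_monomial V) 1 :: ('v, 'k) mpoly)"
proof -
  assume q: "monomial_pth_power p q (m + vars_monomial V)"
  have "(THE q. monomial_pth_power p q (m + vars_monomial V)) = q"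
    by (rule the_equality) (use q monomial_pth_power_unique in blast)+
  then show ?thesis using q by (auto simp: trace_monomial_def)
qed

lemma lookup_vars_monomial:
  "finite V \<Longrightarrow> lookup (vars_monomial V) w = (if w \<in> V then 1 else 0)"
  by (simp add: vars_monomial_def lookup_sum lookup_single when_def)

text \<open>This makes the truncated subtraction in \<open>trace_monomial\<close> exact.\<close>

lemma vars_monomial_le:
  assumes "finite V" "monomial_pth_power p q (m + vars_monomial V)"
  shows "lookup (vars_monomial V) w \<le> lookup q w"
proof (cases "w \<in> V")
  case True
  have "lookup (m + vars_monomial V) w = p * lookup q w"
    using assms(2) by (simp only: monomial_pth_power_def)
  then have "p * lookup q w = lookup m w + 1"
    by (simp add: lookup_add lookup_vars_monomial[OF assms(1)] True)
  then have "lookup q w \<noteq> 0" by (metis add_is_0 mult_0_right one_neq_zero)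
  then show ?thesis using True by (simp add: lookup_vars_monomial[OF assms(1)] Suc_le_eq)
qed (simp add: lookup_vars_monomial[OF assms(1)])

lemma trace_monomial_shift:
  assumes V: "finite V" and pm: "monomial_pth_power p m pm"
  shows "trace_monomial p V (pm + l) = single m 1 * (trace_monomial p V l :: ('v, 'k) mpoly)"
proof (cases "\<exists>q. monomial_pth_power p q (l + vars_monomial V)")
  case True
  then obtain q where q: "monomial_pth_power p q (l + vars_monomial V)" by blast
  then have mq: "monomial_pth_power p (m + q) (pm + l + vars_monomial V)"
    using pm by (simp add: monomial_pth_power_def lookup_add distrib_left)
  have "m + q - vars_monomial V = m + (q - vars_monomial V)"
    by (rule poly_mapping_eqI) (use vars_monomial_le[OF V q] in \<open>simp add: lookup_add lookup_minus\<close>)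
  then show ?thesis by (simp add: trace_monomial_eq[OF q] trace_monomial_eq[OF mq] mult_single)
next
  case False
  have "\<not> monomial_pth_power p q (pm + l + vars_monomial V)" for q
  proof
    assume q: "monomial_pth_power p q (pm + l + vars_monomial V)"
    have *: "p * lookup q w = p * lookup m w + lookup (l + vars_monomial V) w" for w
    proof -
      have "lookup (pm + l + vars_monomial V) w = p * lookup q w"
        "lookup pm w = p * lookup m w"
        using pm q by (simp_all add: monomial_pth_power_def)
      then show ?thesis by (simp add: lookup_add add.assoc)
    qed
    have "lookup (l + vars_monomial V) w = p * lookup (q - m) w" for w
      using *[of w] by (simp add: lookup_minus diff_mult_distrib2)
    then have "monomial_pth_power p (q - m) (l + vars_monomial V)" by (simp add: monomial_pth_power_def)
    then show False using False by blast
  qed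
  then show ?thesis using False by (simp add: trace_monomial_def)
qed

lemma single_power:
  "(single m c :: ('v, 'k) mpoly) ^ k = single (\<Sum>i<k. m) (c ^ k)"
proof (induction k)
  case (Suc k)
  have "(\<Sum>i<Suc k. m) = m + (\<Sum>i<k. m)" by (simp only: sum.lessThan_Suc add.commute)
  then show ?case by (simp only: power_Suc Suc.IH mult_single)
qed simp

text \<open>In characteristic \<open>p\<close> the \<open>p\<close>-th power of a sum of terms is the sum of their \<open>p\<close>-th powers, which
  reduces the claim to \<open>trace_monomial_shift\<close>.\<close>

lemma trace_map_frobenius:
  assumes V: "finite V"
  shows "trace_map p V (a ^ p * b :: ('v, 'k) mpoly) = a * trace_map p V b"
proof -
  let ?pm = "\<lambda>m :: 'v monomial. \<Sum>i<p. m"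
  let ?ka = "keys a" and ?kb = "keys b"
  let ?la = "lookup a" and ?lb = "lookup b"
  have pm: "monomial_pth_power p m (?pm m)" for m
    by (simp add: monomial_pth_power_def lookup_sum)
  have "a ^ p = (\<Sum>m\<in>?ka. single m (?la m)) ^ p" using poly_eq_sum_single[of a] by simp
  also have "\<dots> = (\<Sum>m\<in>?ka. single m (?la m) ^ p)"
    by (rule freshmans_dream_sum) (use p char in \<open>simp_all add: CHAR_mpoly\<close>)
  finally have ap: "a ^ p = (\<Sum>m\<in>?ka. single (?pm m) (?la m ^ p))" by (simp only: single_power)
  have "a ^ p * b = (\<Sum>m\<in>?ka. single (?pm m) (?la m ^ p)) * (\<Sum>l\<in>?kb. single l (?lb l))"
    using poly_eq_sum_single[of b] ap by simp
  also have "\<dots> = (\<Sum>m\<in>?ka. \<Sum>l\<in>?kb. single (?pm m + l) (?la m ^ p * ?lb l))"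
    by (simp only: sum_product mult_single)
  finally have "trace_map p V (a ^ p * b) =
      (\<Sum>m\<in>?ka. \<Sum>l\<in>?kb. single 0 (pth_root p (?la m ^ p * ?lb l)) * trace_monomial p V (?pm m + l))"
    by (simp only: trace_map_sum trace_map_single)
  also have "\<dots> = (\<Sum>m\<in>?ka. \<Sum>l\<in>?kb. single m (?la m) *
      (single 0 (pth_root p (?lb l)) * trace_monomial p V l))"
  proof (intro sum.cong refl)
    fix m l
    have "single 0 (?la m * pth_root p (?lb l)) * single m 1 =
        single m (?la m) * single 0 (pth_root p (?lb l))"
      by (simp add: mult_single)
    then show "single 0 (pth_root p (?la m ^ p * ?lb l)) * trace_monomial p V (?pm m + l) =
        single m (?la m) * (single 0 (pth_root p (?lb l)) * trace_monomial p V l)"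
      unfolding pth_root_mult trace_monomial_shift[OF V pm] mult.assoc[symmetric] by simp
  qed
  also have "\<dots> = (\<Sum>m\<in>?ka. single m (?la m)) * trace_map p V b"
    unfolding trace_map_def by (rule sum_product[symmetric])
  finally show ?thesis using poly_eq_sum_single[of a] by simp
qed

lemma trace_map_polys:
  assumes V: "finite V" and g: "g \<in> polys V"
  shows "trace_map p V (g :: ('v, 'k) mpoly) \<in> polys V"
  unfolding trace_map_def
proof (intro polys_sum polys_mult polys_const)
  fix m assume "m \<in> keys g"
  then have mV: "m \<in> monomials_in V" using g by (auto simp: mem_polys)
  show "(trace_monomial p V m :: ('v, 'k) mpoly) \<in> polys V"
  proof (cases "\<exists>q. monomial_pth_power p q (m + vars_monomial V)")
    case True
    then obtain q where q: "monomial_pth_power p q (m + vars_monomial V)" by blast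
    have "lookup q w = 0" if w: "w \<notin> V" for w
    proof -
      have "w \<notin> keys m" using mV w by (auto simp: monomials_in_def)
      then have "lookup (m + vars_monomial V) w = 0"
        using w by (simp add: lookup_add in_keys_iff lookup_vars_monomial[OF V])
      then show ?thesis using q p_pos by (simp add: monomial_pth_power_def)
    qed
    then have "lookup (q - vars_monomial V) w = 0" if "w \<notin> V" for w
      using that by (simp add: lookup_minus)
    then have "q - vars_monomial V \<in> monomials_in V"
      unfolding monomials_in_def by (metis (no_types, lifting) in_keys_iff mem_Collect_eq subsetI)
    then show ?thesis unfolding trace_monomial_eq[OF q] by (rule polys_single)
  next
    case False then show ?thesis by (simp add: trace_monomial_def)
  qed
qed

text \<open>The leading monomial of \<open>f ^ (p - 1)\<close> is \<open>\<pi> ^ (p - 1)\<close>, whose trace is \<open>1\<close>. If another monomial \<open>m\<close>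
  had nonzero trace, then \<open>m \<pi>\<close> would be a \<open>p\<close>-th power divisible by \<open>\<pi>\<close>, hence by \<open>\<pi> ^ p\<close>; so
  \<open>\<pi> ^ (p - 1)\<close> would divide \<open>m\<close>, although \<open>m\<close> is smaller.\<close>

lemma trace_power_eq_1:
  fixes f :: "('v::linorder, 'k) mpoly"
  assumes V: "finite V" and f: "f \<noteq> 0" "lm f = vars_monomial V" "lookup f (vars_monomial V) = 1"
  shows "trace_map p V (f ^ (p - 1)) = 1"
proof -
  let ?\<pi> = "vars_monomial V" and ?g = "f ^ (p - 1)"
  let ?\<mu> = "\<Sum>i<p - 1. ?\<pi>"
  have lm: "lm ?g = ?\<mu>" using power_lm(1)[OF f(1)] f(2) by simp
  have lc: "lookup ?g ?\<mu> = 1" using power_lm(2)[OF f(1), of "p - 1"] f(2,3) lm by simp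
  have lk: "lookup ?\<mu> w = (p - 1) * lookup ?\<pi> w" for w
    by (simp add: lookup_sum)
  have top: "monomial_pth_power p ?\<pi> (?\<mu> + ?\<pi>)"
    unfolding monomial_pth_power_def
  proof
    fix w
    have "(p - 1) * c + c = p * c" for c using p_pos by (cases p) auto
    then show "lookup (?\<mu> + ?\<pi>) w = p * lookup ?\<pi> w" by (simp only: lookup_add lk)
  qed
  have rest: "trace_monomial p V m = (0 :: ('v, 'k) mpoly)" if m: "m \<in> keys ?g - {?\<mu>}" for m
  proof -
    have "\<not> monomial_pth_power p q (m + ?\<pi>)" for q
    proof
      assume q: "monomial_pth_power p q (m + ?\<pi>)"
      have ge: "lookup ?\<mu> w \<le> lookup m w" for w
      proof -
        have "p * lookup ?\<pi> w \<le> p * lookup q w"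
          using vars_monomial_le[OF V q] by (intro mult_le_mono2)
        also have "\<dots> = lookup m w + lookup ?\<pi> w"
          using q by (simp add: monomial_pth_power_def lookup_add)
        finally show ?thesis unfolding lk by (simp add: diff_mult_distrib)
      qed
      have "m < ?\<mu>" using m le_lm[of m ?g] by (simp add: lm order_less_le)
      then obtain w where "lookup m w < lookup ?\<mu> w"
        by (auto simp only: less_poly_mapping_iff)
      then show False using ge[of w] by simp
    qed
    then show ?thesis by (simp add: trace_monomial_def)
  qed
  have mem: "?\<mu> \<in> keys ?g" using lc by (simp add: in_keys_iff)
  have "trace_map p V ?g = single 0 (pth_root p (lookup ?g ?\<mu>)) * trace_monomial p V ?\<mu>"
    unfolding trace_map_def by (subst sum.remove[OF _ mem]) (simp_all add: rest)
  also have "\<dots> = 1"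
    unfolding lc trace_monomial_eq[OF top] by (simp add: pth_root_1)
  finally show ?thesis .
qed

lemma trace_frobenius_splitting:
  fixes f :: "('v::linorder, 'k) mpoly"
  assumes V: "finite V" and fV: "f \<in> polys V"
    and f: "f \<noteq> 0" "lm f = vars_monomial V" "lookup f (vars_monomial V) = 1"
  shows "frobenius_splitting p (mpoly_ring V) (\<lambda>a. trace_map p V (f ^ (p - 1) * a))"
proof -
  interpret R: cring "mpoly_ring V :: ('v, 'k) mpoly ring" by (rule cring_mpoly_ring)
  have pow: "a [^]\<^bsub>mpoly_ring V\<^esub> (m::nat) = a ^ m" for a :: "('v, 'k) mpoly" and m
    by (induction m) (simp_all add: mult.commute)
  show ?thesis
    unfolding frobenius_splitting_def mpoly_ring_simps pow
  proof (intro conjI ballI funcsetI)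
    show "trace_map p V (f ^ (p - 1) * a) \<in> polys V" if "a \<in> polys V" for a
      using fV that by (intro trace_map_polys[OF V] polys_mult polys_power)
    show "trace_map p V (f ^ (p - 1) * (a + b)) = trace_map p V (f ^ (p - 1) * a) + trace_map p V (f ^ (p - 1) * b)" for a b
      by (simp only: distrib_left trace_map_add)
    show "trace_map p V (f ^ (p - 1) * (a ^ p * b)) = a * trace_map p V (f ^ (p - 1) * b)" for a b
      unfolding mult.left_commute[of _ "a ^ p"] by (rule trace_map_frobenius[OF V])
    show "trace_map p V (f ^ (p - 1) * 1) = 1" using trace_power_eq_1[OF V f] by simp
  qed
qed

text \<open>For a colon ideal \<open>I : J\<close> and \<open>b \<in> J\<close>, Frobenius linearity moves \<open>b\<close> inside as \<open>b ^ p\<close>, which is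
  more than enough to land in \<open>I\<close>.\<close>

lemma knutson_class_compatibly_split:
  fixes f :: "('v::linorder, 'k) mpoly"
  assumes V: "finite V" and fV: "f \<in> polys V"
    and I: "I \<in> knutson_class (mpoly_ring V) f"
  shows "compatibly_splits (\<lambda>a. trace_map p V (f ^ (p - 1) * a)) I"
proof -
  let ?T = "\<lambda>a. trace_map p V (f ^ (p - 1) * a)"
  have T_polys: "?T a \<in> polys V" if "a \<in> polys V" for a
    using fV that by (intro trace_map_polys[OF V] polys_mult polys_power)
  have "\<forall>a\<in>I. ?T a \<in> I"
    using I
  proof induction
    case principal
    show ?case
    proof
      fix a assume "a \<in> PIdl\<^bsub>mpoly_ring V\<^esub> f"
      then obtain c where c: "c \<in> polys V" "a = c * f" by (auto simp: mem_PIdl)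
      have "f ^ p = f ^ (p - 1) * f" using p_pos by (cases p) simp_all
      then have "f ^ (p - 1) * a = f ^ p * c" unfolding c(2) by (simp only: mult_ac)
      then have "?T a = f * trace_map p V c" by (simp only: trace_map_frobenius[OF V])
      then show "?T a \<in> PIdl\<^bsub>mpoly_ring V\<^esub> f"
        using trace_map_polys[OF V c(1)] by (auto simp: mem_PIdl mult.commute)
    qed
  next
    case (colon I J)
    note iI = knutson_class_ideal[OF colon(1) fV]
    show ?case
    proof
      fix a assume "a \<in> colon_ideal (mpoly_ring V) I J"
      then have a: "a \<in> polys V" "\<And>b. b \<in> J \<Longrightarrow> a * b \<in> I" by (auto simp: colon_ideal_def)
      have "?T a * b \<in> I" if b: "b \<in> J" for b
      proof -
        have bV: "b \<in> polys V" by (rule ideal_subset_polys[OF colon(2) b])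
        have "b ^ (p - 1) * (a * b) \<in> I" by (intro ideal_mult_left[OF iI] a(2) b polys_power bV)
        then have 1: "?T (b ^ (p - 1) * (a * b)) \<in> I" using colon(3) by blast
        have "b ^ p = b ^ (p - 1) * b" using p_pos by (cases p) simp_all
        then have "f ^ (p - 1) * (b ^ (p - 1) * (a * b)) = b ^ p * (f ^ (p - 1) * a)" by (simp only: mult_ac)
        then have "?T (b ^ (p - 1) * (a * b)) = b * ?T a" by (simp only: trace_map_frobenius[OF V])
        then show ?thesis using 1 by (simp add: mult.commute)
      qed
      then show "?T a \<in> colon_ideal (mpoly_ring V) I J" using T_polys[OF a(1)] by (simp add: colon_ideal_def)
    qed
  next
    case (sum I J)
    show ?case
    proof
      fix a assume "a \<in> I <+>\<^bsub>mpoly_ring V\<^esub> J"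
      then obtain b c where bc: "b \<in> I" "c \<in> J" "a = b + c" by (auto simp: set_add_def')
      have "?T a = ?T b + ?T c" unfolding bc(3) distrib_left trace_map_add ..
      then show "?T a \<in> I <+>\<^bsub>mpoly_ring V\<^esub> J" using sum(3,4) bc(1,2) by (auto simp: set_add_def')
    qed
  next
    case (inter I J)
    then show ?case by blast
  qed
  then show ?thesis by (auto simp: compatibly_splits_def)
qed

end

section \<open>Double determinantal ideals\<close>

theorem theorem5p3:
  fixes p r n :: nat
    and f :: "'k::field gpoly"
    and I :: "'k gpoly set"
  assumes "prime p" and "CHAR('k) = p"
    and perfect: "\<forall>a::'k. \<exists>b. b ^ p = a"
    and "r \<ge> 2" and "n \<ge> 1"
    and f: "f = f_poly r n"
    and I: "I = double_det_ideal r n"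
  shows "knutson_ideal (gvars r n) f I \<and>
    frobenius_splitting p (mpoly_ring (gvars r n))
      (\<lambda>a. trace_map p (gvars r n) (f ^ (p - 1) * a)) \<and>
    compatibly_splits (\<lambda>a. trace_map p (gvars r n) (f ^ (p - 1) * a)) I"
proof -
  let ?V = "gvars r n"
  let ?S = "mpoly_ring ?V :: 'k gpoly ring"
  have n: "0 < n" and r: "0 < r" using \<open>n \<ge> 1\<close> \<open>r \<ge> 2\<close> by auto
  have V: "finite ?V" by (simp add: gvars_def)
  have fV: "f \<in> carrier ?S" unfolding f by (rule f_poly_polys)
  have f1: "f \<noteq> 0" "lm f = vars_monomial ?V" "lookup f (vars_monomial ?V) = 1"
    unfolding f by (rule lm_f_poly[OF n])+
  have "minors_ideal ?S n (H_mat r n) \<in> knutson_class ?S f" "minors_ideal ?S n (V_mat r n) \<in> knutson_class ?S f"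
    unfolding f minors_ideal_H[OF n r] minors_ideal_V[OF n r]
    by (rule window_ideal_knutson_f[OF n \<open>r \<ge> 2\<close>])+
  then have I_class: "I \<in> knutson_class ?S f"
    unfolding I double_det_ideal_def Let_def by (rule knutson_class.sum)
  have "leading_term {(a, b). a \<in> monomials_in ?V \<and> b \<in> monomials_in ?V \<and> a \<le> b} f = (\<Prod>w\<in>?V. mvar w)"
    unfolding leading_term_lex[OF fV f1(1)] f1(2,3) prod_mvar ..
  then have "knutson_ideal ?V f I"
    unfolding knutson_ideal_def using fV I_class term_order_lex[of ?V] by blast
  moreover note char_p = \<open>prime p\<close> \<open>CHAR('k) = p\<close> perfect
  have "frobenius_splitting p ?S (\<lambda>a. trace_map p ?V (f ^ (p - 1) * a))"
    by (rule trace_frobenius_splitting[OF char_p V fV f1])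
  moreover have "compatibly_splits (\<lambda>a. trace_map p ?V (f ^ (p - 1) * a)) I"
    by (rule knutson_class_compatibly_split[OF char_p V fV I_class])
  ultimately show ?thesis by blast
qed

end
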